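(* Let $n\ge2$, $\alpha\in[0,1)$, $p\in[2,\frac{n}{1-\alpha})$, $a:=\frac{(p-1)(1-\alpha)(n-1)}{n-p(1-\alpha)}$. Let $\Omega\subset\mathbb{R}^n$ be a uniformly Lipschitz domain of finite Lebesgue measure with $r_\Omega<\infty$ and $-\Delta_F d_F\ge0$ in $\mathcal{D}'(\Omega)$, and suppose $\Omega$ is $(\omega,a-\delta)$-feeble-regular for some $\delta>0$ and open $\omega\Subset\Omega$. Then there exists $C_6>0$ such that for every $u\in C_c^\infty(\Omega)$ \[ \|F(\nabla u)\|_{L^{1,n-n/p}(\Omega)}\le C_6\big(I_p[u;\Omega]\big)^{1/p}. \]
   Context: A domain is a connected open set $\Omega\subset\mathbb{R}^n$ with nonempty boundary. $F:\mathbb{R}^n\to[0,\infty)$ is a norm (even, positively $1$-homogeneous, convex, positive except at the origin) with $F\in C^2(\mathbb{R}^n\setminus\{0\})$ and strongly convex ($\nabla^2(F^2)(\xi)$ positive definite for $\xi\neq0$); $F_\xi$ denotes its gradient. $F^o(\eta)=\sup_{\xi\ne0}\frac{\xi\cdot\eta}{F(\xi)}$, $d_F(x)=\inf_{y\in\partial\Omega}F^o(x-y)$, $r_\Omega:=\sup_\Omega d_F$. $-\Delta_F d_F\ge0$ in $\mathcal{D}'(\Omega)$ means $\int_\Omega F(\nabla d_F)F_\xi(\nabla d_F)\cdot\nabla\varphi\,dx\ge0$ for all $0\le\varphi\in C_c^\infty(\Omega)$. $(\omega,K)$-feeble-regular: for every $\varphi\in W^{1,\infty}_c(\Omega\setminus\omega)$,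 $\varphi\ge0$, $\big|\int_{\Omega\setminus\omega}\tfrac12\nabla F^2(\nabla d_F)\cdot\nabla(\varphi d_F)\,dx\big|\le K\|\varphi\|_{L^1(\Omega\setminus\omega)}$. $I_p[u;\Omega]:=\int_\Omega F^p(\nabla u)\,dx-\big(\frac{p-1}{p}\big)^p\int_\Omega\frac{|u|^p}{d_F^p}dx$. Morrey norm: $\|f\|_{L^{q,\lambda}(\Omega)}:=\big(\sup_{0<r<D_\Omega,\,x_0\in\Omega}r^{-\lambda}\int_{\Omega\cap B_r(x_0)}|f|^q dx\big)^{1/q}$, $D_\Omega$ the diameter of $\Omega$, $B_r(x_0)$ Euclidean balls. *)

theory Defs
  imports "HOL-Analysis.Analysis"
begin

definition pderiv_dir :: "'n::finite \<Rightarrow> (real^'n \<Rightarrow> real) \<Rightarrow> real^'n \<Rightarrow> real" where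
  "pderiv_dir i f x = frechet_derivative f (at x) (axis i 1)"

definition grad :: "(real^'n::finite \<Rightarrow> real) \<Rightarrow> real^'n \<Rightarrow> real^'n" where
  "grad f x = (\<chi> i. pderiv_dir i f x)"

fun Ck_on :: "(real^'n::finite) set \<Rightarrow> nat \<Rightarrow> (real^'n \<Rightarrow> real) \<Rightarrow> bool" where
  "Ck_on S 0 f = continuous_on S f"
| "Ck_on S (Suc k) f = ((\<forall>x\<in>S. f differentiable (at x)) \<and> (\<forall>i. Ck_on S k (pderiv_dir i f)))"

definition tsupp :: "(real^'n::finite \<Rightarrow> real) \<Rightarrow> (real^'n) set" where
  "tsupp f = closure {x. f x \<noteq> 0}"

definition Cc_inf :: "(real^'n::finite) set \<Rightarrow> (real^'n \<Rightarrow> real) set" where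
  "Cc_inf \<Omega> = {u. (\<forall>k. Ck_on UNIV k u) \<and> compact (tsupp u) \<and> tsupp u \<subseteq> \<Omega>}"

definition finsler_norm :: "(real^'n::finite \<Rightarrow> real) \<Rightarrow> bool" where
  "finsler_norm F \<longleftrightarrow>
     (\<forall>x. F x \<ge> 0) \<and>
     (\<forall>x. F (- x) = F x) \<and>
     (\<forall>t x. t \<ge> 0 \<longrightarrow> F (t *\<^sub>R x) = t * F x) \<and>
     convex_on UNIV F \<and>
     (\<forall>x. x \<noteq> 0 \<longrightarrow> F x > 0) \<and>
     Ck_on (UNIV - {0}) 2 F \<and>
     (\<forall>\<xi> h. \<xi> \<noteq> 0 \<longrightarrow> h \<noteq> 0 \<longrightarrow>
        h \<bullet> (\<chi> i. frechet_derivative (\<lambda>y. grad (\<lambda>z. (F z)\<^sup>2) y $ i) (at \<xi>) h) > 0)"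

definition dual_norm :: "(real^'n::finite \<Rightarrow> real) \<Rightarrow> real^'n \<Rightarrow> real" where
  "dual_norm F \<eta> = Sup {(\<xi> \<bullet> \<eta>) / F \<xi> | \<xi>. \<xi> \<noteq> 0}"

definition dF :: "(real^'n::finite \<Rightarrow> real) \<Rightarrow> (real^'n) set \<Rightarrow> real^'n \<Rightarrow> real" where
  "dF F \<Omega> x = Inf ((\<lambda>y. dual_norm F (x - y)) ` frontier \<Omega>)"

definition domain :: "(real^'n::finite) set \<Rightarrow> bool" where
  "domain \<Omega> \<longleftrightarrow> open \<Omega> \<and> connected \<Omega> \<and> \<Omega> \<noteq> {} \<and> frontier \<Omega> \<noteq> {}"

text \<open>Uniformly Lipschitz domain: there are uniform r > 0 and L such that near every
  boundary point x0, inside the ball of radius r around x0, Omega is the region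
  strictly above the graph of an L-Lipschitz function over the hyperplane orthogonal
  to some unit vector e.\<close>
definition uniformly_lipschitz_domain :: "(real^'n::finite) set \<Rightarrow> bool" where
  "uniformly_lipschitz_domain \<Omega> \<longleftrightarrow> domain \<Omega> \<and>
     (\<exists>r L. r > 0 \<and> L \<ge> 0 \<and>
       (\<forall>x0\<in>frontier \<Omega>. \<exists>e g. norm e = 1 \<and> L-lipschitz_on UNIV g \<and>
          \<Omega> \<inter> ball x0 r =
            {x \<in> ball x0 r. (x - x0) \<bullet> e > g ((x - x0) - ((x - x0) \<bullet> e) *\<^sub>R e)}))"

definition superharmonic_dF :: "(real^'n::finite \<Rightarrow> real) \<Rightarrow> (real^'n) set \<Rightarrow> bool" where
  "superharmonic_dF F \<Omega> \<longleftrightarrow>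
     (\<forall>\<phi>\<in>Cc_inf \<Omega>. (\<forall>x. \<phi> x \<ge> 0) \<longrightarrow>
        (LINT x:\<Omega>|lebesgue. F (grad (dF F \<Omega>) x) *
            (grad F (grad (dF F \<Omega>) x) \<bullet> grad \<phi> x)) \<ge> 0)"

definition feeble_regular ::
  "(real^'n::finite \<Rightarrow> real) \<Rightarrow> (real^'n) set \<Rightarrow> (real^'n) set \<Rightarrow> real \<Rightarrow> bool" where
  "feeble_regular F \<Omega> \<omega> K \<longleftrightarrow>
     (\<forall>\<phi> M Kset. M-lipschitz_on UNIV \<phi> \<and> (\<forall>x. \<phi> x \<ge> 0) \<and>
         compact Kset \<and> Kset \<subseteq> \<Omega> - \<omega> \<and> (\<forall>x. x \<notin> Kset \<longrightarrow> \<phi> x = 0) \<longrightarrow>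
       \<bar>LINT x:(\<Omega> - \<omega>)|lebesgue.
           (1/2) * (grad (\<lambda>z. (F z)\<^sup>2) (grad (dF F \<Omega>) x) \<bullet> grad (\<lambda>y. \<phi> y * dF F \<Omega> y) x)\<bar>
         \<le> K * (LINT x:(\<Omega> - \<omega>)|lebesgue. \<bar>\<phi> x\<bar>))"

definition I_p :: "(real^'n::finite \<Rightarrow> real) \<Rightarrow> real \<Rightarrow> (real^'n \<Rightarrow> real) \<Rightarrow> (real^'n) set \<Rightarrow> real" where
  "I_p F p u \<Omega> =
     (LINT x:\<Omega>|lebesgue. (F (grad u x)) powr p)
     - ((p - 1) / p) powr p * (LINT x:\<Omega>|lebesgue. \<bar>u x\<bar> powr p / (dF F \<Omega> x) powr p)"

definition ediam :: "(real^'n::finite) set \<Rightarrow> ereal" where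
  "ediam \<Omega> = Sup {ereal (dist x y) | x y. x \<in> \<Omega> \<and> y \<in> \<Omega>}"

definition morrey_norm1 :: "real \<Rightarrow> (real^'n::finite) set \<Rightarrow> (real^'n \<Rightarrow> real) \<Rightarrow> ereal" where
  "morrey_norm1 lam \<Omega> f =
     Sup {ereal (r powr (- lam) * (LINT x:(\<Omega> \<inter> ball x0 r)|lebesgue. \<bar>f x\<bar>)) | r x0.
            0 < r \<and> ereal r < ediam \<Omega> \<and> x0 \<in> \<Omega>}"

end

theory Submission
  imports Defs "HOL-Real_Asymp.Real_Asymp"
begin

text \<open>
  Put \<open>c = (p - 1) / p\<close> and \<open>v = u d\<^sup>-\<^sup>c\<close>, so that \<open>\<nabla>v = d\<^sup>-\<^sup>c G\<close> with \<open>G = \<nabla>u - (c u / d) \<nabla>d\<close>.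
  Uniform convexity of \<open>F\<^sup>p\<close> and superharmonicity of \<open>d\<close>, tested with \<open>|u|\<^sup>p S(d)\<close> for suitable weights \<open>S\<close>,
  bound both the \<open>p\<close>-th power integral of \<open>G\<close> and that of \<open>u\<close> by the Hardy deficit.
  Since \<open>F (\<nabla>u) \<le> F G + c |u| / d\<close> and \<open>G\<close> is controlled by Hoelder's inequality, it remains to bound the integral
  of \<open>|u| / d = d powr (- 1 / p) |v|\<close> over a ball of radius \<open>r\<close> by \<open>r powr (n - n / p)\<close>.
  In a boundary chart one first transports the ball by dilations into the
  interior: the dilated balls spread out like \<open>(1 + s / r)\<^sup>n\<close>, and as \<open>n \<ge> 2\<close> the resulting
  bound for the derivative of the transported integral of \<open>|v|\<close> is integrable in \<open>s\<close>. A one-dimensional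
  Hardy argument in the vertical direction of the chart then inserts the weight.
  Differentiability of \<open>d\<close> almost everywhere comes from semiconcavity of \<open>d\<^sup>2\<close>, which is dual to
  strong convexity of \<open>F\<^sup>2\<close>.
\<close>

section \<open>Finsler norms\<close>

text \<open>Why dilate and not translate: lifting a ball of radius r straight up by s costs s powr
  (-c) = s powr (1/p - 1) times an L^p norm of G, so transport to a fixed height would contribute a
  constant. What is needed is a factor r powr (1/p), because the weight d powr (-1/p) at height
  about r consumes exactly that much. Along dilations the pulled back L^p norm decays like (1 + s/r)
  powr (-n/p), so beyond s = r the integrand is of order s powr (1/p - 1 - n/p); for n = 1 this
  would be 1/s, with a logarithmic loss. The weak inequality for d is stated for smooth test
  functions, while |u|^p S(d) is only Lipschitz and d only almost everywhere differentiable; hence a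
  mollification whose gradients converge at every point of differentiability. The boundary graphs
  are only Lipschitz as well, so the vertical Hardy argument is carried out with finite translations
  and a limit at the end. Charts handle small radii only; for large ones finite volume and the room
  near every point of \<Omega> yield a finite cover by small balls.\<close>

lemma has_derivative_grad:
  fixes f :: "real^'n::finite \<Rightarrow> real"
  assumes "f differentiable (at x)"
  shows "(f has_derivative (\<lambda>h. grad f x \<bullet> h)) (at x)"
proof -
  let ?D = "frechet_derivative f (at x)"
  have D: "(f has_derivative ?D) (at x)"
    using assms frechet_derivative_works by blast
  then have lin: "linear ?D" by (rule has_derivative_linear)
  have "?D h = grad f x \<bullet> h" for h
  proof -
    have "?D h = ?D (\<Sum>i\<in>UNIV. h $ i *\<^sub>R axis i 1)"
      by (metis basis_expansion scalar_mult_eq_scaleR)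
    also have "\<dots> = (\<Sum>i\<in>UNIV. h $ i * ?D (axis i 1))"
      by (simp add: linear_sum[OF lin] linear_cmul[OF lin] o_def)
    finally show ?thesis
      by (simp add: grad_def pderiv_dir_def inner_vec_def mult.commute)
  qed
  then have "?D = (\<lambda>h. grad f x \<bullet> h)" by auto
  with D show ?thesis by simp
qed

lemma grad_eqI:
  fixes f :: "real^'n::finite \<Rightarrow> real"
  assumes "(f has_derivative (\<lambda>h. w \<bullet> h)) (at x)"
  shows "grad f x = w"
proof -
  have "frechet_derivative f (at x) = (\<lambda>h. w \<bullet> h)"
    using assms frechet_derivative_at by metis
  then show ?thesis
    by (simp add: grad_def pderiv_dir_def vec_eq_iff inner_axis)
qed

lemma powr_ge_tangent:
  fixes A B q :: real
  assumes q: "1 \<le> q" and A: "0 < A" and B: "0 \<le> B"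
  shows "A powr q + q * A powr (q - 1) * (B - A) \<le> B powr q"
proof (cases "B = 0")
  case True
  have "A powr q = A powr (q - 1) * A" using A by (simp add: powr_diff)
  moreover have "A powr (q-1) * A * (1 - q) \<le> 0"
    using q A by (intro mult_nonneg_nonpos) auto
  ultimately show ?thesis using True by (simp add: algebra_simps)
next
  case False
  then have B: "0 < B" using B by simp
  have "q * A powr (q - 1) * (B - A) \<le> B powr q - A powr q"
  proof (rule convex_on_imp_above_tangent[where A="{0<..}"])
    show "convex_on {0<..} (\<lambda>x. x powr q)" by (rule powr_convex[OF q])
    show "((\<lambda>x. x powr q) has_real_derivative q * A powr (q - 1)) (at A within {0<..})"
      using A by (auto intro!: derivative_eq_intros)
  qed (use A B in \<open>auto simp: interior_open\<close>)
  then show ?thesis by simp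
qed

lemma powr_convex_combination:
  fixes a b t p :: real
  assumes "0 \<le> a" "0 \<le> b" "0 \<le> t" "t \<le> 1" "1 \<le> p"
  shows "((1 - t) * a + t * b) powr p \<le> (1 - t) * a powr p + t * b powr p"
proof (cases "(1 - t) * a + t * b = 0")
  case True
  then show ?thesis using assms by simp
next
  case False
  define m where "m = (1 - t) * a + t * b"
  have m: "0 < m" using False assms unfolding m_def
    by (metis add_nonneg_nonneg diff_ge_0_iff_ge less_eq_real_def mult_nonneg_nonneg)
  have "(1-t) * (m powr p + p * m powr (p - 1) * (a - m)) \<le> (1-t) * a powr p"
       "t * (m powr p + p * m powr (p - 1) * (b - m)) \<le> t * b powr p"
    using powr_ge_tangent[of p m] m assms by (auto intro!: mult_left_mono)
  moreover have "(1-t) * (m powr p + p * m powr (p - 1) * (a - m)) + t * (m powr p + p * m powr (p - 1) * (b - m))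
     = m powr p + p * m powr (p - 1) * ((1 - t) * a + t * b - m)"
    by (simp add: algebra_simps)
  ultimately show ?thesis by (simp add: m_def)
qed

locale finsler =
  fixes F :: "real^'n::finite \<Rightarrow> real"
  assumes finsler: "finsler_norm F"
begin

lemma F_nonneg [simp]: "0 \<le> F x"
  and F_minus [simp]: "F (- x) = F x"
  and F_pos: "x \<noteq> 0 \<Longrightarrow> 0 < F x"
  and F_convex: "convex_on UNIV F"
  using finsler unfolding finsler_norm_def by auto

lemma F_scaleR: "F (t *\<^sub>R x) = \<bar>t\<bar> * F x"
proof -
  have *: "\<And>t x. t \<ge> 0 \<Longrightarrow> F (t *\<^sub>R x) = t * F x"
    using finsler unfolding finsler_norm_def by auto
  show ?thesis
  proof (cases "0 \<le> t")
    case False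
    then have "F (t *\<^sub>R x) = F ((-t) *\<^sub>R x)"
      using F_minus[of "t *\<^sub>R x"] by simp
    then show ?thesis using *[of "-t" x] False by simp
  qed (use * in simp)
qed

lemma F_zero [simp]: "F 0 = 0"
  using F_scaleR[of 0 0] by simp

lemma F_eq_0_iff [simp]: "F x = 0 \<longleftrightarrow> x = 0"
  using F_pos[of x] by force

lemma F_triangle: "F (x + y) \<le> F x + F y"
proof -
  have "F ((1 - 1/2) *\<^sub>R (2 *\<^sub>R x) + (1/2) *\<^sub>R (2 *\<^sub>R y)) \<le> (1 - 1/2) * F (2 *\<^sub>R x) + (1/2) * F (2 *\<^sub>R y)"
    by (rule convex_onD[OF F_convex]) auto
  then show ?thesis by (simp add: F_scaleR)
qed

lemma F_continuous: "continuous_on S F"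
  using convex_on_continuous[OF open_UNIV F_convex] continuous_on_subset by blast

lemma F_bounds: "\<exists>a b. 0 < a \<and> 0 < b \<and> (\<forall>x. a * norm x \<le> F x \<and> F x \<le> b * norm x)"
proof -
  have comp: "compact (sphere (0::real^'n) 1)" by simp
  have "axis undefined 1 \<in> sphere (0::real^'n) 1" by simp
  then have ne: "sphere (0::real^'n) 1 \<noteq> {}" by blast
  obtain x0 where x0: "x0 \<in> sphere 0 1" "\<And>y. y \<in> sphere 0 1 \<Longrightarrow> F x0 \<le> F y"
    using continuous_attains_inf[OF comp ne F_continuous] by auto
  obtain x1 where x1: "x1 \<in> sphere 0 1" "\<And>y. y \<in> sphere 0 1 \<Longrightarrow> F y \<le> F x1"
    using continuous_attains_sup[OF comp ne F_continuous] by auto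
  have pos: "0 < F x0" "0 < F x1" using x0(1) x1(1) by (auto intro!: F_pos)
  have "F x0 * norm x \<le> F x \<and> F x \<le> F x1 * norm x" for x
  proof (cases "x = 0")
    case False
    have "(inverse (norm x)) *\<^sub>R x \<in> sphere 0 1" using False by simp
    then have "F x0 \<le> inverse (norm x) * F x \<and> inverse (norm x) * F x \<le> F x1"
      using x0(2) x1(2) F_scaleR[of "inverse (norm x)" x] by fastforce
    then show ?thesis using False by (simp add: field_simps)
  qed simp
  with pos show ?thesis by blast
qed

lemma F_differentiable: "x \<noteq> 0 \<Longrightarrow> F differentiable (at x)"
  and F_pderiv_differentiable: "x \<noteq> 0 \<Longrightarrow> pderiv_dir i F differentiable (at x)"
  and F_pderiv2_continuous: "continuous_on (UNIV - {0}) (pderiv_dir j (pderiv_dir i F))"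
  using finsler unfolding finsler_norm_def by (auto simp: numeral_2_eq_2)

lemma F_has_derivative: "x \<noteq> 0 \<Longrightarrow> (F has_derivative (\<lambda>h. grad F x \<bullet> h)) (at x)"
  by (simp add: F_differentiable has_derivative_grad)

lemma grad_F_scaleR:
  assumes "x \<noteq> 0" "t \<noteq> 0"
  shows "grad F (t *\<^sub>R x) = sgn t *\<^sub>R grad F x"
proof (rule grad_eqI)
  have "((\<lambda>y. \<bar>t\<bar> * F (inverse t *\<^sub>R y)) has_derivative
      (\<lambda>h. \<bar>t\<bar> * (grad F (inverse t *\<^sub>R (t *\<^sub>R x)) \<bullet> (inverse t *\<^sub>R h)))) (at (t *\<^sub>R x))"
    using assms
    by (auto intro!: derivative_eq_intros has_derivative_compose[OF _ F_has_derivative, of "\<lambda>y. inverse t *\<^sub>R y"])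
  moreover have "(\<lambda>y. \<bar>t\<bar> * F (inverse t *\<^sub>R y)) = F"
    using assms by (auto simp: F_scaleR abs_inverse)
  moreover have "\<bar>t\<bar> * (grad F (inverse t *\<^sub>R (t *\<^sub>R x)) \<bullet> (inverse t *\<^sub>R h)) = sgn t *\<^sub>R grad F x \<bullet> h" for h
    using assms by (simp add: sgn_if field_simps)
  ultimately show "(F has_derivative (\<lambda>h. sgn t *\<^sub>R grad F x \<bullet> h)) (at (t *\<^sub>R x))"
    by simp
qed

lemma F_line_deriv:
  assumes "x + t *\<^sub>R y \<noteq> 0"
  shows "((\<lambda>t. F (x + t *\<^sub>R y)) has_real_derivative (grad F (x + t *\<^sub>R y) \<bullet> y)) (at t)"
  unfolding has_field_derivative_def
  by (rule has_derivative_eq_rhs[OF has_derivative_compose[of "\<lambda>t. x + t *\<^sub>R y", OF _ F_has_derivative[OF assms]]])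
     (auto intro!: derivative_eq_intros)

text \<open>Subadditivity bounds every forward difference quotient of \<open>F\<close> at x by
  \<open>F y\<close>. Together with Euler's identity this makes \<open>grad F x\<close> a norming
  functional of x.\<close>

lemma grad_F_inner_le:
  assumes "x \<noteq> 0" shows "grad F x \<bullet> y \<le> F y"
proof -
  have "((\<lambda>t. F (x + t *\<^sub>R y)) has_real_derivative (grad F x \<bullet> y)) (at 0)"
    using F_line_deriv[of x 0 y] assms by simp
  then have "((\<lambda>t. (F (x + t *\<^sub>R y) - F x) / t) \<longlongrightarrow> grad F x \<bullet> y) (at 0)"
    by (simp add: DERIV_def)
  then have "((\<lambda>t. (F (x + t *\<^sub>R y) - F x) / t) \<longlongrightarrow> grad F x \<bullet> y) (at_right 0)"
    by (rule filterlim_mono) (auto simp: at_le)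
  moreover have "\<forall>\<^sub>F t in at_right 0. (F (x + t *\<^sub>R y) - F x) / t \<le> F y"
    using eventually_at_right_less[of 0]
  proof eventually_elim
    case (elim t)
    have "F (x + t *\<^sub>R y) \<le> F x + t * F y"
      using F_triangle[of x "t *\<^sub>R y"] elim by (simp add: F_scaleR)
    then show ?case using elim by (simp add: divide_simps mult.commute)
  qed
  ultimately show ?thesis
    by (rule tendsto_upperbound) simp
qed

lemma abs_grad_F_inner_le: "x \<noteq> 0 \<Longrightarrow> \<bar>grad F x \<bullet> y\<bar> \<le> F y"
  using grad_F_inner_le[of x y] grad_F_inner_le[of x "-y"] by auto

lemma grad_F_euler:
  assumes "x \<noteq> 0" shows "grad F x \<bullet> x = F x"
proof -
  have "((\<lambda>t. F (x + t *\<^sub>R x)) has_real_derivative (grad F x \<bullet> x)) (at 0)"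
    using F_line_deriv[of x 0 x] assms by simp
  moreover have "((\<lambda>t. F (x + t *\<^sub>R x)) has_real_derivative F x) (at 0)"
  proof (rule has_field_derivative_transform_within_open[of "\<lambda>t. (1 + t) * F x" _ _ "{-1<..}"])
    fix t :: real assume "t \<in> {-1<..}"
    then show "(1 + t) * F x = F (x + t *\<^sub>R x)"
      using F_scaleR[of "1 + t" x] by (simp add: scaleR_add_left)
  qed (auto intro!: derivative_eq_intros)
  ultimately show ?thesis by (rule DERIV_unique)
qed

text \<open>The quadratic form of the second derivative of the square of \<open>F\<close>, expanded
  by the product rule because the smoothness hypothesis speaks about iterated partial derivatives of
  \<open>F\<close> itself.\<close>

definition Hess :: "real^'n \<Rightarrow> real^'n \<Rightarrow> real" where
  "Hess x h = 2 * (grad F x \<bullet> h)\<^sup>2 + 2 * F x * (\<Sum>i\<in>UNIV. h $ i * (\<Sum>j\<in>UNIV. pderiv_dir j (pderiv_dir i F) x * h $ j))"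

lemma grad_F_sq: 
  assumes "y \<noteq> 0" shows "grad (\<lambda>z. (F z)\<^sup>2) y = (2 * F y) *\<^sub>R grad F y"
  by (rule grad_eqI) (use assms in \<open>auto intro!: derivative_eq_intros F_has_derivative\<close>)

lemma grad_F_nth_has_derivative:
  assumes "x \<noteq> 0"
  shows "((\<lambda>y. grad F y $ i) has_derivative (\<lambda>h. \<Sum>j\<in>UNIV. pderiv_dir j (pderiv_dir i F) x * h $ j)) (at x)"
proof -
  have "(pderiv_dir i F has_derivative (\<lambda>h. grad (pderiv_dir i F) x \<bullet> h)) (at x)"
    by (rule has_derivative_grad[OF F_pderiv_differentiable[OF assms]])
  moreover have "(\<lambda>y. grad F y $ i) = pderiv_dir i F" by (auto simp: grad_def)
  ultimately show ?thesis by (simp add: grad_def inner_vec_def)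
qed

lemma grad_F_sq_nth_has_derivative:
  assumes "x \<noteq> 0"
  shows "((\<lambda>y. grad (\<lambda>z. (F z)\<^sup>2) y $ i) has_derivative
     (\<lambda>h. 2 * (grad F x \<bullet> h) * grad F x $ i
        + 2 * F x * (\<Sum>j\<in>UNIV. pderiv_dir j (pderiv_dir i F) x * h $ j))) (at x)"
proof (rule has_derivative_transform_within_open[of "\<lambda>y. 2 * F y * grad F y $ i" _ _ _ "UNIV - {0}"])
  show "((\<lambda>y. 2 * F y * grad F y $ i) has_derivative
     (\<lambda>h. 2 * (grad F x \<bullet> h) * grad F x $ i
        + 2 * F x * (\<Sum>j\<in>UNIV. pderiv_dir j (pderiv_dir i F) x * h $ j))) (at x)"
    using assms
    by (auto intro!: derivative_eq_intros F_has_derivative grad_F_nth_has_derivative)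
qed (use assms in \<open>auto simp: grad_F_sq\<close>)

lemma Hess_pos:
  assumes "x \<noteq> 0" "h \<noteq> 0" shows "0 < Hess x h"
proof -
  have "0 < h \<bullet> (\<chi> i. frechet_derivative (\<lambda>y. grad (\<lambda>z. (F z)\<^sup>2) y $ i) (at x) h)"
    using finsler assms unfolding finsler_norm_def by blast
  also have "\<dots> = h \<bullet> (\<chi> i. 2 * (grad F x \<bullet> h) * grad F x $ i
        + 2 * F x * (\<Sum>j\<in>UNIV. pderiv_dir j (pderiv_dir i F) x * h $ j))"
    using frechet_derivative_at[OF grad_F_sq_nth_has_derivative[OF assms(1)], symmetric] by simp
  also have "\<dots> = Hess x h"
  proof -
    have "(\<Sum>i\<in>UNIV. h $ i * (2 * (grad F x \<bullet> h) * grad F x $ i)) = 2 * (grad F x \<bullet> h)\<^sup>2"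
      by (simp add: inner_vec_def power2_eq_square sum_distrib_left mult_ac)
    then show ?thesis
      by (simp add: Hess_def inner_vec_def sum.distrib algebra_simps sum_distrib_left)
  qed
  finally show ?thesis .
qed

lemma grad_F_continuous: "continuous_on (UNIV - {0}) (grad F)"
proof -
  have "continuous_on (UNIV - {0}) (\<lambda>x. grad F x $ i)" for i
    using has_derivative_continuous[OF grad_F_nth_has_derivative] 
    by (auto intro!: continuous_at_imp_continuous_on)
  then have "continuous_on (UNIV - {0}) (\<lambda>x. \<chi> i. grad F x $ i)"
    by (rule continuous_on_vec_lambda)
  then show ?thesis by simp
qed

lemma Hess_continuous: "continuous_on ((UNIV - {0}) \<times> UNIV) (\<lambda>(x,h). Hess x h)"
  unfolding Hess_def case_prod_unfold
  by (intro continuous_intros continuous_on_compose2[OF grad_F_continuous, of _ fst]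
      continuous_on_compose2[OF F_continuous[of UNIV], of _ fst] continuous_on_compose2[OF F_pderiv2_continuous, of _ fst]) auto

lemma F_line_deriv2:
  assumes "x + t *\<^sub>R y \<noteq> 0"
  shows "((\<lambda>t. 2 * F (x + t *\<^sub>R y) * (grad F (x + t *\<^sub>R y) \<bullet> y)) has_real_derivative Hess (x + t *\<^sub>R y) y) (at t)"
proof -
  have "((\<lambda>t. grad F (x + t *\<^sub>R y) $ i) has_real_derivative
      (\<Sum>j\<in>UNIV. pderiv_dir j (pderiv_dir i F) (x + t *\<^sub>R y) * y $ j)) (at t)" for i
    unfolding has_field_derivative_def
    by (rule has_derivative_eq_rhs[OF has_derivative_compose[of "\<lambda>t. x + t *\<^sub>R y", OF _ grad_F_nth_has_derivative[OF assms]]])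
       (auto intro!: derivative_eq_intros simp: sum_distrib_left fun_eq_iff mult_ac)
  then have "((\<lambda>t. grad F (x + t *\<^sub>R y) \<bullet> y) has_real_derivative
      (\<Sum>i\<in>UNIV. y $ i * (\<Sum>j\<in>UNIV. pderiv_dir j (pderiv_dir i F) (x + t *\<^sub>R y) * y $ j))) (at t)"
    unfolding inner_vec_def by (auto intro!: derivative_eq_intros sum.cong)
  from DERIV_mult[OF DERIV_cmult[OF F_line_deriv[OF assms], of 2] this] show ?thesis
    by (simp add: Hess_def power2_eq_square algebra_simps)
qed


section \<open>Uniform convexity of powers of the norm\<close>

lemma Hess_lower_bound:
  "\<exists>c>0. \<forall>x h. 1/2 \<le> norm x \<longrightarrow> norm x \<le> 3/2 \<longrightarrow> c * (norm h)\<^sup>2 \<le> Hess x h"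
proof -
  \<comment> \<open>The shell contains every segment from a unit vector x to x + y with |y| \<le>
    1/2. In h the form is homogeneous of degree two, so unit vectors suffice there.\<close>
  define K where "K = (cball (0::real^'n) (3/2) - ball 0 (1/2)) \<times> sphere (0::real^'n) 1"
  have "axis undefined 1 \<in> sphere (0::real^'n) 1" by simp
  moreover have "axis undefined 1 \<in> cball (0::real^'n) (3/2) - ball 0 (1/2)" by simp
  ultimately have ne: "K \<noteq> {}" unfolding K_def by blast
  have comp: "compact K" unfolding K_def
    by (intro compact_Times compact_sphere compact_diff) auto
  have cont: "continuous_on K (\<lambda>(x,h). Hess x h)"
    by (rule continuous_on_subset[OF Hess_continuous]) (auto simp: K_def)
  obtain z where z: "z \<in> K" "\<And>w. w \<in> K \<Longrightarrow> (\<lambda>(x,h). Hess x h) z \<le> (\<lambda>(x,h). Hess x h) w"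
    using continuous_attains_inf[OF comp ne cont] by blast
  define c where "c = Hess (fst z) (snd z)"
  have "fst z \<noteq> 0" "snd z \<noteq> 0" using z(1) by (auto simp: K_def)
  then have c: "0 < c" unfolding c_def by (rule Hess_pos)
  have "c * (norm h)\<^sup>2 \<le> Hess x h" if "1/2 \<le> norm x" "norm x \<le> 3/2" for x h :: "real^'n"
  proof (cases "h = 0")
    case False
    define k where "k = inverse (norm h) *\<^sub>R h"
    have h: "h = norm h *\<^sub>R k" using False by (simp add: k_def)
    have "(x, k) \<in> K" using that False by (auto simp: K_def k_def)
    then have "c \<le> Hess x k" using z(2)[of "(x,k)"] by (simp add: c_def case_prod_unfold)
    moreover have "Hess x h = (norm h)\<^sup>2 * Hess x k"
      by (subst h, simp add: Hess_def power_mult_distrib power2_eq_square distrib_left sum_distrib_left mult_ac)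
    ultimately show ?thesis by (metis mult.commute mult_left_mono zero_le_power2)
  qed (simp add: Hess_def)
  with c show ?thesis by blast
qed

text \<open>A second order Taylor expansion along the segment from x to x + y. The bound on y keeps
  the segment away from the origin, where \<open>F\<close> is not differentiable.\<close>

lemma F_sq_convex_local:
  "\<exists>c>0. \<forall>x y. norm x = 1 \<longrightarrow> norm y \<le> 1/2 \<longrightarrow>
     (F x)\<^sup>2 + 2 * F x * (grad F x \<bullet> y) + c * (norm y)\<^sup>2 \<le> (F (x + y))\<^sup>2"
proof -
  obtain c where c: "0 < c" and H: "\<And>x h. 1/2 \<le> norm x \<Longrightarrow> norm x \<le> 3/2 \<Longrightarrow> c * (norm h)\<^sup>2 \<le> Hess x h"
    using Hess_lower_bound by blast
  have "(F x)\<^sup>2 + 2 * F x * (grad F x \<bullet> y) + c/2 * (norm y)\<^sup>2 \<le> (F (x + y))\<^sup>2"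
    if x: "norm x = 1" and y: "norm y \<le> 1/2" for x y :: "real^'n"
  proof -
    have rng: "1/2 \<le> norm (x + t *\<^sub>R y)" "norm (x + t *\<^sub>R y) \<le> 3/2" if "0 \<le> t" "t \<le> 1" for t :: real
    proof -
      have "t * norm y \<le> 1 * (1/2)" using that y by (intro mult_mono) auto
      then have "norm (t *\<^sub>R y) \<le> 1/2" using that by simp
      then show "1/2 \<le> norm (x + t *\<^sub>R y)" "norm (x + t *\<^sub>R y) \<le> 3/2" using x
        using norm_triangle_ineq[of x "t *\<^sub>R y"] norm_diff_ineq[of x "t *\<^sub>R y"] by auto
    qed
    have nz: "x + t *\<^sub>R y \<noteq> 0" if "0 \<le> t" "t \<le> 1" for t :: real
    proof
      assume "x + t *\<^sub>R y = 0"
      then have "norm (x + t *\<^sub>R y) = 0" by (simp only: norm_zero)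
      then show False using rng(1)[OF that] by linarith
    qed
    \<comment> \<open>\<open>g\<close> is the derivative of the square of \<open>F\<close> along the
      segment and \<open>Hess\<close> that of \<open>g\<close>. The lower bound for
      \<open>Hess\<close> is integrated once to get \<open>gmono\<close> and a second time to get
      \<open>f 0 \<le> f 1\<close>.\<close>
    define g where "g t = 2 * F (x + t *\<^sub>R y) * (grad F (x + t *\<^sub>R y) \<bullet> y)" for t
    have g': "((\<lambda>t. g t - c * (norm y)\<^sup>2 * t) has_real_derivative Hess (x + t *\<^sub>R y) y - c * (norm y)\<^sup>2) (at t)"
      if "0 \<le> t" "t \<le> 1" for t :: real
      unfolding g_def by (rule DERIV_diff F_line_deriv2 nz that derivative_eq_intros refl)+ simp
    have gmono: "g 0 \<le> g t - c * (norm y)\<^sup>2 * t" if "0 \<le> t" "t \<le> 1" for t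
      using DERIV_nonneg_imp_nondecreasing[of 0 t "\<lambda>t. g t - c * (norm y)\<^sup>2 * t"] that g' H rng
      by (force intro!: exI)
    define f where "f t = (F (x + t *\<^sub>R y))\<^sup>2 - g 0 * t - c/2 * (norm y)\<^sup>2 * t\<^sup>2" for t
    have f': "(f has_real_derivative g t - g 0 - c * (norm y)\<^sup>2 * t) (at t)" if "0 \<le> t" "t \<le> 1" for t
      unfolding f_def g_def using nz[OF that]
      by (auto intro!: derivative_eq_intros F_line_deriv)
    have "f 0 \<le> f 1"
    proof (rule DERIV_nonneg_imp_nondecreasing[of 0 1 f])
      fix t :: real assume "0 \<le> t" "t \<le> 1"
      then show "\<exists>d. (f has_real_derivative d) (at t) \<and> 0 \<le> d"
        using f'[of t] gmono[of t] by (intro exI[of _ "g t - g 0 - c * (norm y)\<^sup>2 * t"]) auto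
    qed simp
    then show ?thesis by (simp add: f_def g_def algebra_simps)
  qed
  then show ?thesis using c by (intro exI[of _ "c/2"]) auto
qed

text \<open>The convexity gap \<open>Q\<close> has three regimes: for small y the expansion of the
  square is raised to the power p/2; for moderate y convexity along a ray propagates this bound; for
  large y the term \<open>F (x + y) powr p\<close> outweighs all others.\<close>

lemma F_powr_convex_sphere:
  assumes p: "2 \<le> p"
  shows "\<exists>c>0. \<forall>x y. norm x = 1 \<longrightarrow>
     F x powr p + p * F x powr (p - 1) * (grad F x \<bullet> y) + c * norm y powr p \<le> F (x + y) powr p"
proof -
  obtain a b where a: "0 < a" and b: "0 < b" and ab: "\<And>x. a * norm x \<le> F x" "\<And>x. F x \<le> b * norm x"
    using F_bounds by blast
  obtain c where c: "0 < c" and sq: "\<And>x y. norm x = 1 \<Longrightarrow> norm y \<le> 1/2 \<Longrightarrow>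
     (F x)\<^sup>2 + 2 * F x * (grad F x \<bullet> y) + c * (norm y)\<^sup>2 \<le> (F (x + y))\<^sup>2"
    using F_sq_convex_local by blast
  define Q where "Q x y = F (x + y) powr p - F x powr p - p * F x powr (p - 1) * (grad F x \<bullet> y)" for x y
  define c1 where "c1 = p/2 * a powr (p - 2) * c"
  have c1: "0 < c1" using p a c by (simp add: c1_def)
  have near: "c1 * (norm y)\<^sup>2 \<le> Q x y" if x: "norm x = 1" and y: "norm y \<le> 1/2" for x y
  proof -
    have Fx: "a \<le> F x" "0 < F x" using ab(1)[of x] x a by auto
    have "((F x)\<^sup>2) powr (p/2) + p/2 * ((F x)\<^sup>2) powr (p/2 - 1) * ((F (x+y))\<^sup>2 - (F x)\<^sup>2) \<le> ((F (x + y))\<^sup>2) powr (p/2)"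
      using p Fx by (intro powr_ge_tangent) auto
    moreover have "((F z)\<^sup>2) powr (p/2) = F z powr p" for z
      by (cases "F z = 0") (simp_all add: powr_powr flip: powr_numeral)
    moreover have "((F x)\<^sup>2) powr (p/2 - 1) = F x powr (p - 2)"
      using Fx by (simp add: powr_powr flip: powr_numeral)
    ultimately have 1: "F x powr p + p/2 * F x powr (p - 2) * ((F (x+y))\<^sup>2 - (F x)\<^sup>2) \<le> F (x + y) powr p"
      by simp
    have 2: "p/2 * F x powr (p - 2) * (2 * F x * (grad F x \<bullet> y) + c * (norm y)\<^sup>2)
       \<le> p/2 * F x powr (p - 2) * ((F (x+y))\<^sup>2 - (F x)\<^sup>2)"
      using sq[OF x y] p by (intro mult_left_mono) auto
    have "F x powr (p - 1) = F x powr ((p - 2) + 1)" by simp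
    then have 3: "F x powr (p - 1) = F x powr (p - 2) * F x" using Fx by (simp only: powr_add) simp
    have "a powr (p - 2) \<le> F x powr (p - 2)" using p Fx a by (intro powr_mono2) auto
    then have "c1 * (norm y)\<^sup>2 \<le> p/2 * F x powr (p - 2) * (c * (norm y)\<^sup>2)"
      unfolding c1_def using p c by (auto intro!: mult_right_mono mult_left_mono simp: mult.assoc)
    with 1 2 3 show ?thesis unfolding Q_def by (simp add: algebra_simps)
  qed
  \<comment> \<open>As a function of y, \<open>Q x\<close> is convex and vanishes at 0. Its value at
    y is thus at least 1/t times the value at t y, a vector of length 1/2 to which
    \<open>near\<close> applies.\<close>
  have mid: "c1 / 2 * norm y \<le> Q x y" if x: "norm x = 1" and y: "1/2 \<le> norm y" for x y
  proof -
    define t where "t = 1 / (2 * norm y)"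
    have t: "0 < t" "t \<le> 1" "t * norm y = 1/2" using y by (auto simp: t_def divide_simps)
    have "F (x + t *\<^sub>R y) \<le> (1 - t) * F x + t * F (x + y)"
      using convex_onD[OF F_convex, of t x "x + y"] t by (simp add: algebra_simps)
    then have "F (x + t *\<^sub>R y) powr p \<le> ((1 - t) * F x + t * F (x + y)) powr p"
      using p by (intro powr_mono2) auto
    also have "\<dots> \<le> (1 - t) * F x powr p + t * F (x + y) powr p"
      using t p by (intro powr_convex_combination) auto
    finally have "Q x (t *\<^sub>R y) \<le> t * Q x y" unfolding Q_def by (simp add: algebra_simps)
    moreover have "c1 * (norm (t *\<^sub>R y))\<^sup>2 \<le> Q x (t *\<^sub>R y)"
      using x t by (intro near) auto
    moreover have "norm (t *\<^sub>R y) = t * norm y" using t by simp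
    ultimately have "c1 * (t * norm y)\<^sup>2 \<le> t * Q x y" by (metis order_trans)
    moreover have "c1 * (t * norm y)\<^sup>2 = t * (c1 / 2 * norm y)"
      by (simp add: power2_eq_square t(3) mult_ac)
    ultimately show ?thesis using t by (metis mult_le_cancel_left_pos)
  qed
  \<comment> \<open>Chosen so that the two subtracted terms are together at most (1 + p) / K = 2
    powr (- (p + 1)) times \<open>F y powr p\<close>, which is half of the main term (F y / 2) powr
    p.\<close>
  define K where "K = 2 powr (p + 1) * (1 + p)"
  have K: "2 \<le> K"
  proof -
    have "2 * 1 \<le> 2 powr (p + 1) * (1 + p)"
      using p powr_mono[of 1 "p+1" "2::real"] by (intro mult_mono) auto
    then show ?thesis by (simp add: K_def)
  qed
  define c2 where "c2 = (a/2) powr p / 2"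
  have c2: "0 < c2" using a by (simp add: c2_def)
  have far: "c2 * norm y powr p \<le> Q x y" if x: "norm x = 1" and y: "K * F x \<le> F y" for x y
  proof -
    define A B where "A = F x" and "B = F y"
    have A: "0 < A" using x by (auto simp: A_def intro!: F_pos)
    have B: "K * A \<le> B" using y unfolding A_def B_def .
    then have "0 < B" using A K by (smt (verit) mult_pos_pos)
    note B = B this
    have "2 * A \<le> K * A" using K A by simp
    then have BA: "B/2 \<le> B - A" using B by simp
    have "F (x + y) \<ge> B - A" using F_triangle[of "x + y" "-x"] by (simp add: A_def B_def)
    then have 1: "(B/2) powr p \<le> F (x + y) powr p" using BA B p by (intro powr_mono2) auto
    have "grad F x \<bullet> y \<le> B" using grad_F_inner_le[of x y] norm_zero x unfolding B_def by force
    then have 2: "p * A powr (p-1) * (grad F x \<bullet> y) \<le> p * A powr (p-1) * B"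
      using p by (intro mult_left_mono) auto
    have AB: "A \<le> B / K" using B K by (simp add: field_simps)
    have "A powr (p-1) \<le> (B/K) powr (p-1)" using AB A p by (intro powr_mono2) auto
    also have "\<dots> = B powr (p-1) / K powr (p-1)" using B K by (simp add: powr_divide)
    also have "\<dots> \<le> B powr (p-1) / K powr 1" using K p B by (intro divide_left_mono powr_mono) auto
    finally have Ap: "A powr (p-1) \<le> B powr (p-1) / K" using K by simp
    have Bp: "B powr p = B powr (p-1) * B" using B by (simp add: powr_diff)
    have "A powr p = A powr (p-1) * A" using A by (simp add: powr_diff)
    also have "\<dots> \<le> B powr (p-1) / K * B"
      using Ap A AB B K order_trans[OF AB, of B] by (intro mult_mono) (auto simp: field_simps)
    finally have 3: "A powr p \<le> B powr p / K" using Bp by simp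
    have 4: "p * A powr (p-1) * B \<le> p * B powr p / K"
      using Ap p B K unfolding Bp by (auto simp: mult_ac divide_simps intro!: mult_left_mono)
    have "A powr p + p * A powr (p-1) * (grad F x \<bullet> y) \<le> (1 + p) * B powr p / K"
      using 2 3 4 by (simp add: algebra_simps add_divide_distrib)
    also have "\<dots> = B powr p / 2 powr (p+1)" using p by (simp add: K_def)
    also have "\<dots> = (B/2) powr p / 2" using B by (simp add: powr_divide powr_add)
    finally have "(B/2) powr p / 2 \<le> Q x y" using 1 unfolding Q_def A_def by linarith
    moreover have "(a/2) powr p * norm y powr p \<le> (B/2) powr p"
      using ab(1)[of y] a p by (subst powr_mult[symmetric]) (auto simp: B_def intro!: powr_mono2)
    ultimately show ?thesis by (simp add: c2_def)
  qed
  \<comment> \<open>Beyond length M the bounds a and b force \<open>K * F x \<le> F y\<close>. Up to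
    M the linear bound \<open>mid\<close> controls the p-th power at the cost of the factor M powr
    (p - 1), which is the origin of \<open>c3\<close>.\<close>
  define M where "M = 1 + K * b / a"
  have M: "1 \<le> M" using K a b by (simp add: M_def)
  define c3 where "c3 = c1 / 2 / M powr (p - 1)"
  have c3: "0 < c3" using c1 M by (simp add: c3_def)
  define c4 where "c4 = min (min c1 c2) c3"
  have c4: "0 < c4" "c4 \<le> c1" "c4 \<le> c2" "c4 \<le> c3" using c1 c2 c3 by (auto simp: c4_def)
  have "c4 * norm y powr p \<le> Q x y" if x: "norm x = 1" for x y
  proof -
    consider "norm y \<le> 1/2" | "1/2 \<le> norm y" "norm y \<le> M" | "M < norm y" by linarith
    then show ?thesis
    proof cases
      case 1
      have "norm y powr p \<le> norm y powr 2" using 1 p by (intro powr_mono') auto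
      then have "norm y powr p \<le> (norm y)\<^sup>2" by simp
      then have "c4 * norm y powr p \<le> c1 * (norm y)\<^sup>2" using c4 c1 by (intro mult_mono) auto
      then show ?thesis using near[OF x 1] by simp
    next
      case 2
      have "norm y powr (p - 1) \<le> M powr (p - 1)" using 2 p by (intro powr_mono2) auto
      moreover have "norm y powr p = norm y powr (p-1) * norm y" using 2 by (simp add: powr_diff)
      ultimately have "norm y powr p \<le> M powr (p-1) * norm y" by (simp add: mult_right_mono)
      then have "c4 * norm y powr p \<le> c3 * (M powr (p-1) * norm y)" using c4 c3 by (intro mult_mono) auto
      also have "\<dots> = c1 / 2 * norm y" using M by (simp add: c3_def)
      finally show ?thesis using mid[OF x 2(1)] by simp
    next
      case 3
      have "K * F x \<le> K * b" using ab(2)[of x] x K by simp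
      also have "\<dots> \<le> a * M" using a by (simp add: M_def field_simps)
      also have "\<dots> \<le> F y" using 3 a ab(1)[of y] by (meson less_imp_le mult_left_mono order_trans)
      finally have "c2 * norm y powr p \<le> Q x y" by (rule far[OF x])
      moreover have "c4 * norm y powr p \<le> c2 * norm y powr p" using c4 by (intro mult_right_mono) auto
      ultimately show ?thesis by simp
    qed
  qed
  then show ?thesis using c4(1) unfolding Q_def by (intro exI[of _ c4]) (auto simp: algebra_simps)
qed

text \<open>Homogeneity reduces the claim to unit vectors x. For x = 0 the unspecified vector
  \<open>grad F 0\<close> is multiplied by 0 powr (p - 1) = 0, so the inequality may later be
  applied at base points that vanish.\<close>

lemma F_powr_uniformly_convex:
  assumes p: "2 \<le> p"
  shows "\<exists>c>0. \<forall>x y.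
     F x powr p + p * F x powr (p - 1) * (grad F x \<bullet> y) + c * norm y powr p \<le> F (x + y) powr p"
proof -
  obtain a where a: "0 < a" and ab: "\<And>x. a * norm x \<le> F x" using F_bounds by blast
  obtain c where c: "0 < c" and cs: "\<And>x y. norm x = 1 \<Longrightarrow>
     F x powr p + p * F x powr (p - 1) * (grad F x \<bullet> y) + c * norm y powr p \<le> F (x + y) powr p"
    using F_powr_convex_sphere[OF p] by blast
  define k where "k = min c (a powr p)"
  have k: "0 < k" "k \<le> c" "k \<le> a powr p" using c a by (auto simp: k_def)
  have "F x powr p + p * F x powr (p - 1) * (grad F x \<bullet> y) + k * norm y powr p \<le> F (x + y) powr p" for x y
  proof (cases "x = 0")
    case True
    have "k * norm y powr p \<le> a powr p * norm y powr p" using k by (intro mult_right_mono) auto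
    also have "\<dots> \<le> F y powr p" using ab[of y] a p by (subst powr_mult[symmetric]) (auto intro!: powr_mono2)
    finally show ?thesis using True by simp
  next
    case False
    define s where "s = norm x"
    have s: "0 < s" using False by (simp add: s_def)
    define x' y' where "x' = inverse s *\<^sub>R x" and "y' = inverse s *\<^sub>R y"
    have x: "x = s *\<^sub>R x'" and y: "y = s *\<^sub>R y'" using s by (auto simp: x'_def y'_def)
    have nx': "norm x' = 1" using s by (simp add: x'_def s_def)
    then have x'0: "x' \<noteq> 0" by auto
    have g: "grad F x = grad F x'" using grad_F_scaleR[OF x'0, of s] s x by simp
    have Fx: "F x = s * F x'" using s x F_scaleR[of s x'] by simp
    have Fxy: "F (x + y) = s * F (x' + y')" using s x y F_scaleR[of s "x'+y'"] by (simp add: scaleR_add_right)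
    have ny: "norm y = s * norm y'" using y s by simp
    have sp: "s powr p = s powr (p-1) * s" using s by (simp add: powr_diff)
    have "F x powr p + p * F x powr (p - 1) * (grad F x \<bullet> y) + k * norm y powr p
       = s powr p * (F x' powr p + p * F x' powr (p - 1) * (grad F x' \<bullet> y') + k * norm y' powr p)"
      unfolding g Fx ny using s sp y by (simp add: powr_mult algebra_simps)
    also have "\<dots> \<le> s powr p * (F x' powr p + p * F x' powr (p - 1) * (grad F x' \<bullet> y') + c * norm y' powr p)"
      using k by (intro mult_left_mono add_left_mono mult_right_mono) auto
    also have "\<dots> \<le> s powr p * F (x' + y') powr p"
      using cs[OF nx', of y'] by (intro mult_left_mono) auto
    also have "\<dots> = F (x + y) powr p" using s unfolding Fxy by (simp add: powr_mult)
    finally show ?thesis .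
  qed
  with k(1) show ?thesis by blast
qed

end

section \<open>Differentiability of the distance function\<close>

text \<open>Every line in direction e meets N at most once, so Fubini's theorem gives measure
  zero.\<close>

lemma thin_closed_null:
  fixes N :: "(real^'n::finite) set"
  assumes N: "closed N" and e: "\<And>x t. x \<in> N \<Longrightarrow> 0 < t \<Longrightarrow> x + t *\<^sub>R e \<notin> N"
  shows "N \<in> null_sets lebesgue"
proof -
  have [measurable]: "N \<in> sets borel" using N by simp
  have one: "(\<integral>\<^sup>+t. indicator {0..1::real} t * indicator N (x + t *\<^sub>R e) \<partial>lborel) = 0" for x
  proof -
    have "{t. x + t *\<^sub>R e \<in> N} \<subseteq> {s}" if "x + s *\<^sub>R e \<in> N" for s
    proof
      fix t assume "t \<in> {t. x + t *\<^sub>R e \<in> N}"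
      then have t: "x + t *\<^sub>R e \<in> N" by simp
      have "x + t *\<^sub>R e = (x + s *\<^sub>R e) + (t - s) *\<^sub>R e" "x + s *\<^sub>R e = (x + t *\<^sub>R e) + (s - t) *\<^sub>R e"
        by (simp_all add: algebra_simps)
      then have "\<not> 0 < t - s" "\<not> 0 < s - t" using e[OF that, of "t - s"] e[OF t, of "s - t"] t that by metis+
      then show "t \<in> {s}" by simp
    qed
    then obtain s where s: "{t. x + t *\<^sub>R e \<in> N} \<subseteq> {s}" by (cases "\<exists>s. x + s *\<^sub>R e \<in> N") auto
    have "(\<integral>\<^sup>+t. indicator {0..1::real} t * indicator N (x + t *\<^sub>R e) \<partial>lborel) \<le> (\<integral>\<^sup>+t. indicator {s} t \<partial>lborel)"
      by (rule nn_integral_mono) (use s in \<open>auto simp: indicator_def\<close>)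
    then show ?thesis by simp
  qed
  have trans: "(\<integral>\<^sup>+x. indicator N (x + y) \<partial>lborel) = emeasure lborel N" for y :: "real^'n"
  proof -
    have "emeasure lborel N = (\<integral>\<^sup>+x. indicator N x \<partial>distr lborel borel ((+) y))"
      by (simp add: lborel_distr_plus)
    also have "\<dots> = (\<integral>\<^sup>+x. indicator N (y + x) \<partial>lborel)"
      by (subst nn_integral_distr) auto
    finally show ?thesis by (simp add: add.commute)
  qed
  \<comment> \<open>The measure of N is the average over t in [0, 1] of the measures of its
    translates, which are all equal.\<close>
  have "emeasure lborel N = (\<integral>\<^sup>+t. indicator {0..1::real} t * (\<integral>\<^sup>+x. indicator N (x + t *\<^sub>R e) \<partial>lborel) \<partial>lborel)"
    unfolding trans by (subst nn_integral_multc) auto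
  also have "\<dots> = (\<integral>\<^sup>+t. (\<integral>\<^sup>+x. indicator {0..1::real} t * indicator N (x + t *\<^sub>R e) \<partial>lborel) \<partial>lborel)"
    by (subst nn_integral_cmult) auto
  also have "\<dots> = (\<integral>\<^sup>+x. (\<integral>\<^sup>+t. indicator {0..1::real} t * indicator N (x + t *\<^sub>R e) \<partial>lborel) \<partial>lborel)"
    by (rule pair_sigma_finite.Fubini') (auto intro: lborel_pair.pair_sigma_finite_axioms pair_sigma_finite.intro sigma_finite_lborel)
  also have "\<dots> = 0" unfolding one by simp
  finally have "N \<in> null_sets lborel" by auto
  then show ?thesis using null_sets_completionI by blast
qed

text \<open>The hypothesis says that no rational gap separates left from right slopes along an axis,
  so all partial derivatives exist. For convex functions this implies total differentiability: an
  increment is bounded by an average of axis increments, which controls the remainder from above,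
  and midpoint convexity converts this into control from below.\<close>

lemma convex_differentiable_of_partials:
  fixes f :: "real^'n::finite \<Rightarrow> real"
  assumes f: "convex_on UNIV f"
    and N: "\<And>i q1 q2. q1 \<in> \<rat> \<Longrightarrow> q2 \<in> \<rat> \<Longrightarrow> q1 < q2 \<Longrightarrow>
      \<exists>t>0. f x - f (x - t *\<^sub>R axis i 1) > q1 * t \<or> f (x + t *\<^sub>R axis i 1) - f x < q2 * t"
  shows "f differentiable (at x)"
proof -
  have mono: "(f (x + s *\<^sub>R y) - f x) / s \<le> (f (x + t *\<^sub>R y) - f x) / t" if "0 < s" "s \<le> t" for s t and y :: "real^'n"
  proof -
    have "x + s *\<^sub>R y = (1 - s/t) *\<^sub>R x + (s/t) *\<^sub>R (x + t *\<^sub>R y)"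
      using that by (simp add: algebra_simps)
    then have "f (x + s *\<^sub>R y) \<le> (1 - s/t) * f x + s/t * f (x + t *\<^sub>R y)"
      using convex_onD[OF f, of "s/t" x "x + t *\<^sub>R y"] that by simp
    then have "f (x + s *\<^sub>R y) - f x \<le> (s/t) * (f (x + t *\<^sub>R y) - f x)" by (simp add: algebra_simps)
    then show ?thesis using that by (simp add: field_simps)
  qed
  have sub: "f x - f (x - s *\<^sub>R y) \<le> f (x + s *\<^sub>R y) - f x" for s and y :: "real^'n"
  proof -
    have "f ((1 - 1/2) *\<^sub>R (x - s *\<^sub>R y) + (1/2) *\<^sub>R (x + s *\<^sub>R y)) \<le> (1 - 1/2) * f (x - s *\<^sub>R y) + (1/2) * f (x + s *\<^sub>R y)"
      by (rule convex_onD[OF f]) auto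
    moreover have "(1 - 1/2) *\<^sub>R (x - s *\<^sub>R y) + (1/2) *\<^sub>R (x + s *\<^sub>R y) = x"
      by (simp add: algebra_simps flip: scaleR_add_left)
    ultimately show ?thesis by simp
  qed
  have cross: "(f x - f (x - s *\<^sub>R y)) / s \<le> (f (x + t *\<^sub>R y) - f x) / t" if "0 < s" "0 < t" for s t and y :: "real^'n"
  proof -
    define m where "m = min s t"
    have m: "0 < m" "m \<le> s" "m \<le> t" using that by (auto simp: m_def)
    have "(f x - f (x - s *\<^sub>R y)) / s \<le> (f x - f (x - m *\<^sub>R y)) / m"
      using mono[OF m(1,2), of "-y"] that m by (simp add: field_simps)
    also have "\<dots> \<le> (f (x + m *\<^sub>R y) - f x) / m" using sub[of m y] m by (simp add: divide_right_mono)
    also have "\<dots> \<le> (f (x + t *\<^sub>R y) - f x) / t" using mono[OF m(1,3), of y] .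
    finally show ?thesis .
  qed
  \<comment> \<open>The right derivative along axis i, as the infimum of the nondecreasing
    difference quotients; it lies above all left quotients.\<close>
  define l where "l i = (INF t\<in>{0<..}. (f (x + t *\<^sub>R axis i 1) - f x) / t)" for i
  have bdd: "bdd_below ((\<lambda>t. (f (x + t *\<^sub>R axis i 1) - f x) / t) ` {0<..})" for i
    by (rule bdd_belowI2[of _ "(f x - f (x - 1 *\<^sub>R axis i 1)) / 1"]) (metis cross greaterThan_iff zero_less_one)
  have lup: "l i \<le> (f (x + t *\<^sub>R axis i 1) - f x) / t" if "0 < t" for i t
    unfolding l_def using that bdd by (intro cINF_lower) auto
  have llow: "(f x - f (x - t *\<^sub>R axis i 1)) / t \<le> l i" if "0 < t" for i t
    unfolding l_def using that cross by (intro cINF_greatest) auto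
  have near: "\<exists>\<delta>>0. \<forall>t. \<bar>t\<bar> \<le> \<delta> \<longrightarrow> f (x + t *\<^sub>R axis i 1) - f x - l i * t \<le> \<epsilon> * \<bar>t\<bar>" if eps: "0 < \<epsilon>" for i \<epsilon>
  proof -
    have "\<exists>t>0. (f (x + t *\<^sub>R axis i 1) - f x) / t < l i + \<epsilon>"
      using cINF_less_iff[OF _ bdd, of i "l i + \<epsilon>"] eps unfolding l_def by auto
    then obtain t1 where t1: "0 < t1" "(f (x + t1 *\<^sub>R axis i 1) - f x) / t1 < l i + \<epsilon>" by blast
    have "\<exists>t>0. (f x - f (x - t *\<^sub>R axis i 1)) / t > l i - \<epsilon>"
    proof -
      obtain q1 where q1: "q1 \<in> \<rat>" "l i - \<epsilon> < q1" "q1 < l i" using Rats_dense_in_real[of "l i - \<epsilon>" "l i"] eps by auto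
      obtain q2 where q2: "q2 \<in> \<rat>" "q1 < q2" "q2 < l i" using Rats_dense_in_real[of "q1" "l i"] q1 by auto
      obtain t where t: "0 < t" "f x - f (x - t *\<^sub>R axis i 1) > q1 * t \<or> f (x + t *\<^sub>R axis i 1) - f x < q2 * t"
        using N[OF q1(1) q2(1,2)] by blast
      have "\<not> f (x + t *\<^sub>R axis i 1) - f x < q2 * t"
      proof -
        have "l i * t \<le> f (x + t *\<^sub>R axis i 1) - f x" using lup[OF t(1), of i] t(1) by (simp add: field_simps)
        moreover have "q2 * t < l i * t" using q2 t(1) by simp
        ultimately show ?thesis by linarith
      qed
      then have "q1 < (f x - f (x - t *\<^sub>R axis i 1)) / t" using t by (simp add: field_simps)
      then show ?thesis using q1 t(1) by (intro exI[of _ t]) auto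
    qed
    then obtain t2 where t2: "0 < t2" "(f x - f (x - t2 *\<^sub>R axis i 1)) / t2 > l i - \<epsilon>" by blast
    define \<delta> where "\<delta> = min t1 t2"
    have "f (x + t *\<^sub>R axis i 1) - f x - l i * t \<le> \<epsilon> * \<bar>t\<bar>" if t: "\<bar>t\<bar> \<le> \<delta>" for t
    proof -
      consider "t = 0" | "0 < t" | "t < 0" by linarith
      then show ?thesis
      proof cases
        case 2
        then have "(f (x + t *\<^sub>R axis i 1) - f x) / t < l i + \<epsilon>"
          using mono[of t t1 "axis i 1"] t1 t by (auto simp: \<delta>_def)
        then show ?thesis using 2 by (simp add: field_simps)
      next
        case 3
        then have "(f (x + (-t) *\<^sub>R (- axis i 1)) - f x) / (-t) \<le> (f (x + t2 *\<^sub>R (- axis i 1)) - f x) / t2"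
          using t2 t by (intro mono) (auto simp: \<delta>_def)
        moreover have "(f (x + t2 *\<^sub>R (- axis i 1)) - f x) / t2 < \<epsilon> - l i"
          using t2 by (simp add: field_simps)
        ultimately have "(f (x + t *\<^sub>R axis i 1) - f x) / (-t) < \<epsilon> - l i" by simp
        then show ?thesis using 3 by (simp add: field_simps)
      qed simp
    qed
    then show ?thesis using t1 t2 by (intro exI[of _ \<delta>]) (auto simp: \<delta>_def)
  qed
  define w where "w = (\<chi> i. l i)"
  define n where "n = real CARD('n)"
  have n: "0 < n" by (simp add: n_def)
  \<comment> \<open>Jensen's inequality: x + h is the average of the n points x + n h_i e_i.\<close>
  have conv: "f (x + h) - f x - w \<bullet> h \<le> (\<Sum>i\<in>UNIV. (f (x + (n * h $ i) *\<^sub>R axis i 1) - f x - l i * (n * h $ i)) / n)" for h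
  proof -
    have "x + h = (\<Sum>i\<in>UNIV. (1/n) *\<^sub>R (x + (n * h $ i) *\<^sub>R axis i 1))"
    proof -
      have "(\<Sum>i\<in>UNIV. h $ i *\<^sub>R axis i 1) = h" by (metis basis_expansion scalar_mult_eq_scaleR)
      moreover have "(\<Sum>i\<in>(UNIV::'n set). (1/n) *\<^sub>R x) = x"
        using n by (simp only: scaleR_sum_left[symmetric]) (simp add: n_def)
      ultimately show ?thesis using n by (simp add: scaleR_add_right sum.distrib)
    qed
    moreover have "f (\<Sum>i\<in>UNIV. (1/n) *\<^sub>R (x + (n * h $ i) *\<^sub>R axis i 1)) \<le> (\<Sum>i\<in>UNIV. (1/n) * f (x + (n * h $ i) *\<^sub>R axis i 1))"
      by (rule convex_on_sum[OF _ _ f]) (use n in \<open>auto simp: n_def\<close>)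
    ultimately have "f (x + h) \<le> (\<Sum>i\<in>UNIV. f (x + (n * h $ i) *\<^sub>R axis i 1) / n)" by simp
    moreover have "(\<Sum>i\<in>UNIV. (f (x + (n * h $ i) *\<^sub>R axis i 1) - f x - l i * (n * h $ i)) / n)
       = (\<Sum>i\<in>UNIV. f (x + (n * h $ i) *\<^sub>R axis i 1) / n) - (\<Sum>i\<in>(UNIV::'n set). f x / n) - (\<Sum>i\<in>UNIV. l i * h $ i)"
      using n by (simp add: sum_subtractf diff_divide_distrib)
    moreover have "(\<Sum>i\<in>(UNIV::'n set). f x / n) = f x" by (simp add: n_def)
    moreover have "w \<bullet> h = (\<Sum>i\<in>UNIV. l i * h $ i)" by (simp add: w_def inner_vec_def)
    ultimately show ?thesis by simp
  qed
  have up: "\<exists>\<delta>>0. \<forall>h. norm h \<le> \<delta> \<longrightarrow> f (x + h) - f x - w \<bullet> h \<le> \<epsilon> * norm h" if eps: "0 < \<epsilon>" for \<epsilon>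
  proof -
    have "\<forall>i. \<exists>\<delta>>0. \<forall>t. \<bar>t\<bar> \<le> \<delta> \<longrightarrow> f (x + t *\<^sub>R axis i 1) - f x - l i * t \<le> \<epsilon> / n * \<bar>t\<bar>"
      using near[of "\<epsilon> / n"] eps n by (metis divide_pos_pos)
    then obtain \<delta> where \<delta>: "\<And>i. 0 < \<delta> i" "\<And>i t. \<bar>t\<bar> \<le> \<delta> i \<Longrightarrow> f (x + t *\<^sub>R axis i 1) - f x - l i * t \<le> \<epsilon> / n * \<bar>t\<bar>"
      by metis
    define \<eta> where "\<eta> = Min (range \<delta>) / n"
    have \<eta>: "0 < \<eta>" "\<And>i. n * \<eta> \<le> \<delta> i" using \<delta>(1) n by (auto simp: \<eta>_def)
    have "f (x + h) - f x - w \<bullet> h \<le> \<epsilon> * norm h" if h: "norm h \<le> \<eta>" for h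
    proof -
      have "(f (x + (n * h $ i) *\<^sub>R axis i 1) - f x - l i * (n * h $ i)) / n \<le> \<epsilon> / n * norm h" for i
      proof -
        have hi: "\<bar>n * h $ i\<bar> \<le> n * norm h" using n component_le_norm_cart[of h i] by (simp add: abs_mult)
        also have "\<dots> \<le> \<delta> i" using h n \<eta>(2)[of i] by (smt (verit) mult_left_mono)
        finally have "f (x + (n * h $ i) *\<^sub>R axis i 1) - f x - l i * (n * h $ i) \<le> \<epsilon> / n * \<bar>n * h $ i\<bar>"
          by (rule \<delta>(2))
        also have "\<dots> \<le> \<epsilon> / n * (n * norm h)" using hi eps n by (intro mult_left_mono) auto
        also have "\<dots> = \<epsilon> * norm h" using n by simp
        finally show ?thesis using n divide_right_mono[of _ "\<epsilon> * norm h" n] by simp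
      qed
      then have "(\<Sum>i\<in>UNIV. (f (x + (n * h $ i) *\<^sub>R axis i 1) - f x - l i * (n * h $ i)) / n) \<le> (\<Sum>i\<in>(UNIV::'n set). \<epsilon> / n * norm h)"
        by (intro sum_mono) auto
      also have "\<dots> = \<epsilon> * norm h" by (simp add: n_def)
      finally show ?thesis using conv[of h] by simp
    qed
    with \<eta>(1) show ?thesis by blast
  qed
  have "(f has_derivative (\<lambda>h. w \<bullet> h)) (at x)"
    unfolding has_derivative_at_alt
  proof (intro conjI allI impI)
    show "bounded_linear ((\<bullet>) w)" by (rule bounded_linear_inner_right)
    fix \<epsilon> :: real assume "0 < \<epsilon>"
    then obtain \<delta> where \<delta>: "0 < \<delta>" "\<And>h. norm h \<le> \<delta> \<Longrightarrow> f (x + h) - f x - w \<bullet> h \<le> \<epsilon> * norm h"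
      using up by blast
    have "norm (f y - f x - w \<bullet> (y - x)) \<le> \<epsilon> * norm (y - x)" if "norm (y - x) < \<delta>" for y
    proof -
      define h where "h = y - x"
      have y: "y = x + h" by (simp add: h_def)
      have "f (x + h) - f x - w \<bullet> h \<le> \<epsilon> * norm h" "f (x + (-h)) - f x - w \<bullet> (-h) \<le> \<epsilon> * norm h"
        using \<delta>(2)[of h] \<delta>(2)[of "-h"] that unfolding h_def[symmetric] by auto
      moreover have "f x - f (x + (-h)) \<le> f (x + h) - f x" using sub[of 1 h] by simp
      ultimately show ?thesis by (simp add: y abs_le_iff)
    qed
    then show "\<exists>d>0. \<forall>y. norm (y - x) < d \<longrightarrow> norm (f y - f x - w \<bullet> (y - x)) \<le> \<epsilon> * norm (y - x)"
      using \<delta>(1) by blast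
  qed
  then show ?thesis unfolding differentiable_def by blast
qed

text \<open>If x and x + t e_i both lay in \<open>N i q1 q2\<close>, the slope between them would be
  at most q1, seen from the upper point, and at least q2 > q1, seen from the lower one. So each of
  these closed sets meets a line in direction e_i at most once, and countably many of them cover the
  points of non-differentiability.\<close>

lemma convex_AE_differentiable:
  fixes f :: "real^'n::finite \<Rightarrow> real"
  assumes f: "convex_on UNIV f"
  shows "AE x in lebesgue. f differentiable (at x)"
proof -
  have cont: "continuous_on UNIV f" using convex_on_continuous[OF open_UNIV f] .
  define N where "N i q1 q2 = {x. \<forall>t>0. f x - f (x - t *\<^sub>R axis i 1) \<le> q1 * t \<and> q2 * t \<le> f (x + t *\<^sub>R axis i 1) - f x}"
    for i :: 'n and q1 q2
  have null: "N i q1 q2 \<in> null_sets lebesgue" if "q1 < q2" for i q1 q2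
  proof (rule thin_closed_null[where e="axis i 1"])
    have "N i q1 q2 = (\<Inter>t\<in>{0<..}. {x. f x - f (x - t *\<^sub>R axis i 1) \<le> q1 * t} \<inter> {x. q2 * t \<le> f (x + t *\<^sub>R axis i 1) - f x})"
      unfolding N_def by auto
    moreover have "closed {x. f x - f (x - t *\<^sub>R axis i 1) \<le> q1 * t}" "closed {x. q2 * t \<le> f (x + t *\<^sub>R axis i 1) - f x}" for t
      by (intro closed_Collect_le continuous_intros continuous_on_compose2[OF cont]; simp)+
    ultimately show "closed (N i q1 q2)" by (simp only:) (intro closed_INT ballI closed_Int)
    fix x and t :: real assume x: "x \<in> N i q1 q2" and t: "0 < t"
    show "x + t *\<^sub>R axis i 1 \<notin> N i q1 q2"
    proof
      assume y: "x + t *\<^sub>R axis i 1 \<in> N i q1 q2"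
      have "f (x + t *\<^sub>R axis i 1) - f x \<le> q1 * t" using y t unfolding N_def by fastforce
      moreover have "q2 * t \<le> f (x + t *\<^sub>R axis i 1) - f x" using x t unfolding N_def by auto
      ultimately have "q2 * t \<le> q1 * t" by linarith
      with t that show False by simp
    qed
  qed
  define Z where "Z = (\<Union>i\<in>UNIV. \<Union>q\<in>{q \<in> \<rat> \<times> \<rat>. fst q < snd q}. N i (fst q) (snd q))"
  have "countable {q \<in> \<rat> \<times> \<rat>. fst q < snd (q :: real \<times> real)}"
    by (rule countable_subset[of _ "\<rat> \<times> \<rat>"]) (auto intro: countable_rat)
  then have Z: "Z \<in> null_sets lebesgue" unfolding Z_def
    using null by (intro null_sets_UN' countable_finite[OF finite]) auto
  moreover have "{x \<in> space lebesgue. \<not> f differentiable (at x)} \<subseteq> Z"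
  proof
    fix x assume x: "x \<in> {x \<in> space lebesgue. \<not> f differentiable (at x)}"
    show "x \<in> Z"
    proof (rule ccontr)
      assume "x \<notin> Z"
      then have "\<And>i q1 q2. q1 \<in> \<rat> \<Longrightarrow> q2 \<in> \<rat> \<Longrightarrow> q1 < q2 \<Longrightarrow> x \<notin> N i q1 q2"
        unfolding Z_def by auto
      then have "f differentiable (at x)"
        by (intro convex_differentiable_of_partials[OF f]) (force simp: N_def not_le)
      with x show False by simp
    qed
  qed
  ultimately show ?thesis by (rule AE_I')
qed


section \<open>The dual norm and semiconcavity of its square\<close>

context finsler
begin

abbreviation dual :: "real^'n \<Rightarrow> real" where "dual \<equiv> dual_norm F"

lemma dual_bdd: "bdd_above {(\<xi> \<bullet> \<eta>) / F \<xi> | \<xi>. \<xi> \<noteq> 0}"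
proof -
  obtain a where a: "0 < a" and ab: "\<And>x. a * norm x \<le> F x" using F_bounds by blast
  have "(\<xi> \<bullet> \<eta>) / F \<xi> \<le> norm \<eta> / a" if "\<xi> \<noteq> 0" for \<xi>
  proof -
    have "(\<xi> \<bullet> \<eta>) * a \<le> (norm \<xi> * norm \<eta>) * a"
      using norm_cauchy_schwarz[of \<xi> \<eta>] a by (intro mult_right_mono) auto
    also have "\<dots> \<le> F \<xi> * norm \<eta>"
      using mult_right_mono[OF ab[of \<xi>], of "norm \<eta>"] by (simp add: mult_ac)
    finally show ?thesis using F_pos[OF that] a by (simp add: divide_simps mult_ac)
  qed
  then show ?thesis by (intro bdd_aboveI[of _ "norm \<eta> / a"]) auto
qed

lemma inner_le_dual: "\<xi> \<bullet> \<eta> \<le> F \<xi> * dual \<eta>"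
proof (cases "\<xi> = 0")
  case False
  have "(\<xi> \<bullet> \<eta>) / F \<xi> \<le> dual \<eta>"
    unfolding dual_norm_def using dual_bdd False by (intro cSup_upper) auto
  then show ?thesis using F_pos[OF False] by (simp add: divide_simps mult_ac)
qed simp

lemma dual_le:
  assumes "\<And>\<xi>. \<xi> \<bullet> \<eta> \<le> F \<xi> * m"
  shows "dual \<eta> \<le> m"
  unfolding dual_norm_def
proof (rule cSup_least)
  have "axis undefined 1 \<noteq> (0::real^'n)" by (simp add: axis_eq_0_iff)
  then show "{(\<xi> \<bullet> \<eta>) / F \<xi> | \<xi>. \<xi> \<noteq> 0} \<noteq> {}" by blast
  fix z assume "z \<in> {(\<xi> \<bullet> \<eta>) / F \<xi> | \<xi>. \<xi> \<noteq> 0}"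
  then obtain \<xi> where "\<xi> \<noteq> 0" "z = (\<xi> \<bullet> \<eta>) / F \<xi>" by blast
  then show "z \<le> m" using assms[of \<xi>] F_pos[of \<xi>] by (simp add: pos_divide_le_eq mult_ac)
qed

lemma dual_bounds: "\<exists>a b. 0 < a \<and> 0 < b \<and> (\<forall>x. a * norm x \<le> dual x \<and> dual x \<le> b * norm x)"
proof -
  obtain a b where a: "0 < a" and b: "0 < b" and ab: "\<And>x. a * norm x \<le> F x" "\<And>x. F x \<le> b * norm x"
    using F_bounds by blast
  have "norm x / b \<le> dual x" for x
  proof (cases "x = 0")
    case True
    have "0 \<le> dual x" using inner_le_dual[of "axis undefined 1" x] F_pos[of "axis undefined 1"] True
      by (simp add: axis_eq_0_iff zero_le_mult_iff)
    then show ?thesis using True by simp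
  next
    case False
    have "norm x * norm x \<le> F x * dual x" using inner_le_dual[of x x] by (simp add: dot_square_norm power2_eq_square)
    moreover have "0 < norm x * norm x" using False by simp
    ultimately have "0 < dual x" using F_nonneg[of x] by (meson less_le_trans zero_less_mult_iff not_less)
    then have "F x * dual x \<le> b * norm x * dual x" using ab(2)[of x] by (intro mult_right_mono) auto
    with \<open>norm x * norm x \<le> F x * dual x\<close> have "norm x * norm x \<le> norm x * (b * dual x)" by (simp add: mult_ac)
    then have "norm x \<le> b * dual x" using False by simp
    then show ?thesis using b by (simp add: divide_simps mult_ac)
  qed
  moreover have "dual x \<le> norm x / a" for x
  proof (rule dual_le)
    fix \<xi> 
    have "(\<xi> \<bullet> x) \<le> norm \<xi> * norm x" by (rule norm_cauchy_schwarz)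
    also have "\<dots> \<le> F \<xi> / a * norm x" using ab(1)[of \<xi>] a by (intro mult_right_mono) (auto simp: field_simps)
    finally show "\<xi> \<bullet> x \<le> F \<xi> * (norm x / a)" by simp
  qed
  ultimately show ?thesis using a b by (intro exI[of _ "1/b"] exI[of _ "1/a"]) auto
qed

lemma dual_nonneg [simp]: "0 \<le> dual x"
proof -
  obtain a where "0 < a" "a * norm x \<le> dual x" using dual_bounds by blast
  then show ?thesis by (smt (verit) norm_ge_zero zero_le_mult_iff)
qed

lemma dual_triangle: "dual (x + y) \<le> dual x + dual y"
  by (rule dual_le) (use inner_le_dual[of _ x] inner_le_dual[of _ y] in \<open>simp add: inner_add_right distrib_left add_mono\<close>)

lemma dual_scaleR_le: "dual (t *\<^sub>R x) \<le> \<bar>t\<bar> * dual x"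
proof (rule dual_le)
  fix \<xi>
  have "\<xi> \<bullet> (t *\<^sub>R x) = (t *\<^sub>R \<xi>) \<bullet> x" by simp
  also have "\<dots> \<le> F (t *\<^sub>R \<xi>) * dual x" by (rule inner_le_dual)
  finally show "\<xi> \<bullet> (t *\<^sub>R x) \<le> F \<xi> * (\<bar>t\<bar> * dual x)" by (simp add: F_scaleR mult_ac)
qed

lemma dual_minus [simp]: "dual (- x) = dual x"
  using dual_scaleR_le[of "-1" x] dual_scaleR_le[of "-1" "-x"] by simp

lemma dual_lipschitz: "\<exists>b>0. \<forall>x y. \<bar>dual x - dual y\<bar> \<le> b * norm (x - y)"
proof -
  obtain b where b: "0 < b" "\<And>x. dual x \<le> b * norm x" using dual_bounds by blast
  have "\<bar>dual x - dual y\<bar> \<le> b * norm (x - y)" for x y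
    using dual_triangle[of y "x - y"] dual_triangle[of x "y - x"] dual_minus[of "x - y"] b(2)[of "x - y"] by simp
  with b(1) show ?thesis by blast
qed

lemma dual_continuous: "continuous_on S dual"
proof -
  obtain b where b: "0 < b" "\<And>x y. \<bar>dual x - dual y\<bar> \<le> b * norm (x - y)" using dual_lipschitz by blast
  have "b-lipschitz_on S dual" by (rule lipschitz_onI) (use b in \<open>auto simp: dist_norm\<close>)
  then show ?thesis by (rule lipschitz_on_continuous_on)
qed

text \<open>The maximiser is normalised as in the Legendre transform: it attains the supremum of
  \<xi> \<bullet> \<eta> - F(\<xi>)^2 / 2, whose value is half the squared dual norm.\<close>

lemma dual_attained: "\<exists>\<xi>. \<xi> \<bullet> \<eta> = (dual \<eta>)\<^sup>2 \<and> F \<xi> = dual \<eta>"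
proof -
  have comp: "compact (sphere (0::real^'n) 1)" by simp
  have "axis undefined 1 \<in> sphere (0::real^'n) 1" by simp
  then have ne: "sphere (0::real^'n) 1 \<noteq> {}" by blast
  have cont: "continuous_on (sphere 0 1) (\<lambda>\<xi>. (\<xi> \<bullet> \<eta>) / F \<xi>)"
    by (intro continuous_intros F_continuous) auto
  obtain x where x: "norm x = 1" "\<And>y. norm y = 1 \<Longrightarrow> (y \<bullet> \<eta>) / F y \<le> (x \<bullet> \<eta>) / F x"
    using continuous_attains_sup[OF comp ne cont] by auto
  define m where "m = (x \<bullet> \<eta>) / F x"
  have x0: "x \<noteq> 0" using x by auto
  have "dual \<eta> \<le> m"
  proof (rule dual_le)
    fix y show "y \<bullet> \<eta> \<le> F y * m"
    proof (cases "y = 0")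
      case False
      define z where "z = inverse (norm y) *\<^sub>R y"
      have "(z \<bullet> \<eta>) / F z \<le> m" using x(2)[of z] False by (simp add: z_def m_def)
      moreover have "(z \<bullet> \<eta>) / F z = (y \<bullet> \<eta>) / F y" using False by (simp add: z_def F_scaleR)
      ultimately show ?thesis using F_pos[OF False] by (simp add: divide_simps mult_ac)
    qed simp
  qed
  moreover have "m \<le> dual \<eta>"
    using inner_le_dual[of x \<eta>] F_pos[OF x0] by (simp add: m_def divide_simps mult_ac)
  ultimately have m: "m = dual \<eta>" by simp
  show ?thesis
    by (rule exI[of _ "(dual \<eta> / F x) *\<^sub>R x"])
       (use F_pos[OF x0] m in \<open>auto simp: F_scaleR m_def power2_eq_square field_simps\<close>)
qed

text \<open>Uniform convexity with p = 2 is used at the intermediate point, towards both end points;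
  with the weights t and 1 - t the first order terms cancel.\<close>

lemma F_sq_strongly_convex:
  "\<exists>c>0. \<forall>x y t. 0 \<le> t \<longrightarrow> t \<le> 1 \<longrightarrow>
     (F (t *\<^sub>R x + (1 - t) *\<^sub>R y))\<^sup>2 \<le> t * (F x)\<^sup>2 + (1 - t) * (F y)\<^sup>2 - c * t * (1 - t) * (norm (x - y))\<^sup>2"
proof -
  obtain c where c: "0 < c" and "\<And>x y. F x powr 2 + 2 * F x powr (2 - 1) * (grad F x \<bullet> y) + c * norm y powr 2 \<le> F (x + y) powr 2"
    using F_powr_uniformly_convex[of 2] by auto
  then have cv: "(F x)\<^sup>2 + 2 * F x * (grad F x \<bullet> y) + c * (norm y)\<^sup>2 \<le> (F (x + y))\<^sup>2" for x y
    by simp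
  have "(F (t *\<^sub>R x + (1 - t) *\<^sub>R y))\<^sup>2 \<le> t * (F x)\<^sup>2 + (1 - t) * (F y)\<^sup>2 - c * t * (1 - t) * (norm (x - y))\<^sup>2"
    if t: "0 \<le> t" "t \<le> 1" for x y t
  proof -
    define m where "m = t *\<^sub>R x + (1 - t) *\<^sub>R y"
    define k where "k = x - y"
    define A where "A = 2 * F m * (grad F m \<bullet> k)"
    have x: "x = m + (1 - t) *\<^sub>R k" and y: "y = m + (-t) *\<^sub>R k"
      by (simp_all add: m_def k_def algebra_simps)
    have 1: "(F m)\<^sup>2 + (1 - t) * A + c * ((1 - t)\<^sup>2 * (norm k)\<^sup>2) \<le> (F x)\<^sup>2"
      using cv[of m "(1 - t) *\<^sub>R k"] unfolding x[symmetric] by (simp add: A_def power_mult_distrib mult_ac)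
    have 2: "(F m)\<^sup>2 - t * A + c * (t\<^sup>2 * (norm k)\<^sup>2) \<le> (F y)\<^sup>2"
      using cv[of m "(-t) *\<^sub>R k"] unfolding y[symmetric] by (simp add: A_def power_mult_distrib mult_ac)
    have "t * ((F m)\<^sup>2 + (1 - t) * A + c * ((1 - t)\<^sup>2 * (norm k)\<^sup>2)) + (1 - t) * ((F m)\<^sup>2 - t * A + c * (t\<^sup>2 * (norm k)\<^sup>2))
       \<le> t * (F x)\<^sup>2 + (1 - t) * (F y)\<^sup>2"
      using 1 2 t by (intro add_mono mult_left_mono) auto
    moreover have "t * ((F m)\<^sup>2 + (1 - t) * A + c * ((1 - t)\<^sup>2 * (norm k)\<^sup>2)) + (1 - t) * ((F m)\<^sup>2 - t * A + c * (t\<^sup>2 * (norm k)\<^sup>2))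
      = (F m)\<^sup>2 + c * t * (1 - t) * (norm k)\<^sup>2"
      by algebra
    ultimately show ?thesis unfolding m_def k_def by linarith
  qed
  with c show ?thesis by blast
qed

text \<open>Legendre duality turns strong convexity into semiconcavity: the combination \<mu> of the
  two maximisers competes at the intermediate point m, and the mixed term \<open>S\<close> is
  absorbed into the strong convexity gain by Young's inequality, which leaves the constant
  1/c.\<close>

lemma dual_sq_semiconcave:
  "\<exists>C>0. \<forall>x y t. 0 \<le> t \<longrightarrow> t \<le> 1 \<longrightarrow>
     t * (dual x)\<^sup>2 + (1 - t) * (dual y)\<^sup>2 - C * t * (1 - t) * (norm (x - y))\<^sup>2 \<le> (dual (t *\<^sub>R x + (1 - t) *\<^sub>R y))\<^sup>2"
proof -
  obtain c where c: "0 < c" and sc: "\<And>x y t. 0 \<le> t \<Longrightarrow> t \<le> 1 \<Longrightarrow>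
     (F (t *\<^sub>R x + (1 - t) *\<^sub>R y))\<^sup>2 \<le> t * (F x)\<^sup>2 + (1 - t) * (F y)\<^sup>2 - c * t * (1 - t) * (norm (x - y))\<^sup>2"
    using F_sq_strongly_convex by blast
  have "t * (dual x)\<^sup>2 + (1 - t) * (dual y)\<^sup>2 - (1/c) * t * (1 - t) * (norm (x - y))\<^sup>2 \<le> (dual (t *\<^sub>R x + (1 - t) *\<^sub>R y))\<^sup>2"
    if t: "0 \<le> t" "t \<le> 1" for x y t
  proof -
    obtain \<xi> where \<xi>: "\<xi> \<bullet> x = (dual x)\<^sup>2" "F \<xi> = dual x" using dual_attained by blast
    obtain \<zeta> where \<zeta>: "\<zeta> \<bullet> y = (dual y)\<^sup>2" "F \<zeta> = dual y" using dual_attained by blast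
    define m where "m = t *\<^sub>R x + (1 - t) *\<^sub>R y"
    define \<mu> where "\<mu> = t *\<^sub>R \<xi> + (1 - t) *\<^sub>R \<zeta>"
    define S where "S = (\<xi> - \<zeta>) \<bullet> (x - y)"
    define X Y where "X = norm (\<xi> - \<zeta>)" and "Y = norm (x - y)"
    have tt: "0 \<le> t * (1 - t)" using t by simp
    have "\<mu> \<bullet> m \<le> F \<mu> * dual m" by (rule inner_le_dual)
    also have "2 * (F \<mu> * dual m) \<le> (F \<mu>)\<^sup>2 + (dual m)\<^sup>2"
      using sum_squares_bound[of "F \<mu>" "dual m"] by (simp add: mult_ac)
    finally have 1: "2 * (\<mu> \<bullet> m) - (F \<mu>)\<^sup>2 \<le> (dual m)\<^sup>2" by linarith
    have 2: "\<mu> \<bullet> m = t * (dual x)\<^sup>2 + (1 - t) * (dual y)\<^sup>2 - t * (1 - t) * S"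
    proof -
      have "\<mu> \<bullet> m = t * (\<xi> \<bullet> x) + (1 - t) * (\<zeta> \<bullet> y) - t * (1 - t) * S"
        unfolding \<mu>_def m_def S_def
        by (simp add: inner_add_left inner_add_right inner_diff_left inner_diff_right algebra_simps)
      then show ?thesis by (simp add: \<xi> \<zeta>)
    qed
    have 3: "(F \<mu>)\<^sup>2 \<le> t * (dual x)\<^sup>2 + (1 - t) * (dual y)\<^sup>2 - c * t * (1 - t) * X\<^sup>2"
      using sc[OF t, of \<xi> \<zeta>] by (simp add: \<mu>_def \<xi> \<zeta> X_def)
    have "2 * S \<le> 2 * (X * Y)" unfolding S_def X_def Y_def using norm_cauchy_schwarz by simp
    also have "2 * (X * Y) \<le> c * X\<^sup>2 + Y\<^sup>2 / c"
    proof -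
      have "0 \<le> (c * X - Y)\<^sup>2 / c" using c by simp
      also have "(c * X - Y)\<^sup>2 / c = c * X\<^sup>2 + Y\<^sup>2 / c - 2 * (X * Y)"
        using c by (simp add: power2_eq_square field_simps)
      finally show ?thesis by simp
    qed
    finally have "t * (1 - t) * (2 * S) \<le> t * (1 - t) * (c * X\<^sup>2 + Y\<^sup>2 / c)" using tt by (rule mult_left_mono)
    with 1 2 3 have "t * (dual x)\<^sup>2 + (1 - t) * (dual y)\<^sup>2 - t * (1 - t) * (Y\<^sup>2 / c) \<le> (dual m)\<^sup>2"
      by (simp add: algebra_simps)
    then show ?thesis by (simp add: m_def Y_def mult_ac)
  qed
  with c show ?thesis by (intro exI[of _ "1/c"]) auto
qed

end

section \<open>The anisotropic distance to the boundary\<close>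

locale finsler_domain = finsler F for F :: "real^'n::finite \<Rightarrow> real" +
  fixes \<Omega> :: "(real^'n) set"
  assumes dom: "domain \<Omega>"
begin

abbreviation d :: "real^'n \<Rightarrow> real" where "d \<equiv> dF F \<Omega>"

lemma open_\<Omega>: "open \<Omega>" and frontier_ne: "frontier \<Omega> \<noteq> {}"
  using dom by (auto simp: domain_def)

lemma d_le: "y \<in> frontier \<Omega> \<Longrightarrow> d x \<le> dual (x - y)"
  unfolding dF_def by (intro cINF_lower bdd_belowI2[of _ 0]) auto

lemma d_nonneg [simp]: "0 \<le> d x"
  unfolding dF_def using frontier_ne by (intro cINF_greatest) auto

lemma d_attained: "\<exists>y\<in>frontier \<Omega>. d x = dual (x - y)"
proof -
  obtain y0 where y0: "y0 \<in> frontier \<Omega>" using frontier_ne by blast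
  obtain a where a: "0 < a" "\<And>x. a * norm x \<le> dual x" using dual_bounds by blast
  \<comment> \<open>Boundary points farther than R from x have a larger dual distance than the
    candidate y0, so the infimum is one over a compact set.\<close>
  define R where "R = dual (x - y0) / a"
  define K where "K = frontier \<Omega> \<inter> cball x R"
  have K: "compact K" unfolding K_def by (intro closed_Int_compact) auto
  have "a * norm (x - y0) \<le> dual (x - y0)" by (rule a)
  then have y0K: "y0 \<in> K" using y0 a by (simp add: K_def R_def dist_norm field_simps)
  have cont: "continuous_on K (\<lambda>y. dual (x - y))"
    by (intro continuous_on_compose2[OF dual_continuous[of UNIV]] continuous_intros) auto
  obtain y where y: "y \<in> K" "\<And>z. z \<in> K \<Longrightarrow> dual (x - y) \<le> dual (x - z)"
    using continuous_attains_inf[OF K _ cont] y0K by blast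
  have "dual (x - y) \<le> dual (x - z)" if "z \<in> frontier \<Omega>" for z
  proof (cases "z \<in> K")
    case False
    then have "R < norm (x - z)" using that by (auto simp: K_def dist_norm)
    then have "dual (x - y0) < a * norm (x - z)" using a by (simp add: R_def field_simps)
    then show ?thesis using y(2)[OF y0K] a(2)[of "x - z"] by linarith
  qed (use y in auto)
  then have "dual (x - y) \<le> d x" unfolding dF_def using frontier_ne by (intro cINF_greatest) auto
  moreover have "y \<in> frontier \<Omega>" using y by (simp add: K_def)
  ultimately show ?thesis using d_le[of y x] by (intro bexI[of _ y]) auto
qed

lemma d_le_add: "d x \<le> d y + dual (x - y)"
proof -
  obtain z where z: "z \<in> frontier \<Omega>" "d y = dual (y - z)" using d_attained by blast
  have "d x \<le> dual ((y - z) + (x - y))" using d_le[OF z(1), of x] by simp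
  also have "\<dots> \<le> d y + dual (x - y)" using dual_triangle[of "y - z" "x - y"] z by simp
  finally show ?thesis .
qed

lemma d_lipschitz: "\<exists>b>0. b-lipschitz_on UNIV d"
proof -
  obtain b where b: "0 < b" "\<And>x. dual x \<le> b * norm x" using dual_bounds by blast
  have "b-lipschitz_on UNIV d"
  proof (rule lipschitz_onI)
    fix x y
    show "dist (d x) (d y) \<le> b * dist x y"
      using d_le_add[of x y] d_le_add[of y x] b(2)[of "x - y"] b(2)[of "y - x"]
      by (simp add: dist_norm norm_minus_commute)
  qed (use b in auto)
  with b(1) show ?thesis by blast
qed

lemma d_continuous: "continuous_on S d"
  using d_lipschitz lipschitz_on_continuous_on continuous_on_subset by blast

lemma \<Omega>_not_frontier: "x \<in> \<Omega> \<Longrightarrow> x \<notin> frontier \<Omega>"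
  using open_\<Omega> by (simp add: frontier_def interior_open)

lemma d_pos: "x \<in> \<Omega> \<Longrightarrow> 0 < d x"
proof -
  assume x: "x \<in> \<Omega>"
  obtain y where y: "y \<in> frontier \<Omega>" "d x = dual (x - y)" using d_attained by blast
  obtain a where a: "0 < a" "\<And>x. a * norm x \<le> dual x" using dual_bounds by blast
  have "x \<noteq> y" using \<Omega>_not_frontier[OF x] y by auto
  then have "0 < a * norm (x - y)" using a by simp
  then show ?thesis using a(2)[of "x - y"] y by linarith
qed

text \<open>Semiconcavity survives infima: the boundary point nearest to the intermediate point m is
  a competitor at both end points. The parallelogram type identity for the Euclidean norm then
  converts the quadratic defect into convexity.\<close>

lemma d_sq_semiconcave: "\<exists>C>0. convex_on UNIV (\<lambda>x. C * (norm x)\<^sup>2 - (d x)\<^sup>2)"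
proof -
  obtain C where C: "0 < C" and sc: "\<And>x y t. 0 \<le> t \<Longrightarrow> t \<le> 1 \<Longrightarrow>
     t * (dual x)\<^sup>2 + (1 - t) * (dual y)\<^sup>2 - C * t * (1 - t) * (norm (x - y))\<^sup>2 \<le> (dual (t *\<^sub>R x + (1 - t) *\<^sub>R y))\<^sup>2"
    using dual_sq_semiconcave by blast
  have "convex_on UNIV (\<lambda>x. C * (norm x)\<^sup>2 - (d x)\<^sup>2)"
  proof (rule convex_onI)
    fix s :: real and x y :: "real^'n" assume s: "0 < s" "s < 1"
    define t where "t = 1 - s"
    have t: "0 \<le> t" "t \<le> 1" "s = 1 - t" using s by (auto simp: t_def)
    define m where "m = t *\<^sub>R x + (1 - t) *\<^sub>R y"
    obtain z where z: "z \<in> frontier \<Omega>" "d m = dual (m - z)" using d_attained by blast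
    have sq: "(d w)\<^sup>2 \<le> (dual (w - z))\<^sup>2" for w using d_le[OF z(1), of w] by (intro power_mono) auto
    have "m - z = t *\<^sub>R (x - z) + (1 - t) *\<^sub>R (y - z)" by (simp add: m_def algebra_simps)
    then have "t * (dual (x - z))\<^sup>2 + (1 - t) * (dual (y - z))\<^sup>2 - C * t * (1 - t) * (norm (x - y))\<^sup>2 \<le> (d m)\<^sup>2"
      using sc[OF t(1,2), of "x - z" "y - z"] z by simp
    moreover have "t * (d x)\<^sup>2 + (1 - t) * (d y)\<^sup>2 \<le> t * (dual (x - z))\<^sup>2 + (1 - t) * (dual (y - z))\<^sup>2"
      using sq t by (intro add_mono mult_left_mono) auto
    moreover have nm: "(norm m)\<^sup>2 = t * (norm x)\<^sup>2 + (1 - t) * (norm y)\<^sup>2 - t * (1 - t) * (norm (x - y))\<^sup>2"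
      unfolding power2_norm_eq_inner m_def
      by (simp add: inner_add_left inner_add_right inner_diff_left inner_diff_right inner_commute algebra_simps)
    moreover have "C * (norm m)\<^sup>2 = C * (t * (norm x)\<^sup>2 + (1 - t) * (norm y)\<^sup>2 - t * (1 - t) * (norm (x - y))\<^sup>2)"
      by (simp only: nm)
    moreover have "(1 - s) *\<^sub>R x + s *\<^sub>R y = m" by (simp add: m_def t(3))
    ultimately show "C * (norm ((1 - s) *\<^sub>R x + s *\<^sub>R y))\<^sup>2 - (d ((1 - s) *\<^sub>R x + s *\<^sub>R y))\<^sup>2
       \<le> (1 - s) * (C * (norm x)\<^sup>2 - (d x)\<^sup>2) + s * (C * (norm y)\<^sup>2 - (d y)\<^sup>2)"
      using C by (simp add: t(3) algebra_simps)
  qed auto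
  with C show ?thesis by blast
qed

lemma d_AE_differentiable: "AE x in lebesgue. x \<in> \<Omega> \<longrightarrow> d differentiable (at x)"
proof -
  obtain C where cv: "convex_on UNIV (\<lambda>x. C * (norm x)\<^sup>2 - (d x)\<^sup>2)" using d_sq_semiconcave by blast
  from convex_AE_differentiable[OF cv] show ?thesis
  proof eventually_elim
    case (elim x)
    show ?case
    proof
      assume x: "x \<in> \<Omega>"
      have 1: "(\<lambda>x::real^'n. (norm x)\<^sup>2) differentiable (at x)"
        unfolding power2_norm_eq_inner differentiable_def by (auto intro!: derivative_eq_intros exI)
      have "(\<lambda>x. C * (norm x)\<^sup>2 - (C * (norm x)\<^sup>2 - (d x)\<^sup>2)) differentiable (at x)"
        by (intro differentiable_diff differentiable_mult 1 elim differentiable_const)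
      then have "(\<lambda>x. (d x)\<^sup>2) differentiable (at x)" by simp
      then obtain D where D: "((\<lambda>x. (d x)\<^sup>2) has_derivative D) (at x)" unfolding differentiable_def by blast
      have "((\<lambda>x. sqrt ((d x)\<^sup>2)) has_derivative (\<lambda>h. D h * (inverse (sqrt ((d x)\<^sup>2)) / 2))) (at x)"
        using d_pos[OF x] by (intro has_derivative_real_sqrt D) auto
      then show "d differentiable (at x)" unfolding differentiable_def by auto
    qed
  qed
qed

text \<open>The eikonal equation. The triangle inequality gives \<nabla>d \<bullet> h \<le> dual h,
  and testing with the norming vector \<open>grad F (grad d x)\<close>, whose dual norm is at most
  one, bounds the norm from above. Conversely d decreases linearly along the segment to a nearest
  boundary point, which bounds it from below.\<close>

lemma F_grad_d:
  assumes x: "x \<in> \<Omega>" and diff: "d differentiable (at x)"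
  shows "F (grad d x) = 1"
proof -
  let ?g = "grad d x"
  have line: "((\<lambda>t. d (x + t *\<^sub>R h)) has_real_derivative (?g \<bullet> h)) (at 0)" for h
  proof -
    have "(d has_derivative (\<lambda>h. ?g \<bullet> h)) (at (x + 0 *\<^sub>R h))" using has_derivative_grad[OF diff] by simp
    moreover have "((\<lambda>t. x + t *\<^sub>R h) has_derivative (\<lambda>t. t *\<^sub>R h)) (at 0)"
      by (auto intro!: derivative_eq_intros)
    ultimately have "((\<lambda>t. d (x + t *\<^sub>R h)) has_derivative (\<lambda>t. ?g \<bullet> (t *\<^sub>R h))) (at 0)"
      by (rule has_derivative_compose[rotated])
    then show ?thesis unfolding has_field_derivative_def by (simp add: mult_commute_abs)
  qed
  have q: "((\<lambda>t. (d (x + t *\<^sub>R h) - d x) / t) \<longlongrightarrow> ?g \<bullet> h) (at_right 0)" for h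
  proof -
    have "((\<lambda>t. (d (x + t *\<^sub>R h) - d x) / t) \<longlongrightarrow> ?g \<bullet> h) (at 0)"
      using line[of h] by (simp add: DERIV_def)
    then show ?thesis by (rule filterlim_mono) (auto simp: at_le)
  qed
  have up: "?g \<bullet> h \<le> dual h" for h
  proof (rule tendsto_upperbound[OF q])
    show "\<forall>\<^sub>F t in at_right 0. (d (x + t *\<^sub>R h) - d x) / t \<le> dual h"
      using eventually_at_right_less[of 0]
    proof eventually_elim
      case (elim t)
      have "d (x + t *\<^sub>R h) \<le> d x + t * dual h"
        using d_le_add[of "x + t *\<^sub>R h" x] dual_scaleR_le[of t h] elim by simp
      then show ?case using elim by (simp add: divide_simps mult.commute)
    qed
  qed simp
  obtain y where y: "y \<in> frontier \<Omega>" "d x = dual (x - y)" using d_attained by blast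
  have low: "?g \<bullet> (y - x) \<le> - d x"
  proof (rule tendsto_upperbound[OF q])
    have "\<forall>\<^sub>F t in at_right (0::real). t < 1"
      by (rule eventually_at_rightI[of 0 1]) auto
    then show "\<forall>\<^sub>F t in at_right 0. (d (x + t *\<^sub>R (y - x)) - d x) / t \<le> - d x"
      using eventually_at_right_less[of 0]
    proof eventually_elim
      case (elim t)
      have "x + t *\<^sub>R (y - x) - y = (1 - t) *\<^sub>R (x - y)" by (simp add: algebra_simps)
      then have "d (x + t *\<^sub>R (y - x)) \<le> dual ((1 - t) *\<^sub>R (x - y))"
        using d_le[OF y(1), of "x + t *\<^sub>R (y - x)"] by simp
      also have "\<dots> \<le> (1 - t) * d x" using dual_scaleR_le[of "1 - t" "x - y"] elim y by simp
      finally have "d (x + t *\<^sub>R (y - x)) - d x \<le> - d x * t" by (simp add: algebra_simps)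
      then show ?case using elim by (simp add: divide_simps)
    qed
  qed simp
  have "d x \<le> ?g \<bullet> (x - y)" using low by (simp add: inner_diff_right)
  also have "\<dots> \<le> F ?g * d x" using inner_le_dual[of ?g "x - y"] y by simp
  finally have ge: "1 \<le> F ?g" using d_pos[OF x] by simp
  then have nz: "?g \<noteq> 0" by auto
  have "F ?g = ?g \<bullet> grad F ?g" using grad_F_euler[OF nz] by (simp add: inner_commute)
  also have "\<dots> \<le> dual (grad F ?g)" by (rule up)
  also have "\<dots> \<le> 1" by (rule dual_le) (use grad_F_inner_le[OF nz] in \<open>simp add: inner_commute\<close>)
  finally show ?thesis using ge by simp
qed

end

section \<open>Mollification\<close>

text \<open>The standard flat function exp(-1/t), multiplied by powers of 1/t so that derivatives
  are linear combinations of members of the same family.\<close>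

definition beta :: "nat \<Rightarrow> real \<Rightarrow> real" where
  "beta m t = (if 0 < t then exp (- inverse t) * inverse t ^ m else 0)"

lemma beta_tendsto_0: "(beta m \<longlongrightarrow> 0) (at_right 0)"
proof -
  have "((\<lambda>t. inverse t ^ m / exp (inverse t :: real)) \<longlongrightarrow> 0) (at_right 0)"
    by (rule filterlim_compose[OF tendsto_power_div_exp_0 filterlim_inverse_at_top_right])
  then show ?thesis
  proof (rule Lim_transform_eventually)
    show "\<forall>\<^sub>F t in at_right 0. inverse t ^ m / exp (inverse t :: real) = beta m t"
      using eventually_at_right_less[of 0] by eventually_elim (auto simp: beta_def exp_minus divide_inverse)
  qed
qed

lemma beta_nonneg [simp]: "0 \<le> beta m t"
  by (simp add: beta_def)

text \<open>At 0 the difference quotient of \<open>beta m\<close> is \<open>beta (Suc m)\<close> on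
  the right and zero on the left, so flatness of the next member of the family gives the
  derivative.\<close>

lemma beta_has_real_derivative:
  "(beta m has_real_derivative (- real m * beta (Suc m) t + beta (Suc (Suc m)) t)) (at t)"
proof -
  consider "0 < t" | "t < 0" | "t = 0" by linarith
  then show ?thesis
  proof cases
    case 1
    have "((\<lambda>t. exp (- inverse t) * inverse t ^ m) has_real_derivative
        - real m * (exp (- inverse t) * inverse t ^ Suc m) + exp (- inverse t) * inverse t ^ Suc (Suc m)) (at t)"
    proof (cases m)
      case (Suc k)
      then show ?thesis using 1
        by (auto intro!: derivative_eq_intros simp: field_simps power2_eq_square) (cases k; simp)
    qed (use 1 in \<open>auto intro!: derivative_eq_intros simp: power2_eq_square\<close>)
    then show ?thesis
      by (rule has_field_derivative_transform_within_open[where S="{0<..}", THEN DERIV_cong])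
         (use 1 in \<open>auto simp: beta_def\<close>)
  next
    case 2
    show ?thesis
      by (rule has_field_derivative_transform_within_open[where S="{..<0}" and f="\<lambda>_. 0", THEN DERIV_cong])
         (use 2 in \<open>auto simp: beta_def\<close>)
  next
    case 3
    have "((\<lambda>h. beta m h / h) \<longlongrightarrow> 0) (at_right 0)"
    proof (rule Lim_transform_eventually[OF beta_tendsto_0[of "Suc m"]])
      show "\<forall>\<^sub>F h in at_right 0. beta (Suc m) h = beta m h / h"
        using eventually_at_right_less[of 0] by eventually_elim (auto simp: beta_def divide_inverse)
    qed
    moreover have "((\<lambda>h. beta m h / h) \<longlongrightarrow> 0) (at_left 0)"
    proof (rule Lim_transform_eventually[OF tendsto_const])
      show "\<forall>\<^sub>F h in at_left 0. 0 = beta m h / h"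
        unfolding eventually_at_filter by (rule always_eventually) (auto simp: beta_def)
    qed
    ultimately have "((\<lambda>h. beta m h / h) \<longlongrightarrow> 0) (at 0)" by (rule filterlim_split_at_real[rotated])
    then show ?thesis using 3 by (simp add: DERIV_def beta_def)
  qed
qed

text \<open>The class contains the mollifier itself and is closed under multiplication by coordinates and
  under partial derivatives; this gives smoothness and, via integration of derivatives, the
  first moments of the gradient of the mollifier.\<close>

inductive bump_fun :: "real \<Rightarrow> (real^'n::finite \<Rightarrow> real) \<Rightarrow> bool" for r where
  base: "bump_fun r (\<lambda>x. beta m (r\<^sup>2 - x \<bullet> x))"
| add: "bump_fun r f \<Longrightarrow> bump_fun r g \<Longrightarrow> bump_fun r (\<lambda>x. f x + g x)"
| cmul: "bump_fun r f \<Longrightarrow> bump_fun r (\<lambda>x. c * f x)"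
| coord: "bump_fun r f \<Longrightarrow> bump_fun r (\<lambda>x. x $ i * f x)"

lemma bump_fun_derivative:
  fixes f :: "real^'n::finite \<Rightarrow> real"
  assumes "bump_fun r f"
  shows "\<exists>g. (\<forall>i. bump_fun r (g i)) \<and> (\<forall>x. (f has_derivative (\<lambda>h. \<Sum>i\<in>UNIV. g i x * h $ i)) (at x))"
  using assms
proof induction
  case (base m)
  define g where "g i x = (-2) * (x $ i * ((- real m) * beta (Suc m) (r\<^sup>2 - x \<bullet> x) + beta (Suc (Suc m)) (r\<^sup>2 - x \<bullet> x)))"
    for i and x :: "real^'n"
  have "bump_fun r (g i)" for i unfolding g_def by (intro bump_fun.intros)
  moreover have "((\<lambda>x. beta m (r\<^sup>2 - x \<bullet> x)) has_derivative (\<lambda>h. \<Sum>i\<in>UNIV. g i x * h $ i)) (at x)" for x :: "real^'n"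
  proof -
    have "((\<lambda>x. beta m (r\<^sup>2 - x \<bullet> x)) has_derivative
       (\<lambda>h. (- real m * beta (Suc m) (r\<^sup>2 - x \<bullet> x) + beta (Suc (Suc m)) (r\<^sup>2 - x \<bullet> x)) * (- (x \<bullet> h + h \<bullet> x)))) (at x)"
      by (rule has_derivative_compose[OF _ beta_has_real_derivative[unfolded has_field_derivative_def]])
         (auto intro!: derivative_eq_intros)
    moreover have "(- real m * beta (Suc m) (r\<^sup>2 - x \<bullet> x) + beta (Suc (Suc m)) (r\<^sup>2 - x \<bullet> x)) * (- (x \<bullet> h + h \<bullet> x))
       = (\<Sum>i\<in>UNIV. g i x * h $ i)" for h
    proof -
      have "x \<bullet> h + h \<bullet> x = 2 * (\<Sum>i\<in>UNIV. x $ i * h $ i)"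
        by (simp add: inner_vec_def mult.commute)
      moreover have "(\<Sum>i\<in>UNIV. g i x * h $ i) = (- real m * beta (Suc m) (r\<^sup>2 - x \<bullet> x) + beta (Suc (Suc m)) (r\<^sup>2 - x \<bullet> x))
          * (- (2 * (\<Sum>i\<in>UNIV. x $ i * h $ i)))"
        unfolding g_def sum_distrib_left sum_negf[symmetric] by (intro sum.cong refl) algebra
      ultimately show ?thesis by simp
    qed
    ultimately show ?thesis by simp
  qed
  ultimately show ?case by (intro exI[of _ g] conjI allI)
next
  case (add f1 f2)
  then obtain g1 g2 where g: "\<And>i. bump_fun r (g1 i)" "\<And>i. bump_fun r (g2 i)"
    "\<And>x. (f1 has_derivative (\<lambda>h. \<Sum>i\<in>UNIV. g1 i x * h $ i)) (at x)"
    "\<And>x. (f2 has_derivative (\<lambda>h. \<Sum>i\<in>UNIV. g2 i x * h $ i)) (at x)" by blast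
  show ?case
    by (rule exI[of _ "\<lambda>i x. g1 i x + g2 i x"])
       (auto intro!: bump_fun.add g has_derivative_eq_rhs[OF has_derivative_add[OF g(3,4)]]
         simp: sum.distrib distrib_right)
next
  case (cmul f c)
  then obtain g where g: "\<And>i. bump_fun r (g i)"
    "\<And>x. (f has_derivative (\<lambda>h. \<Sum>i\<in>UNIV. g i x * h $ i)) (at x)" by blast
  show ?case
    by (rule exI[of _ "\<lambda>i x. c * g i x"])
       (auto intro!: bump_fun.cmul g has_derivative_eq_rhs[OF has_derivative_mult_right[OF g(2), of c]]
         simp: sum_distrib_left mult_ac)
next
  case (coord f j)
  then obtain g where g: "\<And>i. bump_fun r (g i)"
    "\<And>x. (f has_derivative (\<lambda>h. \<Sum>i\<in>UNIV. g i x * h $ i)) (at x)" by blast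
  have nth: "((\<lambda>x. x $ j) has_derivative (\<lambda>h. h $ j)) (at x)" for x :: "real^'n"
    by (rule bounded_linear.has_derivative[OF bounded_linear_vec_nth]) auto
  define k where "k i x = (if i = j then 1 else 0) * f x + x $ j * g i x" for i x
  have "bump_fun r (k i)" for i
    unfolding k_def by (intro bump_fun.add bump_fun.cmul bump_fun.coord coord.hyps g)
  moreover have "((\<lambda>x. x $ j * f x) has_derivative (\<lambda>h. \<Sum>i\<in>UNIV. k i x * h $ i)) (at x)" for x
  proof (rule has_derivative_eq_rhs[OF has_derivative_mult[OF nth g(2)]])
    have "(\<Sum>i\<in>UNIV. (if i = j then 1 else 0) * f x * h $ i) = h $ j * f x" for h :: "real^'n"
      by (simp add: if_distrib[of "\<lambda>u. u * _"] cong: if_cong)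
    then show "(\<lambda>h. x $ j * (\<Sum>i\<in>UNIV. g i x * h $ i) + h $ j * f x) = (\<lambda>h. \<Sum>i\<in>UNIV. k i x * h $ i)"
      by (simp add: k_def distrib_right sum.distrib sum_distrib_left mult.assoc add.commute)
  qed
  ultimately show ?case by (intro exI[of _ k] conjI allI)
qed

lemma bump_fun_differentiable: "bump_fun r f \<Longrightarrow> f differentiable (at x)"
  using bump_fun_derivative unfolding differentiable_def by blast

lemma bump_fun_pderiv:
  assumes "bump_fun r f" shows "bump_fun r (pderiv_dir i f)"
proof -
  obtain g where g: "\<And>i. bump_fun r (g i)" "\<And>x. (f has_derivative (\<lambda>h. \<Sum>i\<in>UNIV. g i x * h $ i)) (at x)"
    using bump_fun_derivative[OF assms] by blast
  have "grad f x = (\<chi> i. g i x)" for x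
    using g(2)[of x] by (intro grad_eqI) (simp add: inner_vec_def)
  then have "pderiv_dir i f = g i" by (auto simp: grad_def fun_eq_iff vec_eq_iff)
  then show ?thesis using g by simp
qed

lemma bump_fun_continuous: "bump_fun r f \<Longrightarrow> continuous_on S f"
  using bump_fun_differentiable differentiable_imp_continuous_within
  by (metis continuous_at_imp_continuous_on)

lemma bump_fun_support:
  assumes "bump_fun r f" "0 < r" "r \<le> norm x" shows "f x = 0"
proof -
  have "r\<^sup>2 \<le> x \<bullet> x" using assms by (simp add: power_mono flip: power2_norm_eq_inner)
  with assms(1) show ?thesis by induction (auto simp: beta_def)
qed

lemma integrable_compact_support:
  fixes f :: "'a::euclidean_space \<Rightarrow> real"
  assumes f: "continuous_on UNIV f" and K: "compact K" "\<And>x. x \<notin> K \<Longrightarrow> f x = 0"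
  shows "integrable lborel f"
proof -
  have "integrable lborel (\<lambda>x. indicator K x *\<^sub>R f x)"
    using borel_integrable_compact[OF K(1)] f continuous_on_subset by blast
  moreover have "(\<lambda>x. indicator K x *\<^sub>R f x) = f" using K(2) by (force simp: indicator_def)
  ultimately show ?thesis by simp
qed

lemma lborel_integral_reflect:
  fixes f :: "real^'n::finite \<Rightarrow> real"
  assumes [measurable]: "f \<in> borel_measurable borel"
  shows "(\<integral>y. f (x - y) \<partial>lborel) = (\<integral>y. f y \<partial>lborel)"
proof -
  have "lborel = distr lborel borel (\<lambda>y. x - y)"
    using lborel_affine[of "-1" x] by (simp add: density_1)
  then have "(\<integral>y. f y \<partial>lborel) = (\<integral>y. f y \<partial>distr lborel borel (\<lambda>y. x - y))"
    by simp
  also have "\<dots> = (\<integral>y. f (x - y) \<partial>lborel)"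
    by (simp add: integral_distr)
  finally show ?thesis by simp
qed

text \<open>A convolution cut off to a box, so that the rule for differentiation under an integral
  over a compact box applies. All derivatives fall on f, and \<phi> has to be merely
  continuous.\<close>

definition box_conv :: "real^'n::finite \<Rightarrow> real^'n \<Rightarrow> (real^'n \<Rightarrow> real) \<Rightarrow> (real^'n \<Rightarrow> real) \<Rightarrow> real^'n \<Rightarrow> real" where
  "box_conv a b \<phi> f x = integral (cbox a b) (\<lambda>y. \<phi> y * f (x - y))"

lemma box_conv_has_derivative:
  fixes \<phi> :: "real^'n::finite \<Rightarrow> real"
  assumes \<phi>: "continuous_on UNIV \<phi>" and f: "bump_fun r f"
  shows "(box_conv a b \<phi> f has_derivative (\<lambda>h. (\<chi> i. box_conv a b \<phi> (pderiv_dir i f) x) \<bullet> h)) (at x)"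
proof -
  define B where "B i = blinfun_inner_right (axis i 1 :: real^'n)" for i :: 'n
  define fx where "fx x y = (\<Sum>i\<in>UNIV. (\<phi> y * pderiv_dir i f (x - y)) *\<^sub>R B i)" for x y
  have fcont: "continuous_on UNIV f" by (rule bump_fun_continuous[OF f])
  have pcont: "continuous_on UNIV (pderiv_dir i f)" for i by (rule bump_fun_continuous[OF bump_fun_pderiv[OF f]])
  have Bi: "blinfun_apply (B i) h = h $ i" for i h by (simp add: B_def inner_axis' )
  have "((\<lambda>x. integral (cbox a b) (\<lambda>y. \<phi> y * f (x - y))) has_derivative integral (cbox a b) (fx x)) (at x within UNIV)"
  proof (rule leibniz_rule)
    fix x y :: "real^'n"
    have "(f has_derivative (\<lambda>h. grad f (x - y) \<bullet> h)) (at (x - y))"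
      by (rule has_derivative_grad[OF bump_fun_differentiable[OF f]])
    then have "((\<lambda>x. f (x - y)) has_derivative (\<lambda>h. grad f (x - y) \<bullet> h)) (at x)"
      by (rule has_derivative_compose[rotated]) (auto intro!: derivative_eq_intros)
    then have "((\<lambda>x. \<phi> y * f (x - y)) has_derivative (\<lambda>h. \<phi> y * (grad f (x - y) \<bullet> h))) (at x)"
      by (rule has_derivative_mult_right)
    moreover have "blinfun_apply (fx x y) = (\<lambda>h. \<phi> y * (grad f (x - y) \<bullet> h))"
      by (auto simp: fx_def blinfun.sum_left blinfun.scaleR_left Bi grad_def inner_vec_def sum_distrib_left mult_ac)
    ultimately show "((\<lambda>x. \<phi> y * f (x - y)) has_derivative blinfun_apply (fx x y)) (at x within UNIV)" by simp
  next
    show "(\<lambda>y. \<phi> y * f (x - y)) integrable_on cbox a b" for x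
      by (intro integrable_continuous continuous_intros continuous_on_subset[OF \<phi>] continuous_on_compose2[OF fcont]) auto
    show "continuous_on (UNIV \<times> cbox a b) (\<lambda>(x, t). fx x t)"
      unfolding fx_def case_prod_unfold
      by (intro continuous_intros continuous_on_compose2[OF \<phi>] continuous_on_compose2[OF pcont]) auto
  qed auto
  moreover have "integral (cbox a b) (fx x) = (\<Sum>i\<in>UNIV. box_conv a b \<phi> (pderiv_dir i f) x *\<^sub>R B i)"
    unfolding fx_def box_conv_def
    by (intro integral_unique has_integral_sum has_integral_scaleR_left integrable_integral integrable_continuous
        continuous_intros continuous_on_subset[OF \<phi>] continuous_on_compose2[OF pcont]) auto
  moreover have "blinfun_apply (\<Sum>i\<in>UNIV. box_conv a b \<phi> (pderiv_dir i f) x *\<^sub>R B i)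
     = (\<lambda>h. (\<chi> i. box_conv a b \<phi> (pderiv_dir i f) x) \<bullet> h)"
    by (auto simp: blinfun.sum_left blinfun.scaleR_left Bi inner_vec_def)
  ultimately show ?thesis unfolding box_conv_def[abs_def] by simp
qed

lemma box_conv_pderiv:
  assumes "continuous_on UNIV \<phi>" "bump_fun r f"
  shows "pderiv_dir i (box_conv a b \<phi> f) = box_conv a b \<phi> (pderiv_dir i f)"
proof
  fix x
  have "grad (box_conv a b \<phi> f) x = (\<chi> i. box_conv a b \<phi> (pderiv_dir i f) x)"
    by (rule grad_eqI[OF box_conv_has_derivative[OF assms]])
  then show "pderiv_dir i (box_conv a b \<phi> f) x = box_conv a b \<phi> (pderiv_dir i f) x"
    by (auto simp: grad_def vec_eq_iff)
qed

lemma box_conv_smooth: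
  assumes \<phi>: "continuous_on UNIV \<phi>" and f: "bump_fun r f"
  shows "Ck_on UNIV k (box_conv a b \<phi> f)"
  using f
proof (induction k arbitrary: f)
  case 0
  then show ?case
    using has_derivative_continuous[OF box_conv_has_derivative[OF \<phi>]]
    by (auto intro!: continuous_at_imp_continuous_on)
next
  case (Suc k)
  have "box_conv a b \<phi> f differentiable (at x)" for x
    using box_conv_has_derivative[OF \<phi> Suc.prems] unfolding differentiable_def by blast
  moreover have "Ck_on UNIV k (pderiv_dir i (box_conv a b \<phi> f))" for i
    unfolding box_conv_pderiv[OF \<phi> Suc.prems] by (rule Suc.IH[OF bump_fun_pderiv[OF Suc.prems]])
  ultimately show ?case by simp
qed

lemma box_conv_eq_lborel:
  fixes \<phi> :: "real^'n::finite \<Rightarrow> real"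
  assumes \<phi>: "continuous_on UNIV \<phi>" and f: "continuous_on UNIV f"
    and supp: "\<And>y. y \<notin> cbox a b \<Longrightarrow> \<phi> y * f (x - y) = 0"
  shows "box_conv a b \<phi> f x = (\<integral>z. \<phi> (x - z) * f z \<partial>lborel)"
proof -
  have cont: "continuous_on UNIV (\<lambda>y. \<phi> y * f (x - y))"
    by (intro continuous_intros \<phi> continuous_on_compose2[OF f]) auto
  have int: "integrable lborel (\<lambda>y. \<phi> y * f (x - y))"
    by (rule integrable_compact_support[OF cont compact_cbox supp])
  have [measurable]: "\<phi> \<in> borel_measurable borel" "f \<in> borel_measurable borel"
    using \<phi> f by (auto intro: borel_measurable_continuous_onI)
  have "box_conv a b \<phi> f x = integral UNIV (\<lambda>y. \<phi> y * f (x - y))"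
  proof -
    have "(\<lambda>y. if y \<in> cbox a b then \<phi> y * f (x - y) else 0) = (\<lambda>y. \<phi> y * f (x - y))"
    proof
      fix y show "(if y \<in> cbox a b then \<phi> y * f (x - y) else 0) = \<phi> y * f (x - y)"
        using supp[of y] by (cases "y \<in> cbox a b") simp_all
    qed
    then show ?thesis unfolding box_conv_def
      using integral_restrict_UNIV[of "cbox a b" "\<lambda>y. \<phi> y * f (x - y)"] by simp
  qed
  also have "\<dots> = (\<integral>y. \<phi> y * f (x - y) \<partial>lborel)"
    using has_integral_integral_lborel[OF int] by (simp add: integral_unique)
  also have "\<dots> = (\<integral>z. \<phi> (x - z) * f z \<partial>lborel)"
    using lborel_integral_reflect[of "\<lambda>z. \<phi> (x - z) * f z" x] by simp
  finally show ?thesis .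
qed

lemma bump_fun_integrable:
  assumes f: "bump_fun r f" and r: "0 < r" and \<phi>: "continuous_on UNIV \<phi>"
  shows "integrable lborel (\<lambda>z. \<phi> z * f z)"
  by (rule integrable_compact_support[where K="cball 0 r"])
     (use bump_fun_support[OF f r] in \<open>auto intro!: continuous_intros \<phi> bump_fun_continuous[OF f]\<close>)

text \<open>The convolution of f with the constant 1 over a large box is constant near the origin,
  while its derivative there consists of the integrals of the partial derivatives.\<close>

lemma bump_fun_integral_pderiv:
  fixes f :: "real^'n::finite \<Rightarrow> real"
  assumes f: "bump_fun r f" and r: "0 < r"
  shows "(\<integral>z. pderiv_dir i f z \<partial>lborel) = 0"
proof -
  have "bounded (cball (0::real^'n) (r + 1))" by simp
  then obtain a where a: "cball (0::real^'n) (r + 1) \<subseteq> cbox (-a) a"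
    using bounded_subset_cbox_symmetric by blast
  have eq: "box_conv (-a) a (\<lambda>_. 1) g x = (\<integral>z. g z \<partial>lborel)" if g: "bump_fun r g" and x: "norm x < 1" for g x
  proof -
    have "1 * g (x - y) = 0" if "y \<notin> cbox (-a) a" for y
    proof -
      have "y \<notin> cball 0 (r + 1)" using a that by blast
      then have "r \<le> norm (x - y)" using x norm_triangle_ineq4[of x "x - y"] by simp
      then show ?thesis using bump_fun_support[OF g r] by simp
    qed
    then show ?thesis
      by (subst box_conv_eq_lborel) (auto intro!: bump_fun_continuous[OF g])
  qed
  have "(box_conv (-a) a (\<lambda>_. 1) f has_derivative (\<lambda>h. (\<chi> i. box_conv (-a) a (\<lambda>_. 1) (pderiv_dir i f) 0) \<bullet> h)) (at 0)"
    by (rule box_conv_has_derivative[OF _ f]) auto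
  moreover have "(box_conv (-a) a (\<lambda>_. 1) f has_derivative (\<lambda>h. 0)) (at 0)"
    by (rule has_derivative_transform_within_open[OF has_derivative_const, of "ball 0 1"])
       (use eq[OF f] in auto)
  ultimately have "(\<lambda>h. (\<chi> i. box_conv (-a) a (\<lambda>_. 1) (pderiv_dir i f) 0) \<bullet> h) = (\<lambda>h. 0)"
    by (rule has_derivative_unique)
  then have "(\<chi> i. box_conv (-a) a (\<lambda>_. 1) (pderiv_dir i f) 0) \<bullet> axis i 1 = 0" by (rule fun_cong)
  then show ?thesis using eq[OF bump_fun_pderiv[OF f], of 0 i] by (simp add: inner_axis)
qed


section \<open>Moments of the gradient of the mollifier\<close>

definition mol :: "real \<Rightarrow> real^'n::finite \<Rightarrow> real" where
  "mol r x = beta 0 (r\<^sup>2 - x \<bullet> x)"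

lemma mol_bump_fun: "bump_fun r (mol r)"
  unfolding mol_def[abs_def] by (rule bump_fun.base)

lemma mol_nonneg: "0 \<le> mol r x" by (simp add: mol_def)

lemma mol_pderiv: "pderiv_dir i (mol r) x = - 2 * x $ i * beta 2 (r\<^sup>2 - x \<bullet> x)"
proof -
  have "grad (mol r) x = (-2 * beta 2 (r\<^sup>2 - x \<bullet> x)) *\<^sub>R x"
  proof (rule grad_eqI)
    have "((\<lambda>x. beta 0 (r\<^sup>2 - x \<bullet> x)) has_derivative
       (\<lambda>h. (- real 0 * beta (Suc 0) (r\<^sup>2 - x \<bullet> x) + beta (Suc (Suc 0)) (r\<^sup>2 - x \<bullet> x)) * (- (x \<bullet> h + h \<bullet> x)))) (at x)"
      by (rule has_derivative_compose[OF _ beta_has_real_derivative[unfolded has_field_derivative_def]])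
         (auto intro!: derivative_eq_intros)
    moreover have "(- real 0 * beta (Suc 0) (r\<^sup>2 - x \<bullet> x) + beta (Suc (Suc 0)) (r\<^sup>2 - x \<bullet> x)) * (- (x \<bullet> h + h \<bullet> x))
        = (-2 * beta 2 (r\<^sup>2 - x \<bullet> x)) *\<^sub>R x \<bullet> h" for h
      by (simp add: inner_commute numeral_2_eq_2)
    ultimately show "(mol r has_derivative (\<lambda>h. (-2 * beta 2 (r\<^sup>2 - x \<bullet> x)) *\<^sub>R x \<bullet> h)) (at x)"
      unfolding mol_def[abs_def] by simp
  qed
  then show ?thesis by (simp add: grad_def vec_eq_iff)
qed

lemma mol_integrable:
  assumes "0 < r" "continuous_on UNIV \<phi>"
  shows "integrable lborel (\<lambda>z. \<phi> z * mol r z)" "integrable lborel (\<lambda>z. \<phi> z * pderiv_dir i (mol r) z)"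
  by (rule bump_fun_integrable[OF mol_bump_fun assms], rule bump_fun_integrable[OF bump_fun_pderiv[OF mol_bump_fun] assms])

lemma mol_integral_pos:
  assumes r: "0 < r" shows "0 < (\<integral>z. mol r z \<partial>(lborel :: (real^'n::finite) measure))"
proof -
  let ?I = "(\<integral>z. mol r z \<partial>(lborel :: (real^'n) measure))"
  have int: "integrable (lborel :: (real^'n) measure) (mol r)" using mol_integrable(1)[OF r, of "\<lambda>_. 1"] by simp
  have "0 \<le> ?I" by (rule integral_nonneg_AE) (simp add: mol_nonneg)
  moreover have "?I \<noteq> 0"
  proof
    assume "?I = 0"
    then have "AE z in (lborel :: (real^'n) measure). mol r z = 0"
      using integral_nonneg_eq_0_iff_AE[OF int] mol_nonneg by auto
    then have "AE z in (lborel :: (real^'n) measure). z \<notin> ball 0 r"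
    proof eventually_elim
      case (elim z)
      then have "\<not> z \<bullet> z < r\<^sup>2" by (auto simp: mol_def beta_def split: if_splits)
      then show ?case using r by (auto simp: power_strict_mono not_less simp flip: power2_norm_eq_inner)
    qed
    then have "emeasure (lborel :: (real^'n) measure) (ball 0 r) = 0"
      by (subst (asm) AE_iff_measurable[OF _ refl]) (auto simp: ball_def)
    then show False using content_ball_pos[OF r, of "0::real^'n"] by (simp add: measure_def)
  qed
  ultimately show ?thesis by simp
qed

lemma mol_integral_pderiv: "0 < r \<Longrightarrow> (\<integral>z. pderiv_dir i (mol r) z \<partial>lborel) = 0"
  by (rule bump_fun_integral_pderiv[OF mol_bump_fun])

text \<open>Integration by parts: the i-th partial derivative of z_j times the mollifier has
  integral zero.\<close>

lemma mol_moment: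
  assumes r: "0 < r"
  shows "(\<integral>z. z $ j * pderiv_dir i (mol r) z \<partial>(lborel :: (real^'n::finite) measure)) =
    - (if i = j then (\<integral>z. mol r z \<partial>(lborel :: (real^'n) measure)) else 0)"
proof -
  have b: "bump_fun r (\<lambda>z. z $ j * mol r z)" by (rule bump_fun.coord[OF mol_bump_fun])
  have "pderiv_dir i (\<lambda>z. z $ j * mol r z) x = (if i = j then 1 else 0) * mol r x + x $ j * pderiv_dir i (mol r) x" for x
  proof -
    have nth: "((\<lambda>x. x $ j) has_derivative (\<lambda>h. h $ j)) (at x)"
      by (rule bounded_linear.has_derivative[OF bounded_linear_vec_nth]) auto
    have "((\<lambda>z. z $ j * mol r z) has_derivative (\<lambda>h. x $ j * (grad (mol r) x \<bullet> h) + h $ j * mol r x)) (at x)"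
      by (rule has_derivative_mult[OF nth has_derivative_grad[OF bump_fun_differentiable[OF mol_bump_fun]]])
    then have "frechet_derivative (\<lambda>z. z $ j * mol r z) (at x) = (\<lambda>h. x $ j * (grad (mol r) x \<bullet> h) + h $ j * mol r x)"
      by (rule frechet_derivative_at[symmetric])
    then show ?thesis 
      by (simp add: pderiv_dir_def[of _ "\<lambda>z. z $ j * mol r z"] inner_axis grad_def) (simp add: axis_def)
  qed
  then have "(\<lambda>x. (if i = j then 1 else 0) * mol r x + x $ j * pderiv_dir i (mol r) x) = pderiv_dir i (\<lambda>z. z $ j * mol r z)"
    by auto
  then have "(\<integral>x. (if i = j then 1 else 0) * mol r x + x $ j * pderiv_dir i (mol r) x \<partial>(lborel :: (real^'n) measure)) = 0"
    using bump_fun_integral_pderiv[OF b r, of i] by simp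
  moreover have "(\<integral>x. (if i = j then 1 else 0) * mol r x + x $ j * pderiv_dir i (mol r) x \<partial>(lborel :: (real^'n) measure))
     = (\<integral>x. (if i = j then 1 else 0) * mol r x \<partial>(lborel :: (real^'n) measure)) + (\<integral>x. x $ j * pderiv_dir i (mol r) x \<partial>(lborel :: (real^'n) measure))"
    by (intro Bochner_Integration.integral_add mol_integrable r continuous_intros)
  ultimately show ?thesis by (auto split: if_splits)
qed

text \<open>The mollifier decreases radially, so |z| times the modulus of a partial derivative is
  dominated by minus its radial derivative z \<bullet> \<nabla>, whose integral is the dimension
  times the mass. The resulting constant is independent of r.\<close>

lemma mol_abs_moment:
  assumes r: "0 < r"
  shows "(\<integral>z. norm z * \<bar>pderiv_dir i (mol r) z\<bar> \<partial>(lborel :: (real^'n) measure)) \<le> real CARD('n) * (\<integral>z. mol r z \<partial>(lborel :: (real^'n::finite) measure))"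
proof -
  have "(\<integral>z. norm z * \<bar>pderiv_dir i (mol r) z\<bar> \<partial>lborel) \<le> (\<integral>z. (\<Sum>j\<in>UNIV. - (z $ j * pderiv_dir j (mol r) z)) \<partial>(lborel :: (real^'n) measure))"
  proof (rule Bochner_Integration.integral_mono)
    show "integrable lborel (\<lambda>z. norm z * \<bar>pderiv_dir i (mol r) z\<bar>)"
      by (rule Bochner_Integration.integrable_bound[OF mol_integrable(2)[OF r, of "\<lambda>z. norm z" i]])
         (auto intro!: continuous_intros borel_measurable_continuous_onI bump_fun_continuous[OF bump_fun_pderiv[OF mol_bump_fun]] simp: abs_mult)
    show "integrable (lborel :: (real^'n) measure) (\<lambda>z. \<Sum>j\<in>UNIV. - (z $ j * pderiv_dir j (mol r) z))"
      by (intro Bochner_Integration.integrable_sum integrable_minus mol_integrable r continuous_intros)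
    fix z :: "real^'n"
    have "norm z * \<bar>pderiv_dir i (mol r) z\<bar> = 2 * beta 2 (r\<^sup>2 - z \<bullet> z) * (norm z * \<bar>z $ i\<bar>)"
      by (simp add: mol_pderiv abs_mult)
    also have "\<dots> \<le> 2 * beta 2 (r\<^sup>2 - z \<bullet> z) * (norm z * norm z)"
      by (intro mult_left_mono component_le_norm_cart) auto
    also have "norm z * norm z = (\<Sum>j\<in>UNIV. z $ j * z $ j)"
      using dot_square_norm[of z] by (simp add: inner_vec_def power2_eq_square)
    also have "2 * beta 2 (r\<^sup>2 - z \<bullet> z) * (\<Sum>j\<in>UNIV. z $ j * z $ j) = (\<Sum>j\<in>UNIV. - (z $ j * pderiv_dir j (mol r) z))"
      unfolding sum_distrib_left by (intro sum.cong refl) (simp add: mol_pderiv)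
    finally show "norm z * \<bar>pderiv_dir i (mol r) z\<bar> \<le> (\<Sum>j\<in>UNIV. - (z $ j * pderiv_dir j (mol r) z))" .
  qed
  also have "\<dots> = (\<Sum>j\<in>(UNIV::'n set). - (\<integral>z. z $ j * pderiv_dir j (mol r) z \<partial>(lborel :: (real^'n) measure)))"
    by (subst Bochner_Integration.integral_sum) (auto intro!: integrable_minus mol_integrable r continuous_intros)
  also have "\<dots> = real CARD('n) * (\<integral>z. mol r z \<partial>(lborel :: (real^'n) measure))"
    by (simp add: mol_moment[OF r])
  finally show ?thesis .
qed

text \<open>Subtract an affine approximation of \<phi>: constants integrate to zero against the
  derivative, the linear part reproduces w by the first moments, and the rest is bounded by the
  absolute moment. The choice w = 0 yields a uniform gradient bound, the choice of w as the gradient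
  of \<phi> yields convergence.\<close>

lemma mollify_pderiv_bound:
  fixes \<phi> :: "real^'n::finite \<Rightarrow> real"
  assumes r: "0 < r" and \<phi>: "continuous_on UNIV \<phi>" and w: "\<And>z. norm z \<le> r \<Longrightarrow> \<bar>\<phi> (x - z) - \<phi> x + w \<bullet> z\<bar> \<le> m * norm z"
    and m: "0 \<le> m"
  shows "\<bar>(\<integral>z. \<phi> (x - z) * pderiv_dir i (mol r) z \<partial>lborel) - w $ i * (\<integral>z. mol r z \<partial>(lborel :: (real^'n) measure))\<bar>
     \<le> m * (real CARD('n) * (\<integral>z. mol r z \<partial>(lborel :: (real^'n) measure)))"
proof -
  let ?p = "pderiv_dir i (mol r)"
  have phi': "continuous_on UNIV (\<lambda>z. \<phi> (x - z))"
    by (intro continuous_on_compose2[OF \<phi>] continuous_intros) auto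
  have 1: "(\<integral>z. (w \<bullet> z) * ?p z \<partial>lborel) = - (w $ i * (\<integral>z. mol r z \<partial>(lborel :: (real^'n) measure)))"
  proof -
    have "(\<lambda>z. (w \<bullet> z) * ?p z) = (\<lambda>z. \<Sum>j\<in>UNIV. w $ j * (z $ j * ?p z))"
      by (auto simp: inner_vec_def sum_distrib_left mult_ac)
    then have "(\<integral>z. (w \<bullet> z) * ?p z \<partial>lborel) = (\<Sum>j\<in>UNIV. \<integral>z. w $ j * (z $ j * ?p z) \<partial>lborel)"
      by (simp only:) (intro Bochner_Integration.integral_sum integrable_mult_right mol_integrable r continuous_intros)
    also have "\<dots> = (\<Sum>j\<in>UNIV. - (if i = j then w $ j * (\<integral>z. mol r z \<partial>(lborel :: (real^'n) measure)) else 0))"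
      by (intro sum.cong refl) (simp add: mol_moment[OF r])
    also have "\<dots> = - (w $ i * (\<integral>z. mol r z \<partial>(lborel :: (real^'n) measure)))" by (simp add: sum_negf)
    finally show ?thesis .
  qed
  have 2: "(\<integral>z. \<phi> x * ?p z \<partial>lborel) = 0" by (simp add: mol_integral_pderiv[OF r])
  have int: "integrable lborel (\<lambda>z. \<phi> (x - z) * ?p z)" "integrable lborel (\<lambda>z. \<phi> x * ?p z)" "integrable lborel (\<lambda>z. (w \<bullet> z) * ?p z)"
    by (intro mol_integrable r phi' continuous_intros)+
  have "(\<integral>z. (\<phi> (x - z) - \<phi> x + w \<bullet> z) * ?p z \<partial>lborel)
     = (\<integral>z. (\<phi> (x - z) * ?p z - \<phi> x * ?p z) + (w \<bullet> z) * ?p z \<partial>lborel)" by (simp add: algebra_simps)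
  also have "\<dots> = (\<integral>z. \<phi> (x - z) * ?p z \<partial>lborel) - (\<integral>z. \<phi> x * ?p z \<partial>lborel) + (\<integral>z. (w \<bullet> z) * ?p z \<partial>lborel)"
    using int by (simp add: Bochner_Integration.integral_add Bochner_Integration.integral_diff)
  finally have eq: "(\<integral>z. \<phi> (x - z) * ?p z \<partial>lborel) - w $ i * (\<integral>z. mol r z \<partial>(lborel :: (real^'n) measure)) = (\<integral>z. (\<phi> (x - z) - \<phi> x + w \<bullet> z) * ?p z \<partial>lborel)"
    using 1 2 by simp
  have "\<bar>\<integral>z. (\<phi> (x - z) - \<phi> x + w \<bullet> z) * ?p z \<partial>lborel\<bar> \<le> (\<integral>z. m * (norm z * \<bar>?p z\<bar>) \<partial>lborel)"
  proof (rule integral_abs_bound_integral)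
    show "integrable lborel (\<lambda>z. (\<phi> (x - z) - \<phi> x + w \<bullet> z) * ?p z)"
      by (intro mol_integrable r phi' continuous_intros)
    show "integrable lborel (\<lambda>z. m * (norm z * \<bar>?p z\<bar>))"
      by (intro integrable_mult_right, rule Bochner_Integration.integrable_bound[OF mol_integrable(2)[OF r, of "\<lambda>z. norm z" i]])
         (auto intro!: continuous_intros borel_measurable_continuous_onI bump_fun_continuous[OF bump_fun_pderiv[OF mol_bump_fun]] simp: abs_mult)
    fix z :: "real^'n"
    show "\<bar>(\<phi> (x - z) - \<phi> x + w \<bullet> z) * ?p z\<bar> \<le> m * (norm z * \<bar>?p z\<bar>)"
    proof (cases "norm z \<le> r")
      case True
      then show ?thesis using mult_right_mono[OF w[OF True], of "\<bar>?p z\<bar>"] by (simp add: abs_mult mult_ac)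
    next
      case False
      then have "?p z = 0" by (intro bump_fun_support[OF bump_fun_pderiv[OF mol_bump_fun] r]) auto
      then show ?thesis by simp
    qed
  qed
  also have "\<dots> = m * (\<integral>z. norm z * \<bar>?p z\<bar> \<partial>lborel)" by simp
  also have "\<dots> \<le> m * (real CARD('n) * (\<integral>z. mol r z \<partial>(lborel :: (real^'n) measure)))" by (intro mult_left_mono mol_abs_moment r m)
  finally show ?thesis unfolding eq .
qed


lemma grad_eq_0_outside:
  fixes f :: "real^'n::finite \<Rightarrow> real"
  assumes "closed K" "\<And>y. y \<notin> K \<Longrightarrow> f y = 0" "x \<notin> K"
  shows "(f has_derivative (\<lambda>h. 0)) (at x)" "grad f x = 0"
proof -
  show *: "(f has_derivative (\<lambda>h. 0)) (at x)"
    by (rule has_derivative_transform_within_open[OF has_derivative_const, of "- K"]) (use assms in auto)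
  show "grad f x = 0" by (rule grad_eqI) (use * in simp)
qed

text \<open>The form is tailored to dominated convergence: a common bound B, a common compact set
  K', and convergence of gradients at every single point of differentiability.\<close>

lemma mollification:
  fixes \<phi> :: "real^'n::finite \<Rightarrow> real"
  assumes lip: "M-lipschitz_on UNIV \<phi>" and nonneg: "\<And>x. 0 \<le> \<phi> x"
    and K: "compact K" "K \<subseteq> \<Omega>" "\<And>x. x \<notin> K \<Longrightarrow> \<phi> x = 0" and \<Omega>: "open \<Omega>"
  shows "\<exists>\<psi> K' B. compact K' \<and> K' \<subseteq> \<Omega> \<and>
     (\<forall>k::nat. \<psi> k \<in> Cc_inf \<Omega> \<and> (\<forall>x. 0 \<le> \<psi> k x) \<and> (\<forall>x. norm (grad (\<psi> k) x) \<le> B) \<and> (\<forall>x. x \<notin> K' \<longrightarrow> grad (\<psi> k) x = 0)) \<and>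
     (\<forall>x. \<phi> differentiable (at x) \<longrightarrow> (\<lambda>k. grad (\<psi> k) x) \<longlonglongrightarrow> grad \<phi> x)"
proof -
  have \<phi>: "continuous_on UNIV \<phi>" using lip by (rule lipschitz_on_continuous_on)
  have M: "0 \<le> M" using lip by (rule lipschitz_on_nonneg)
  obtain e where e: "0 < e" "(\<Union>x\<in>K. cball x e) \<subseteq> \<Omega>"
    using compact_subset_open_imp_cball_epsilon_subset[OF K(1) \<Omega> K(2)] by blast
  \<comment> \<open>The closed e-neighbourhood of K contains the supports of all mollifications,
    since every radius \<open>rr k\<close> is at most e.\<close>
  define K' where "K' = {x + y |x y. x \<in> K \<and> y \<in> cball 0 e}"
  have K': "compact K'" unfolding K'_def by (intro compact_sums K compact_cball)
  have K'\<Omega>: "K' \<subseteq> \<Omega>" using e(2) by (fastforce simp: K'_def dist_norm)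
  obtain a where a: "K \<subseteq> cbox (-a) a"
    using bounded_subset_cbox_symmetric[OF compact_imp_bounded[OF K(1)]] by blast
  define rr where "rr k = e / (real k + 1)" for k :: nat
  have rr: "0 < rr k" "rr k \<le> e" for k using e by (auto simp: rr_def divide_simps)
  have rr_lim: "rr \<longlonglongrightarrow> 0" unfolding rr_def by real_asymp
  define J where "J k = (\<integral>z. mol (rr k) z \<partial>(lborel :: (real^'n) measure))" for k
  have J: "0 < J k" for k unfolding J_def by (rule mol_integral_pos[OF rr(1)])
  define \<psi> where "\<psi> k = box_conv (-a) a (\<lambda>y. \<phi> y / J k) (mol (rr k))" for k
  have \<phi>J: "continuous_on UNIV (\<lambda>y. \<phi> y / J k)" for k using J[of k] by (intro continuous_intros \<phi>) auto
  have conv: "box_conv (-a) a (\<lambda>y. \<phi> y / J k) f x = (\<integral>z. \<phi> (x - z) / J k * f z \<partial>lborel)" if "bump_fun (rr k) f" for k f x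
    by (rule box_conv_eq_lborel[OF \<phi>J bump_fun_continuous[OF that]]) (use a K in auto)
  have grad\<psi>: "grad (\<psi> k) x $ i = (\<integral>z. \<phi> (x - z) * pderiv_dir i (mol (rr k)) z \<partial>lborel) / J k" for k x i
  proof -
    have "grad (\<psi> k) x = (\<chi> i. box_conv (-a) a (\<lambda>y. \<phi> y / J k) (pderiv_dir i (mol (rr k))) x)"
      unfolding \<psi>_def by (rule grad_eqI[OF box_conv_has_derivative[OF \<phi>J mol_bump_fun]])
    then show ?thesis by (simp add: conv[OF bump_fun_pderiv[OF mol_bump_fun]])
  qed
  have est: "\<bar>grad (\<psi> k) x $ i - w $ i\<bar> \<le> m * real CARD('n)"
    if "\<And>z. norm z \<le> rr k \<Longrightarrow> \<bar>\<phi> (x - z) - \<phi> x + w \<bullet> z\<bar> \<le> m * norm z" "0 \<le> m" for k x i w m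
  proof -
    have "\<bar>(\<integral>z. \<phi> (x - z) * pderiv_dir i (mol (rr k)) z \<partial>lborel) - w $ i * J k\<bar> \<le> m * (real CARD('n) * J k)"
      unfolding J_def by (rule mollify_pderiv_bound[OF rr(1) \<phi> that])
    moreover have "(\<integral>z. \<phi> (x - z) * pderiv_dir i (mol (rr k)) z \<partial>lborel) = grad (\<psi> k) x $ i * J k"
      using J[of k] by (simp add: grad\<psi>)
    ultimately have "\<bar>grad (\<psi> k) x $ i - w $ i\<bar> * J k \<le> (m * real CARD('n)) * J k"
      using J[of k] by (simp add: abs_mult mult.assoc flip: left_diff_distrib)
    then show ?thesis using J[of k] by simp
  qed
  have \<psi>_nonneg: "0 \<le> \<psi> k x" for k x
    unfolding \<psi>_def conv[OF mol_bump_fun]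
    by (rule integral_nonneg_AE) (use J[of k] nonneg mol_nonneg in \<open>auto intro!: mult_nonneg_nonneg divide_nonneg_pos\<close>)
  have \<psi>_supp: "\<psi> k x = 0" if x: "x \<notin> K'" for k x
  proof -
    have "\<phi> (x - z) / J k * mol (rr k) z = 0" for z
    proof (cases "x - z \<in> K")
      case True
      have "e < norm z"
      proof (rule ccontr)
        assume "\<not> e < norm z"
        then have "x \<in> K'" unfolding K'_def mem_Collect_eq using True
          by (intro exI[of _ "x - z"] exI[of _ z]) auto
        with x show False by simp
      qed
      then have "mol (rr k) z = 0" using rr[of k] by (intro bump_fun_support[OF mol_bump_fun rr(1)]) auto
      then show ?thesis by simp
    qed (use K in auto)
    then show ?thesis unfolding \<psi>_def conv[OF mol_bump_fun] by (simp only: Bochner_Integration.integral_zero)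
  qed
  have "\<psi> k \<in> Cc_inf \<Omega>" for k
  proof -
    have "tsupp (\<psi> k) \<subseteq> K'"
      unfolding tsupp_def using \<psi>_supp K' by (intro closure_minimal) (auto intro: compact_imp_closed)
    moreover have "compact (tsupp (\<psi> k))"
      using calculation K' unfolding tsupp_def by (meson closed_closure closed_Int_compact inf.absorb_iff2 compact_closure compact_imp_bounded bounded_subset closure_subset)
    moreover have "Ck_on UNIV j (\<psi> k)" for j unfolding \<psi>_def by (rule box_conv_smooth[OF \<phi>J mol_bump_fun])
    ultimately show ?thesis using K'\<Omega> by (auto simp: Cc_inf_def)
  qed
  moreover have "norm (grad (\<psi> k) x) \<le> real CARD('n) * (M * real CARD('n))" for k x
  proof -
    have "\<bar>grad (\<psi> k) x $ i\<bar> \<le> M * real CARD('n)" for i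
    proof -
      have "\<bar>\<phi> (x - z) - \<phi> x + 0 \<bullet> z\<bar> \<le> M * norm z" for z
        using lipschitz_onD[OF lip, of "x - z" x] by (simp add: dist_norm)
      from est[OF this M, of k i] show ?thesis by simp
    qed
    then have "(\<Sum>i\<in>UNIV. \<bar>grad (\<psi> k) x $ i\<bar>) \<le> (\<Sum>i\<in>(UNIV::'n set). M * real CARD('n))" by (intro sum_mono)
    then show ?thesis using norm_le_l1_cart[of "grad (\<psi> k) x"] by simp
  qed
  moreover have "grad (\<psi> k) x = 0" if "x \<notin> K'" for k x
    by (rule grad_eq_0_outside(2)[OF compact_imp_closed[OF K'] \<psi>_supp that])
  moreover have "(\<lambda>k. grad (\<psi> k) x) \<longlonglongrightarrow> grad \<phi> x" if diff: "\<phi> differentiable (at x)" for x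
  proof (rule vec_tendstoI)
    fix i
    show "(\<lambda>k. grad (\<psi> k) x $ i) \<longlonglongrightarrow> grad \<phi> x $ i"
    proof (rule LIMSEQ_I)
      fix \<epsilon> :: real assume \<epsilon>: "0 < \<epsilon>"
      define m where "m = \<epsilon> / 2 / real CARD('n)"
      have m: "0 < m" "m * real CARD('n) < \<epsilon>" using \<epsilon> by (auto simp: m_def)
      obtain \<delta> where \<delta>: "0 < \<delta>" "\<And>y. norm (y - x) < \<delta> \<Longrightarrow> norm (\<phi> y - \<phi> x - grad \<phi> x \<bullet> (y - x)) \<le> m * norm (y - x)"
        using has_derivative_grad[OF diff] m(1) unfolding has_derivative_at_alt by blast
      obtain N where N: "\<And>k. N \<le> k \<Longrightarrow> rr k < \<delta>"
        using order_tendstoD(2)[OF rr_lim \<delta>(1)] unfolding eventually_sequentially by blast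
      have "norm (grad (\<psi> k) x $ i - grad \<phi> x $ i) < \<epsilon>" if "N \<le> k" for k
      proof -
        have "\<bar>\<phi> (x - z) - \<phi> x + grad \<phi> x \<bullet> z\<bar> \<le> m * norm z" if "norm z \<le> rr k" for z
          using \<delta>(2)[of "x - z"] that N[OF \<open>N \<le> k\<close>] by simp
        then have "\<bar>grad (\<psi> k) x $ i - grad \<phi> x $ i\<bar> \<le> m * real CARD('n)" using m(1) by (intro est) auto
        with m(2) show ?thesis by simp
      qed
      then show "\<exists>no. \<forall>n\<ge>no. norm (grad (\<psi> n) x $ i - grad \<phi> x $ i) < \<epsilon>" by blast
    qed
  qed
  ultimately show ?thesis using \<psi>_nonneg K' K'\<Omega>
    by (intro exI[of _ \<psi>] exI[of _ K'] exI[of _ "real CARD('n) * (M * real CARD('n))"]) blast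
qed

section \<open>Superharmonicity tested with Lipschitz functions\<close>

lemma lebesgue_measurable_AE_limit:
  fixes s :: "nat \<Rightarrow> 'a::euclidean_space \<Rightarrow> 'b::euclidean_space"
  assumes s: "\<And>k. s k \<in> borel_measurable lebesgue" and lim: "AE x in lebesgue. (\<lambda>k. s k x) \<longlonglongrightarrow> f x"
  shows "f \<in> borel_measurable lebesgue"
proof (rule borel_measurable_AE)
  show "(\<lambda>x. lim (\<lambda>k. s k x)) \<in> borel_measurable lebesgue"
    by (rule borel_measurable_lim_metric[OF s])
  show "AE x in lebesgue. lim (\<lambda>k. s k x) = f x"
    using lim by eventually_elim (rule limI)
qed

lemma continuous_imp_lebesgue_measurable:
  fixes f :: "'a::euclidean_space \<Rightarrow> 'b::euclidean_space"
  shows "continuous_on UNIV f \<Longrightarrow> f \<in> borel_measurable lebesgue"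
  by (intro measurable_completion) (simp add: borel_measurable_continuous_onI)

lemma Cc_inf_differentiable:
  assumes "u \<in> Cc_inf \<Omega>" shows "u differentiable (at x)"
proof -
  have "Ck_on UNIV (Suc 0) u" using assms unfolding Cc_inf_def by blast
  then show ?thesis by simp
qed

lemma Cc_inf_grad_continuous:
  assumes "u \<in> Cc_inf \<Omega>" shows "continuous_on UNIV (grad u)"
proof -
  have "Ck_on UNIV (Suc 0) u" using assms unfolding Cc_inf_def by blast
  then have "continuous_on UNIV (\<lambda>x. \<chi> i. pderiv_dir i u x)" by (intro continuous_on_vec_lambda) auto
  then show ?thesis by (simp add: grad_def[abs_def])
qed

lemma difference_quotient_tendsto:
  fixes f :: "'a::real_normed_vector \<Rightarrow> real"
  assumes f: "(f has_derivative f') (at x)" and t: "t \<longlonglongrightarrow> 0" "\<And>k::nat. t k \<noteq> 0"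
  shows "(\<lambda>k. (f (x + t k *\<^sub>R h) - f x) / t k) \<longlonglongrightarrow> f' h"
proof -
  have "(f has_derivative f') (at (x + 0 *\<^sub>R h))" using f by simp
  moreover have "((\<lambda>s. x + s *\<^sub>R h) has_derivative (\<lambda>s. s *\<^sub>R h)) (at 0)" by (auto intro!: derivative_eq_intros)
  ultimately have "((\<lambda>s. f (x + s *\<^sub>R h)) has_derivative (\<lambda>s. f' (s *\<^sub>R h))) (at 0)"
    by (rule has_derivative_compose[rotated])
  moreover have "(\<lambda>s. f' (s *\<^sub>R h)) = (*) (f' h)"
    using has_derivative_linear[OF f] by (auto simp: linear_cmul mult.commute)
  ultimately have "((\<lambda>s. f (x + s *\<^sub>R h)) has_real_derivative f' h) (at 0)"
    unfolding has_field_derivative_def by simp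
  then have "((\<lambda>s. (f (x + s *\<^sub>R h) - f x) / s) \<longlongrightarrow> f' h) (at 0)" by (simp add: DERIV_def)
  moreover have "filterlim t (at 0) sequentially" using t by (simp add: filterlim_at)
  ultimately show ?thesis by (rule filterlim_compose)
qed

text \<open>Where f is differentiable its gradient is the limit of difference quotients, which are
  continuous functions of the point; completeness of the measure takes care of the exceptional null
  set.\<close>

lemma grad_measurable:
  fixes f :: "real^'n::finite \<Rightarrow> real"
  assumes f: "continuous_on UNIV f" and A: "A \<in> sets lebesgue" and diff: "AE x in lebesgue. x \<in> A \<longrightarrow> f differentiable (at x)"
  shows "(\<lambda>x. indicator A x *\<^sub>R grad f x) \<in> borel_measurable lebesgue"
proof (rule lebesgue_measurable_AE_limit)
  define t where "t k = 1 / real (Suc k)" for k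
  have t: "t \<longlonglongrightarrow> 0" "\<And>k. t k \<noteq> 0" unfolding t_def by real_asymp simp
  define s where "s k x = (\<chi> i. (f (x + t k *\<^sub>R axis i 1) - f x) / t k)" for k x
  have "continuous_on UNIV (s k)" for k
    unfolding s_def using t(2)[of k] by (intro continuous_intros continuous_on_compose2[OF f]) auto
  then show "(\<lambda>x. indicator A x *\<^sub>R s k x) \<in> borel_measurable lebesgue" for k
    using A by (intro borel_measurable_scaleR borel_measurable_indicator continuous_imp_lebesgue_measurable)
  show "AE x in lebesgue. (\<lambda>k. indicator A x *\<^sub>R s k x) \<longlonglongrightarrow> indicator A x *\<^sub>R grad f x"
    using diff
  proof eventually_elim
    case (elim x)
    show ?case
    proof (cases "x \<in> A")
      case True
      then have "f differentiable (at x)" using elim by simp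
      then have D: "(f has_derivative (\<lambda>h. grad f x \<bullet> h)) (at x)" by (rule has_derivative_grad)
      have "(\<lambda>k. s k x) \<longlonglongrightarrow> grad f x"
      proof (rule vec_tendstoI)
        fix i
        show "(\<lambda>k. s k x $ i) \<longlonglongrightarrow> grad f x $ i"
          using difference_quotient_tendsto[OF D t, of "axis i 1"] by (simp add: s_def inner_axis)
      qed
      then show ?thesis using True by simp
    qed simp
  qed
qed

lemma (in finsler) grad_F_measurable: "grad F \<in> borel_measurable borel"
proof -
  have "(\<lambda>x. if x \<in> UNIV - {0} then grad F x else grad F 0) \<in> borel_measurable borel"
    by (rule borel_measurable_continuous_on_if) (auto intro: grad_F_continuous)
  moreover have "(\<lambda>x. if x \<in> UNIV - {0} then grad F x else grad F 0) = grad F" by auto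
  ultimately show ?thesis by simp
qed

context finsler_domain
begin

lemma \<Omega>_lebesgue: "\<Omega> \<in> sets lebesgue" using open_\<Omega> by simp

text \<open>Cut off to \<Omega>, the set on which almost everywhere differentiability of d is
  established, so as to be measurable on the whole space.\<close>

definition gd :: "real^'n \<Rightarrow> real^'n" where "gd x = indicator \<Omega> x *\<^sub>R grad d x"

lemma gd_measurable: "gd \<in> borel_measurable lebesgue"
  unfolding gd_def[abs_def] by (rule grad_measurable[OF d_continuous \<Omega>_lebesgue d_AE_differentiable])

lemma AE_F_gd: "AE x in lebesgue. x \<in> \<Omega> \<longrightarrow> F (gd x) = 1 \<and> (d has_derivative (\<lambda>h. gd x \<bullet> h)) (at x)"
  using d_AE_differentiable
proof eventually_elim
  case (elim x)
  then show ?case using F_grad_d[of x] has_derivative_grad[of d x] by (auto simp: gd_def)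
qed

text \<open>Almost everywhere in \<Omega> this field is norming for the gradient of d: their product
  is 1, and as a functional it is bounded by \<open>F\<close>. Since \<open>F\<close> of the
  gradient is 1, it is also the flux in the superharmonicity condition.\<close>

definition Td :: "real^'n \<Rightarrow> real^'n" where "Td x = indicator \<Omega> x *\<^sub>R grad F (gd x)"

lemma Td_measurable: "Td \<in> borel_measurable lebesgue"
  unfolding Td_def[abs_def] using \<Omega>_lebesgue
  by (intro borel_measurable_scaleR borel_measurable_indicator measurable_compose[OF gd_measurable grad_F_measurable])

lemma AE_Td: "AE x in lebesgue. x \<in> \<Omega> \<longrightarrow> Td x \<bullet> gd x = 1 \<and> (\<forall>w. \<bar>Td x \<bullet> w\<bar> \<le> F w)"
  using AE_F_gd
proof eventually_elim
  case (elim x)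
  show ?case
  proof
    assume x: "x \<in> \<Omega>"
    then have "gd x \<noteq> 0" using elim by auto
    then show "Td x \<bullet> gd x = 1 \<and> (\<forall>w. \<bar>Td x \<bullet> w\<bar> \<le> F w)"
      using x elim grad_F_euler abs_grad_F_inner_le by (auto simp: Td_def)
  qed
qed

lemma superharmonic_integrand:
  "AE x in lebesgue. indicator \<Omega> x *\<^sub>R (F (grad d x) * (grad F (grad d x) \<bullet> w x)) = Td x \<bullet> w x"
  using AE_F_gd
proof eventually_elim
  case (elim x)
  then show ?case by (cases "x \<in> \<Omega>") (auto simp: Td_def gd_def)
qed

text \<open>Passage to the limit along mollified test functions; the bound of |Td \<bullet> w| by
  \<open>F w\<close> and the common support K' provide the dominating function.\<close>

lemma superharmonic_lipschitz:
  assumes sup: "superharmonic_dF F \<Omega>"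
    and lip: "M-lipschitz_on UNIV \<phi>" and nonneg: "\<And>x. 0 \<le> \<phi> x"
    and K: "compact K" "K \<subseteq> \<Omega>" "\<And>x. x \<notin> K \<Longrightarrow> \<phi> x = 0"
    and diff: "AE x in lebesgue. x \<in> \<Omega> \<longrightarrow> \<phi> differentiable (at x)"
  shows "integrable lebesgue (\<lambda>x. Td x \<bullet> grad \<phi> x)" "0 \<le> (\<integral>x. Td x \<bullet> grad \<phi> x \<partial>lebesgue)"
proof -
  obtain \<psi> K' B where K': "compact K'" "K' \<subseteq> \<Omega>"
    and \<psi>: "\<And>k::nat. \<psi> k \<in> Cc_inf \<Omega>" "\<And>k x. 0 \<le> \<psi> k x" "\<And>k x. norm (grad (\<psi> k) x) \<le> B" "\<And>k x. x \<notin> K' \<Longrightarrow> grad (\<psi> k) x = 0"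
    and lim: "\<And>x. \<phi> differentiable (at x) \<Longrightarrow> (\<lambda>k. grad (\<psi> k) x) \<longlonglongrightarrow> grad \<phi> x"
    using mollification[OF lip nonneg K open_\<Omega>] by blast
  obtain b where b: "0 < b" "\<And>x. F x \<le> b * norm x" using F_bounds by blast
  have cont: "continuous_on UNIV (grad (\<psi> k))" for k
    by (rule Cc_inf_grad_continuous[OF \<psi>(1)])
  have meas: "(\<lambda>x. Td x \<bullet> grad (\<psi> k) x) \<in> borel_measurable lebesgue" for k
    by (intro borel_measurable_inner Td_measurable continuous_imp_lebesgue_measurable cont)
  have AElim: "AE x in lebesgue. (\<lambda>k. Td x \<bullet> grad (\<psi> k) x) \<longlonglongrightarrow> Td x \<bullet> grad \<phi> x"
    using diff
  proof eventually_elim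
    case (elim x)
    show ?case
    proof (cases "x \<in> \<Omega>")
      case True
      then show ?thesis using elim lim by (intro tendsto_intros) auto
    qed (simp add: Td_def)
  qed
  have bound: "AE x in lebesgue. norm (Td x \<bullet> grad (\<psi> k) x) \<le> (b * B) * indicator K' x" for k
    using AE_Td
  proof eventually_elim
    case (elim x)
    show ?case
    proof (cases "x \<in> K'")
      case True
      then have "\<bar>Td x \<bullet> grad (\<psi> k) x\<bar> \<le> F (grad (\<psi> k) x)" using elim K' by auto
      also have "\<dots> \<le> b * B" using b \<psi>(3)[where x=x] by (meson mult_left_mono order_trans less_imp_le)
      finally show ?thesis using True by simp
    qed (use \<psi>(4) in simp)
  qed
  have int: "integrable lebesgue (\<lambda>x. (b * B) * indicator K' x)"
    using lmeasurable_compact[OF K'(1)] by (intro integrable_mult_right integrable_real_indicator) (auto simp: fmeasurable_def)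
  have fm: "(\<lambda>x. Td x \<bullet> grad \<phi> x) \<in> borel_measurable lebesgue"
    by (rule lebesgue_measurable_AE_limit[OF meas AElim])
  show "integrable lebesgue (\<lambda>x. Td x \<bullet> grad \<phi> x)"
    by (rule integrable_dominated_convergence[OF fm meas int AElim bound])
  have conv: "(\<lambda>k. \<integral>x. Td x \<bullet> grad (\<psi> k) x \<partial>lebesgue) \<longlonglongrightarrow> (\<integral>x. Td x \<bullet> grad \<phi> x \<partial>lebesgue)"
    by (rule integral_dominated_convergence[OF fm meas int AElim bound])
  have "0 \<le> (\<integral>x. Td x \<bullet> grad (\<psi> k) x \<partial>lebesgue)" for k
  proof -
    have "0 \<le> (LINT x:\<Omega>|lebesgue. F (grad d x) * (grad F (grad d x) \<bullet> grad (\<psi> k) x))"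
      using sup \<psi>(1,2) unfolding superharmonic_dF_def by blast
    also have "\<dots> = (\<integral>x. Td x \<bullet> grad (\<psi> k) x \<partial>lebesgue)"
      unfolding set_lebesgue_integral_def
    proof (rule integral_cong_AE)
      show eq: "AE x in lebesgue. indicator \<Omega> x *\<^sub>R (F (grad d x) * (grad F (grad d x) \<bullet> grad (\<psi> k) x)) = Td x \<bullet> grad (\<psi> k) x"
        by (rule superharmonic_integrand)
      show "(\<lambda>x. indicator \<Omega> x *\<^sub>R (F (grad d x) * (grad F (grad d x) \<bullet> grad (\<psi> k) x))) \<in> borel_measurable lebesgue"
        by (rule borel_measurable_AE[OF meas[of k]]) (use eq in eventually_elim, simp)
    qed (rule meas)
    finally show ?thesis .
  qed
  then show "0 \<le> (\<integral>x. Td x \<bullet> grad \<phi> x \<partial>lebesgue)" by (intro LIMSEQ_le_const[OF conv]) auto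
qed

end

section \<open>The Hardy inequality with remainder terms\<close>

lemma lipschitz_mult_compact_support:
  fixes f g :: "'a::metric_space \<Rightarrow> real"
  assumes f: "M-lipschitz_on UNIV f" and g: "L-lipschitz_on UNIV g" and K: "compact K" "\<And>x. x \<notin> K \<Longrightarrow> f x = 0"
  shows "\<exists>C. C-lipschitz_on UNIV (\<lambda>x. f x * g x)"
proof -
  have "compact (f ` K)" "compact (g ` K)"
    using compact_continuous_image[OF continuous_on_subset[OF lipschitz_on_continuous_on[OF f]] K(1)]
      compact_continuous_image[OF continuous_on_subset[OF lipschitz_on_continuous_on[OF g]] K(1)] by auto
  then have "bounded (f ` K)" "bounded (g ` K)" by (auto intro: compact_imp_bounded)
  then obtain A B where A: "0 < A" "\<forall>y\<in>f ` K. norm y \<le> A" and B: "0 < B" "\<forall>y\<in>g ` K. norm y \<le> B"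
    unfolding bounded_pos by blast
  have A': "\<bar>f x\<bar> \<le> A" for x using A K(2) by (cases "x \<in> K") auto
  have B': "\<bar>g x\<bar> \<le> B" if "x \<in> K" for x using B that by auto
  have ML0: "0 \<le> M" "0 \<le> L" using f g by (auto intro: lipschitz_on_nonneg)
  have key: "\<bar>f x * g x - f y * g y\<bar> \<le> (B * M + A * L) * dist x y" if "x \<in> K" for x y
  proof -
    have "f x * g x - f y * g y = g x * (f x - f y) + f y * (g x - g y)" by (simp add: algebra_simps)
    then have "\<bar>f x * g x - f y * g y\<bar> \<le> \<bar>g x\<bar> * \<bar>f x - f y\<bar> + \<bar>f y\<bar> * \<bar>g x - g y\<bar>"
      by (metis abs_mult abs_triangle_ineq)
    also have "\<dots> \<le> B * (M * dist x y) + A * (L * dist x y)"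
      using A' B'[OF that] A B lipschitz_onD[OF f, of x y] lipschitz_onD[OF g, of x y]
      by (intro add_mono mult_mono) (auto simp: dist_real_def)
    finally show ?thesis by (simp add: algebra_simps)
  qed
  have "(B * M + A * L)-lipschitz_on UNIV (\<lambda>x. f x * g x)"
  proof (rule lipschitz_onI)
    fix x y :: 'a
    consider "x \<in> K" | "y \<in> K" | "x \<notin> K" "y \<notin> K" by blast
    then show "dist (f x * g x) (f y * g y) \<le> (B * M + A * L) * dist x y"
    proof cases
      case 2
      then show ?thesis using key[OF 2, of x] by (simp add: dist_real_def dist_commute abs_minus_commute)
    next
      case 3
      then show ?thesis using K(2) A B ML0 by simp
    qed (use key in \<open>auto simp: dist_real_def\<close>)
  qed (use A B ML0 in auto)
  then show ?thesis by blast
qed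

lemma integrable_bounded_support:
  fixes f :: "real^'n::finite \<Rightarrow> real"
  assumes f: "f \<in> borel_measurable lebesgue" and b: "AE x in lebesgue. \<bar>f x\<bar> \<le> B" and K: "compact K" "\<And>x. x \<notin> K \<Longrightarrow> f x = 0"
  shows "integrable lebesgue f"
proof (rule Bochner_Integration.integrable_bound[OF _ f])
  show "integrable lebesgue (\<lambda>x. B * indicator K x)"
    using lmeasurable_compact[OF K(1)] by (intro integrable_mult_right integrable_real_indicator) (auto simp: fmeasurable_def)
  show "AE x in lebesgue. norm (f x) \<le> norm (B * indicator K x)"
    using b
  proof eventually_elim
    case (elim x)
    then show ?case using K(2) by (cases "x \<in> K") auto
  qed
qed

lemma integrable_continuous_support:
  fixes f :: "real^'n::finite \<Rightarrow> real"
  assumes f: "continuous_on UNIV f" and K: "compact K" "\<And>x. x \<notin> K \<Longrightarrow> f x = 0"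
  shows "integrable lebesgue f"
  using integrable_compact_support[OF f K] by (simp add: integrable_completion)

lemma Cc_inf_support:
  assumes "u \<in> Cc_inf \<Omega>"
  shows "compact (tsupp u)" "tsupp u \<subseteq> \<Omega>" "x \<notin> tsupp u \<Longrightarrow> u x = 0" "x \<notin> tsupp u \<Longrightarrow> grad u x = 0"
proof -
  show 1: "compact (tsupp u)" "tsupp u \<subseteq> \<Omega>" using assms by (auto simp: Cc_inf_def)
  have 2: "\<And>x. x \<notin> tsupp u \<Longrightarrow> u x = 0" unfolding tsupp_def using closure_subset[of "{x. u x \<noteq> 0}"] by auto
  then show "x \<notin> tsupp u \<Longrightarrow> u x = 0" .
  show "x \<notin> tsupp u \<Longrightarrow> grad u x = 0"
    using grad_eq_0_outside(2)[OF compact_imp_closed[OF 1(1)] 2] .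
qed

lemma Cc_inf_continuous: "u \<in> Cc_inf \<Omega> \<Longrightarrow> continuous_on S u"
  by (meson Cc_inf_differentiable continuous_at_imp_continuous_on differentiable_imp_continuous_within)

lemma Cc_inf_bounded:
  assumes u: "u \<in> Cc_inf \<Omega>"
  shows "\<exists>B>0. (\<forall>x. \<bar>u x\<bar> \<le> B) \<and> (\<forall>x. norm (grad u x) \<le> B)"
proof -
  have "bounded (u ` tsupp u)" "bounded (grad u ` tsupp u)"
    using compact_continuous_image[OF Cc_inf_continuous[OF u] Cc_inf_support(1)[OF u]]
      compact_continuous_image[OF continuous_on_subset[OF Cc_inf_grad_continuous[OF u]] Cc_inf_support(1)[OF u]]
    by (auto intro: compact_imp_bounded)
  then obtain A B where A: "0 < A" "\<forall>y\<in>u ` tsupp u. norm y \<le> A" and B: "0 < B" "\<forall>y\<in>grad u ` tsupp u. norm y \<le> B"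
    unfolding bounded_pos by blast
  have "\<bar>u x\<bar> \<le> max A B" "norm (grad u x) \<le> max A B" for x
    using A B Cc_inf_support(3,4)[OF u, of x] by (cases "x \<in> tsupp u"; force)+
  then show ?thesis using A(1) by (intro exI[of _ "max A B"]) auto
qed

lemma Cc_inf_lipschitz:
  assumes u: "u \<in> Cc_inf \<Omega>" shows "\<exists>M. M-lipschitz_on UNIV u"
proof -
  obtain B where B: "0 < B" "\<And>x. norm (grad u x) \<le> B" using Cc_inf_bounded[OF u] by blast
  have "B-lipschitz_on UNIV u"
  proof (rule bounded_derivative_imp_lipschitz)
    show "(u has_derivative (\<lambda>h. grad u x \<bullet> h)) (at x within UNIV)" for x
      using has_derivative_grad[OF Cc_inf_differentiable[OF u]] by simp
    show "onorm (\<lambda>h. grad u x \<bullet> h) \<le> B" for x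
      by (rule onorm_le) (use B(2)[of x] in \<open>smt (verit) Cauchy_Schwarz_ineq2 mult_right_mono norm_ge_zero real_norm_def\<close>)
  qed (use B in auto)
  then show ?thesis by blast
qed

lemma abs_powr_has_derivative:
  fixes t p :: real
  assumes p: "2 \<le> p"
  shows "((\<lambda>t. \<bar>t\<bar> powr p) has_real_derivative (p * \<bar>t\<bar> powr (p - 1) * sgn t)) (at t)"
proof -
  consider "0 < t" | "t < 0" | "t = 0" by linarith
  then show ?thesis
  proof cases
    case 1
    show ?thesis
      by (rule has_field_derivative_transform_within_open[where S="{0<..}" and f="\<lambda>t. t powr p"])
         (use 1 in \<open>auto intro!: derivative_eq_intros\<close>)
  next
    case 2
    show ?thesis
      by (rule has_field_derivative_transform_within_open[where S="{..<0}" and f="\<lambda>t. (-t) powr p"])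
         (use 2 in \<open>auto intro!: derivative_eq_intros\<close>)
  next
    case 3
    have "((\<lambda>h::real. \<bar>h\<bar> powr p / h) \<longlongrightarrow> 0) (at 0)"
    proof (rule Lim_null_comparison)
      have "\<forall>\<^sub>F h in at (0::real). \<bar>h\<bar> < 1 \<and> h \<noteq> 0"
        unfolding eventually_at by (rule exI[of _ 1]) auto
      then show "\<forall>\<^sub>F h in at 0. norm (\<bar>h\<bar> powr p / h) \<le> \<bar>h\<bar>"
      proof eventually_elim
        case (elim h)
        have "\<bar>h\<bar> powr p \<le> \<bar>h\<bar> powr 2" using elim p by (intro powr_mono') auto
        then have "\<bar>h\<bar> powr p \<le> \<bar>h\<bar> * \<bar>h\<bar>" using elim by (simp add: power2_eq_square)
        then show ?case using elim by (simp add: divide_simps)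
      qed
      show "((\<lambda>h::real. \<bar>h\<bar>) \<longlongrightarrow> 0) (at 0)" by (simp add: tendsto_rabs_zero)
    qed
    then show ?thesis using 3 by (simp add: DERIV_def)
  qed
qed

lemma abs_powr_lipschitz:
  assumes u: "u \<in> Cc_inf \<Omega>" and p: "2 \<le> p"
  shows "\<exists>M. M-lipschitz_on UNIV (\<lambda>x. \<bar>u x\<bar> powr p)"
proof -
  obtain B where B: "0 < B" "\<And>x. \<bar>u x\<bar> \<le> B" using Cc_inf_bounded[OF u] by blast
  obtain M where M: "M-lipschitz_on UNIV u" using Cc_inf_lipschitz[OF u] by blast
  have "(p * B powr (p - 1))-lipschitz_on {-B..B} (\<lambda>t. \<bar>t\<bar> powr p)"
  proof (rule bounded_derivative_imp_lipschitz)
    show "((\<lambda>t. \<bar>t\<bar> powr p) has_derivative (*) (p * \<bar>t\<bar> powr (p - 1) * sgn t)) (at t within {-B..B})" for t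
      using abs_powr_has_derivative[OF p] unfolding has_field_derivative_def by (rule has_derivative_at_withinI)
    fix t assume t: "t \<in> {-B..B}"
    have "\<bar>p * \<bar>t\<bar> powr (p - 1) * sgn t\<bar> \<le> p * B powr (p - 1)"
      using t p by (cases "t = 0") (auto simp: abs_mult abs_sgn_eq intro!: mult_left_mono powr_mono2)
    then show "onorm ((*) (p * \<bar>t\<bar> powr (p - 1) * sgn t)) \<le> p * B powr (p - 1)"
      by (intro onorm_le) (simp add: abs_mult mult_right_mono)
  qed (use p in auto)
  then have "(p * B powr (p - 1) * M)-lipschitz_on UNIV (\<lambda>x. \<bar>u x\<bar> powr p)"
    using B by (intro lipschitz_on_compose2[OF M]) (auto elim!: lipschitz_on_subset simp: abs_le_iff minus_le_iff)
  then show ?thesis by blast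
qed

context finsler_domain
begin

lemma lipschitz_mult_d:
  assumes f: "M-lipschitz_on UNIV f" and K: "compact K" "K \<subseteq> \<Omega>" "\<And>x. x \<notin> K \<Longrightarrow> f x = 0"
    and S: "\<And>t. 0 < t \<Longrightarrow> (S has_real_derivative S' t) (at t)" "continuous_on {0<..} S'"
  shows "\<exists>C. C-lipschitz_on UNIV (\<lambda>x. f x * S (d x))"
proof (cases "K = {}")
  case True
  then have "(\<lambda>x. f x * S (d x)) = (\<lambda>x. 0)" using K(3) by auto
  then show ?thesis by (intro exI[of _ 0]) (simp only:, simp add: lipschitz_on_def)
next
  case False
  obtain x0 where x0: "x0 \<in> K" "\<And>y. y \<in> K \<Longrightarrow> d x0 \<le> d y"
    using continuous_attains_inf[OF K(1) False d_continuous] by auto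
  obtain x1 where x1: "x1 \<in> K" "\<And>y. y \<in> K \<Longrightarrow> d y \<le> d x1"
    using continuous_attains_sup[OF K(1) False d_continuous] by auto
  define \<delta> R where "\<delta> = d x0" and "R = d x1"
  have \<delta>: "0 < \<delta>" "\<delta> \<le> R" using d_pos x0 x1 K(2) by (auto simp: \<delta>_def R_def)
  obtain L where L: "L-lipschitz_on UNIV d" using d_lipschitz by blast
  \<comment> \<open>On K the distance takes values in [\<delta>, R] only, so clamping d to this
    interval leaves the product unchanged and removes the possible singularity of S at 0.\<close>
  define cl where "cl t = max \<delta> (min t R)" for t
  have "1-lipschitz_on UNIV cl" by (rule lipschitz_onI) (auto simp: cl_def dist_real_def max_def min_def)
  from lipschitz_on_compose2[OF L lipschitz_on_subset[OF this]]
  have cd: "(1 * L)-lipschitz_on UNIV (\<lambda>x. cl (d x))" by simp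
  have "compact (S' ` {\<delta>..R})"
    using \<delta> by (intro compact_continuous_image continuous_on_subset[OF S(2)]) auto
  then have "bounded (S' ` {\<delta>..R})" by (rule compact_imp_bounded)
  then obtain B where B: "0 < B" "\<And>t. t \<in> {\<delta>..R} \<Longrightarrow> \<bar>S' t\<bar> \<le> B"
    unfolding bounded_pos by (metis imageI real_norm_def)
  have "B-lipschitz_on {\<delta>..R} S"
  proof (rule bounded_derivative_imp_lipschitz)
    fix t assume t: "t \<in> {\<delta>..R}"
    show "(S has_derivative (*) (S' t)) (at t within {\<delta>..R})"
      using S(1)[of t] t \<delta> unfolding has_field_derivative_def by (auto intro: has_derivative_at_withinI)
    show "onorm ((*) (S' t)) \<le> B"
      using B(2)[OF t] by (intro onorm_le) (simp add: abs_mult mult_right_mono)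
  qed (use B in auto)
  moreover have "(\<lambda>x. cl (d x)) ` UNIV \<subseteq> {\<delta>..R}" using \<delta> by (auto simp: cl_def)
  ultimately have "(B * (1 * L))-lipschitz_on UNIV (\<lambda>x. S (cl (d x)))"
    by (intro lipschitz_on_compose2[OF cd]) (rule lipschitz_on_subset)
  from lipschitz_mult_compact_support[OF f this K(1,3)]
  obtain C where "C-lipschitz_on UNIV (\<lambda>x. f x * S (cl (d x)))" by blast
  moreover have "f x * S (cl (d x)) = f x * S (d x)" for x
    using K(3) x0(2) x1(2) by (cases "x \<in> K") (auto simp: cl_def \<delta>_def R_def max_def min_def)
  ultimately show ?thesis by auto
qed

text \<open>Glued from \<Omega>, where d is positive, and the complement of K, where the product is
  zero; V may therefore be singular at 0.\<close>

lemma continuous_mult_d: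
  assumes f: "continuous_on UNIV f" and K: "compact K" "K \<subseteq> \<Omega>" "\<And>x. x \<notin> K \<Longrightarrow> f x = 0"
    and V: "continuous_on (d ` \<Omega>) V"
  shows "continuous_on UNIV (\<lambda>x. f x * V (d x) :: real)"
proof -
  have "continuous_on \<Omega> (\<lambda>x. f x * V (d x))"
    by (intro continuous_intros continuous_on_subset[OF f] continuous_on_compose2[OF V d_continuous]) auto
  moreover have "continuous_on (- K) (\<lambda>x. f x * V (d x))"
    by (rule continuous_on_eq[OF continuous_on_const[of _ 0]]) (use K in auto)
  moreover have "open (- K)" using K(1) by (simp add: compact_imp_closed open_Compl)
  ultimately have "continuous_on (\<Omega> \<union> - K) (\<lambda>x. f x * V (d x))"
    using open_\<Omega> by (intro continuous_on_open_Un)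
  moreover have "\<Omega> \<union> - K = UNIV" using K(2) by auto
  ultimately show ?thesis by simp
qed

lemma gd_bound: "\<exists>A>0. AE x in lebesgue. norm (gd x) \<le> A"
proof -
  obtain a where a: "0 < a" "\<And>x. a * norm x \<le> F x" using F_bounds by blast
  have "AE x in lebesgue. norm (gd x) \<le> 1 / a"
    using AE_F_gd
  proof eventually_elim
    case (elim x)
    show ?case
    proof (cases "x \<in> \<Omega>")
      case True
      then show ?thesis using a(2)[of "gd x"] elim a(1) by (simp add: field_simps)
    qed (use a in \<open>simp add: gd_def\<close>)
  qed
  then show ?thesis using a by (intro exI[of _ "1/a"]) auto
qed

end

locale superharmonic_domain = finsler_domain F \<Omega> for F :: "real^'n::finite \<Rightarrow> real" and \<Omega> +
  fixes p R :: real
  assumes sup: "superharmonic_dF F \<Omega>" and p: "2 \<le> p" and R: "0 < R" "\<And>x. x \<in> \<Omega> \<Longrightarrow> d x \<le> R"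
begin

text \<open>Uniform convexity is used at the base point w \<nabla>d with w = S(d) powr (1/(p - 1))
  u. The exponent is dictated by the linear term: it turns |w|^(p - 1) sgn w into S(d) |u|^(p - 1)
  sgn u, so that by the product rule p times this factor times Td \<bullet> \<nabla>u equals Td
  \<bullet> \<nabla>\<phi> - |u|^p S'(d) with \<phi> = |u|^p S(d). The integral of Td \<bullet>
  \<nabla>\<phi> is nonnegative by superharmonicity.\<close>

lemma hardy_general:
  fixes S S' :: "real \<Rightarrow> real"
  assumes k: "0 < k" "\<And>x y. F x powr p + p * F x powr (p - 1) * (grad F x \<bullet> y) + k * norm y powr p \<le> F (x + y) powr p"
    and S: "\<And>t. 0 < t \<Longrightarrow> (S has_real_derivative S' t) (at t)" "continuous_on {0<..} S'" "\<And>t. 0 < t \<Longrightarrow> t \<le> R \<Longrightarrow> 0 \<le> S t"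
    and u: "u \<in> Cc_inf \<Omega>"
  shows "integrable lebesgue (\<lambda>x. F (grad u x) powr p)"
    "integrable lebesgue (\<lambda>x. \<bar>u x\<bar> powr p * (- S' (d x) - (p - 1) * S (d x) powr (p / (p - 1))))"
    "integrable lebesgue (\<lambda>x. norm (grad u x - (S (d x) powr (1 / (p - 1)) * u x) *\<^sub>R gd x) powr p)"
    "(\<integral>x. \<bar>u x\<bar> powr p * (- S' (d x) - (p - 1) * S (d x) powr (p / (p - 1))) \<partial>lebesgue)
       + k * (\<integral>x. norm (grad u x - (S (d x) powr (1 / (p - 1)) * u x) *\<^sub>R gd x) powr p \<partial>lebesgue)
     \<le> (\<integral>x. F (grad u x) powr p \<partial>lebesgue)"
proof -
  define K where "K = tsupp u"
  have K: "compact K" "K \<subseteq> \<Omega>" "\<And>x. x \<notin> K \<Longrightarrow> u x = 0" "\<And>x. x \<notin> K \<Longrightarrow> grad u x = 0"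
    unfolding K_def using Cc_inf_support[OF u] by auto
  have uc: "continuous_on UNIV u" and guc: "continuous_on UNIV (grad u)"
    using Cc_inf_continuous[OF u] Cc_inf_grad_continuous[OF u] by auto
  have Sc: "continuous_on {0<..} S"
    using S(1) by (intro continuous_at_imp_continuous_on ballI DERIV_isCont) auto
  show int1: "integrable lebesgue (\<lambda>x. F (grad u x) powr p)"
    using p by (intro integrable_continuous_support[OF _ K(1)] continuous_on_powr' continuous_on_compose2[OF F_continuous guc] continuous_intros)
      (auto simp: K(4))
  have upc: "continuous_on UNIV (\<lambda>x. \<bar>u x\<bar> powr p)"
    using p by (intro continuous_on_powr' continuous_intros uc) auto
  have up0: "\<bar>u x\<bar> powr p = 0" if "x \<notin> K" for x using K(3)[OF that] by simp
  have d\<Omega>: "d ` \<Omega> \<subseteq> {0<..R}" using d_pos R by auto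
  have powc: "continuous_on (d ` \<Omega>) (\<lambda>t. S t powr q)" if "0 < q" for q
    using that d\<Omega> S(3) by (intro continuous_on_powr' continuous_on_const continuous_on_subset[OF Sc]) fastforce+
  have q: "0 < p / (p - 1)" "0 < 1 / (p - 1)" using p by auto
  show int2: "integrable lebesgue (\<lambda>x. \<bar>u x\<bar> powr p * (- S' (d x) - (p - 1) * S (d x) powr (p / (p - 1))))"
  proof (rule integrable_continuous_support[OF continuous_mult_d[OF upc K(1,2) up0] K(1)])
    show "continuous_on (d ` \<Omega>) (\<lambda>t. - S' t - (p - 1) * S t powr (p / (p - 1)))"
      using d\<Omega> by (intro continuous_intros powc q continuous_on_subset[OF S(2)]) auto
  qed (use up0 in auto)
  define w where "w x = S (d x) powr (1 / (p - 1)) * u x" for x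
  have wc: "continuous_on UNIV w"
    using continuous_mult_d[OF uc K(1,2,3) powc[OF q(2)]] by (simp add: w_def[abs_def] mult.commute)
  have w0: "w x = 0" if "x \<notin> K" for x using K(3)[OF that] by (simp add: w_def)
  obtain B where B: "0 < B" "\<And>x. norm (grad u x) \<le> B" using Cc_inf_bounded[OF u] by blast
  have "bounded (w ` K)" using compact_continuous_image[OF continuous_on_subset[OF wc] K(1)] by (auto intro: compact_imp_bounded)
  then obtain C where C: "0 < C" "\<And>x. x \<in> K \<Longrightarrow> \<bar>w x\<bar> \<le> C" unfolding bounded_pos by auto
  then have C': "\<bar>w x\<bar> \<le> C" for x using w0 by (cases "x \<in> K") auto
  obtain A where A: "0 < A" "AE x in lebesgue. norm (gd x) \<le> A" using gd_bound by blast
  have "integrable lebesgue (\<lambda>x. norm (grad u x - w x *\<^sub>R gd x) powr p)"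
  proof (rule integrable_bounded_support[OF _ _ K(1)])
    show "(\<lambda>x. norm (grad u x - w x *\<^sub>R gd x) powr p) \<in> borel_measurable lebesgue"
    proof -
      note [measurable] = continuous_imp_lebesgue_measurable[OF guc] continuous_imp_lebesgue_measurable[OF wc] gd_measurable
      show ?thesis by measurable
    qed
    show "AE x in lebesgue. \<bar>norm (grad u x - w x *\<^sub>R gd x) powr p\<bar> \<le> (B + C * A) powr p"
      using A(2)
    proof eventually_elim
      case (elim x)
      have "norm (grad u x - w x *\<^sub>R gd x) \<le> norm (grad u x) + norm (w x *\<^sub>R gd x)" by (rule norm_triangle_ineq4)
      also have "norm (w x *\<^sub>R gd x) = \<bar>w x\<bar> * norm (gd x)" by simp
      also have "norm (grad u x) + \<dots> \<le> B + C * A"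
        using B(2)[of x] C'[of x] elim C by (intro add_mono mult_mono) auto
      finally show ?case using p by (simp add: powr_mono2)
    qed
  qed (use K(4) w0 in simp)
  then show int3: "integrable lebesgue (\<lambda>x. norm (grad u x - (S (d x) powr (1 / (p - 1)) * u x) *\<^sub>R gd x) powr p)"
    by (simp only: w_def)
  define \<phi> where "\<phi> x = \<bar>u x\<bar> powr p * S (d x)" for x
  obtain M where "M-lipschitz_on UNIV (\<lambda>x. \<bar>u x\<bar> powr p)" using abs_powr_lipschitz[OF u p] by blast
  from lipschitz_mult_d[OF this K(1,2) up0 S(1,2)]
  obtain M' where M': "M'-lipschitz_on UNIV \<phi>" by (auto simp: \<phi>_def[abs_def])
  have \<phi>_nonneg: "0 \<le> \<phi> x" for x
  proof (cases "x \<in> K")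
    case True
    then have "0 \<le> S (d x)" using K(2) d_pos R S(3) by auto
    then show ?thesis by (simp add: \<phi>_def)
  qed (simp add: \<phi>_def up0)
  have \<phi>_der: "(\<phi> has_derivative (\<lambda>h. ((S (d x) * (p * \<bar>u x\<bar> powr (p - 1) * sgn (u x))) *\<^sub>R grad u x + (\<bar>u x\<bar> powr p * S' (d x)) *\<^sub>R gd x) \<bullet> h)) (at x)"
    if x: "x \<in> \<Omega>" and D: "(d has_derivative (\<lambda>h. gd x \<bullet> h)) (at x)" for x
  proof -
    have 1: "((\<lambda>x. \<bar>u x\<bar> powr p) has_derivative (\<lambda>h. p * \<bar>u x\<bar> powr (p - 1) * sgn (u x) * (grad u x \<bullet> h))) (at x)"
      by (rule has_derivative_compose[OF has_derivative_grad[OF Cc_inf_differentiable[OF u]]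
           abs_powr_has_derivative[OF p, unfolded has_field_derivative_def]])
    have 2: "((\<lambda>x. S (d x)) has_derivative (\<lambda>h. S' (d x) * (gd x \<bullet> h))) (at x)"
      by (rule has_derivative_compose[OF D S(1)[OF d_pos[OF x], unfolded has_field_derivative_def]])
    show ?thesis unfolding \<phi>_def
      by (rule has_derivative_eq_rhs[OF has_derivative_mult[OF 1 2]]) (auto simp: inner_add_left algebra_simps)
  qed
  have \<phi>_diff: "AE x in lebesgue. x \<in> \<Omega> \<longrightarrow> \<phi> differentiable (at x)"
    using AE_F_gd
  proof eventually_elim
    case (elim x)
    then show ?case using \<phi>_der[of x] unfolding differentiable_def by blast
  qed
  have \<phi>0: "\<phi> x = 0" if "x \<notin> K" for x using up0[OF that] by (simp add: \<phi>_def)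
  note sl = superharmonic_lipschitz[OF sup M' \<phi>_nonneg K(1,2) \<phi>0 \<phi>_diff]
  let ?U = "\<lambda>x. \<bar>u x\<bar> powr p * (- S' (d x) - (p - 1) * S (d x) powr (p / (p - 1)))"
  let ?G = "\<lambda>x. norm (grad u x - (S (d x) powr (1 / (p - 1)) * u x) *\<^sub>R gd x) powr p"
  have "AE x in lebesgue. ?U x + k * ?G x + Td x \<bullet> grad \<phi> x \<le> F (grad u x) powr p"
    using AE_F_gd AE_Td
  proof eventually_elim
    case (elim x)
    show ?case
    proof (cases "x \<in> \<Omega>")
      case False
      then have "x \<notin> K" using K(2) by auto
      then show ?thesis using False K(3,4) by (simp add: Td_def gd_def)
    next
      case x: True
      have dx: "0 < d x" "d x \<le> R" using d_pos[OF x] R(2)[OF x] by auto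
      define a where "a = \<bar>u x\<bar>"
      define s where "s = S (d x)"
      define W where "W = w x"
      define T where "T = Td x \<bullet> grad u x"
      have s: "0 \<le> s" using S(3)[OF dx] by (simp add: s_def)
      have gd: "F (gd x) = 1" "(d has_derivative (\<lambda>h. gd x \<bullet> h)) (at x)" "Td x \<bullet> gd x = 1" using elim x by auto
      then have gd0: "gd x \<noteq> 0" by auto
      have g\<phi>: "grad \<phi> x = (s * (p * a powr (p - 1) * sgn (u x))) *\<^sub>R grad u x + (a powr p * S' (d x)) *\<^sub>R gd x"
        unfolding a_def s_def by (rule grad_eqI[OF \<phi>_der[OF x gd(2)]])
      have T\<phi>: "Td x \<bullet> grad \<phi> x = s * (p * a powr (p - 1) * sgn (u x)) * T + a powr p * S' (d x)"
        unfolding g\<phi> inner_add_right by (simp add: T_def gd(3))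
      have Fw: "F (W *\<^sub>R gd x) = \<bar>W\<bar>" by (simp add: F_scaleR gd)
      \<comment> \<open>\<open>grad F\<close> is homogeneous of degree zero up to sign, so it may be
        evaluated at the gradient of d itself; for W = 0 the powers make both sides vanish.\<close>
      have lin: "F (W *\<^sub>R gd x) powr (p - 1) * (grad F (W *\<^sub>R gd x) \<bullet> y) = \<bar>W\<bar> powr (p - 1) * sgn W * (Td x \<bullet> y)" for y
        using grad_F_scaleR[OF gd0, of W] x by (cases "W = 0") (auto simp: Fw Td_def)
      have "F (W *\<^sub>R gd x) powr p + p * F (W *\<^sub>R gd x) powr (p - 1) * (grad F (W *\<^sub>R gd x) \<bullet> (grad u x - W *\<^sub>R gd x))
          + k * norm (grad u x - W *\<^sub>R gd x) powr p \<le> F (W *\<^sub>R gd x + (grad u x - W *\<^sub>R gd x)) powr p"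
        by (rule k(2))
      then have f1: "\<bar>W\<bar> powr p + p * (\<bar>W\<bar> powr (p - 1) * sgn W * (T - W)) + k * ?G x \<le> F (grad u x) powr p"
      proof -
        assume that: "F (W *\<^sub>R gd x) powr p + p * F (W *\<^sub>R gd x) powr (p - 1) * (grad F (W *\<^sub>R gd x) \<bullet> (grad u x - W *\<^sub>R gd x))
          + k * norm (grad u x - W *\<^sub>R gd x) powr p \<le> F (W *\<^sub>R gd x + (grad u x - W *\<^sub>R gd x)) powr p"
        have "p * F (W *\<^sub>R gd x) powr (p - 1) * (grad F (W *\<^sub>R gd x) \<bullet> (grad u x - W *\<^sub>R gd x))
            = p * (\<bar>W\<bar> powr (p - 1) * sgn W * (T - W))"
          unfolding mult.assoc[of p] lin by (simp add: inner_diff_right gd(3) T_def)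
        moreover have "?G x = norm (grad u x - W *\<^sub>R gd x) powr p" by (simp add: W_def w_def)
        moreover have "F (W *\<^sub>R gd x) powr p = \<bar>W\<bar> powr p" by (simp only: Fw)
        moreover have "W *\<^sub>R gd x + (grad u x - W *\<^sub>R gd x) = grad u x" by simp
        ultimately show ?thesis using that by (simp only:)
      qed
      have f2: "\<bar>W\<bar> powr (p - 1) * sgn W * W = \<bar>W\<bar> powr p"
        by (cases "W = 0") (auto simp: powr_diff mult.assoc sgn_mult_self_eq abs_sgn[symmetric] mult_sgn_abs mult.commute[of "sgn W"])
      have f3: "\<bar>W\<bar> powr p = s powr (p / (p - 1)) * a powr p"
        using p by (simp add: W_def w_def abs_mult powr_mult powr_powr a_def s_def)
      have f4: "\<bar>W\<bar> powr (p - 1) * sgn W = s * a powr (p - 1) * sgn (u x)"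
      proof (cases "s = 0")
        case False
        then show ?thesis using s p
          by (simp add: W_def w_def abs_mult powr_mult powr_powr a_def s_def sgn_mult)
      qed (simp add: W_def w_def s_def)
      have "p * (\<bar>W\<bar> powr (p - 1) * sgn W * (T - W)) = p * (\<bar>W\<bar> powr (p - 1) * sgn W) * T - p * (\<bar>W\<bar> powr (p - 1) * sgn W * W)"
        by (simp add: algebra_simps)
      also have "\<dots> = p * (s * a powr (p - 1) * sgn (u x)) * T - p * (s powr (p / (p - 1)) * a powr p)"
        by (simp only: f2) (simp only: f3 f4)
      finally have "(1 - p) * (s powr (p / (p - 1)) * a powr p) + p * (s * a powr (p - 1) * sgn (u x)) * T + k * ?G x \<le> F (grad u x) powr p"
        using f1 unfolding f3 by (simp add: algebra_simps)
      then show ?thesis unfolding T\<phi> by (simp add: s_def[symmetric] a_def[symmetric] algebra_simps)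
    qed
  qed
  then have "(\<integral>x. ?U x + k * ?G x + Td x \<bullet> grad \<phi> x \<partial>lebesgue) \<le> (\<integral>x. F (grad u x) powr p \<partial>lebesgue)"
    by (intro integral_mono_AE int1 Bochner_Integration.integrable_add int2 integrable_mult_right int3 sl(1))
  also have "(\<integral>x. ?U x + k * ?G x + Td x \<bullet> grad \<phi> x \<partial>lebesgue) = (\<integral>x. ?U x \<partial>lebesgue) + k * (\<integral>x. ?G x \<partial>lebesgue) + (\<integral>x. Td x \<bullet> grad \<phi> x \<partial>lebesgue)"
    using int2 int3 sl(1) by (simp add: Bochner_Integration.integral_add)
  finally show "(\<integral>x. ?U x \<partial>lebesgue) + k * (\<integral>x. ?G x \<partial>lebesgue) \<le> (\<integral>x. F (grad u x) powr p \<partial>lebesgue)"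
    using sl(2) by linarith
qed


definition c :: real where "c = (p - 1) / p"

lemma c_bounds: "0 < c" "c < 1" "(p - 1) * (1 - c) = c" "1 - c = 1 / p"
  using p by (auto simp: c_def field_simps)

definition Gv :: "(real^'n \<Rightarrow> real) \<Rightarrow> real^'n \<Rightarrow> real^'n" where
  "Gv u x = grad u x - (c * u x / d x) *\<^sub>R gd x"

lemma hardy:
  "\<exists>k>0. \<forall>u\<in>Cc_inf \<Omega>. integrable lebesgue (\<lambda>x. norm (Gv u x) powr p) \<and>
     k * (\<integral>x. norm (Gv u x) powr p \<partial>lebesgue) \<le> I_p F p u \<Omega> \<and>
     k * (\<integral>x. \<bar>u x\<bar> powr p \<partial>lebesgue) \<le> I_p F p u \<Omega>"
proof -
  obtain k where k: "0 < k" "\<And>x y. F x powr p + p * F x powr (p - 1) * (grad F x \<bullet> y) + k * norm y powr p \<le> F (x + y) powr p"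
    using F_powr_uniformly_convex[OF p] by blast
  \<comment> \<open>The largest value for which \<open>S1\<close> below is nonnegative on (0, R].
    This is where the upper bound on d enters.\<close>
  define e where "e = inverse (R powr p)"
  have e: "0 < e" "e * R powr p = 1" using R(1) by (auto simp: e_def)
  \<comment> \<open>A weight k t powr (1 - p) yields the coefficient (p - 1) (k - k powr (p / (p -
    1))) of t powr (-p). It is maximal for k = c powr (p - 1), and its value there is the sharp
    constant c powr p.\<close>
  define cp where "cp = c powr (p - 1)"
  have cp: "0 < cp" using c_bounds by (simp add: cp_def)
  (* S0 yields the sharp Hardy weight; subtracting e * t only decreases S0 powr (p / (p - 1))
     but adds the constant cp * e to - S0', which is the zero order remainder. *)
  define S0 S0' S1 S1' where "S0 t = cp * t powr (1 - p)" and "S0' t = cp * ((1 - p) * t powr (- p))"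
    and "S1 t = cp * (t powr (1 - p) - e * t)" and "S1' t = cp * ((1 - p) * t powr (- p) - e)" for t
  have pw: "t powr (1 - p) = t powr (- p) * t" if "0 < t" for t :: real
    using that powr_add[of t "-p" 1] by simp
  have D0: "(S0 has_real_derivative S0' t) (at t)" "(S1 has_real_derivative S1' t) (at t)" if "0 < t" for t
    unfolding S0_def S0'_def S1_def S1'_def using that by (auto intro!: derivative_eq_intros)
  have C0: "continuous_on {0<..} S0'" "continuous_on {0<..} S1'"
    unfolding S0'_def S1'_def by (auto intro!: continuous_intros)
  have ge0: "0 \<le> S0 t" for t using cp by (simp add: S0_def)
  have ge1: "0 \<le> S1 t" "S1 t \<le> S0 t" if t: "0 < t" "t \<le> R" for t
  proof -
    have "t powr p \<le> R powr p" using t p by (intro powr_mono2) auto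
    then have "e * t powr p \<le> 1" using e by (metis mult_left_mono less_imp_le)
    then have "e * t powr p * t powr (1 - p) \<le> t powr (1 - p)" using mult_right_mono[of "e * t powr p" 1 "t powr (1 - p)"] by simp
    moreover have "t powr p * t powr (1 - p) = t" using t by (simp flip: powr_add)
    ultimately show "0 \<le> S1 t" using cp by (simp add: S1_def mult.assoc)
    show "S1 t \<le> S0 t" using cp e t by (simp add: S1_def S0_def)
  qed
  have S0p: "S0 t powr (p / (p - 1)) = c powr p * t powr (- p)" if "0 < t" for t
  proof -
    have "(p - 1) * (p / (p - 1)) = p" "(1 - p) * (p / (p - 1)) = - p" using p by (auto simp: field_simps)
    then show ?thesis using that c_bounds by (simp add: S0_def cp_def powr_mult powr_powr)
  qed
  \<comment> \<open>This identifies the gradient remainder of \<open>hardy_general\<close> for the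
    weight \<open>S0\<close> with \<open>Gv\<close>.\<close>
  have S0s: "S0 t powr (1 / (p - 1)) = c / t" if "0 < t" for t
  proof -
    have "(p - 1) * (1 / (p - 1)) = 1" "(1 - p) * (1 / (p - 1)) = - 1" using p by (auto simp: field_simps)
    then show ?thesis using that c_bounds by (simp add: S0_def cp_def powr_mult powr_powr powr_minus divide_inverse)
  qed
  have cc: "c powr p = cp * c" using c_bounds by (simp add: cp_def powr_diff)
  have id0: "- S0' t - (p - 1) * S0 t powr (p / (p - 1)) = c powr p * t powr (- p)" if "0 < t" for t
  proof -
    have "- S0' t - (p - 1) * S0 t powr (p / (p - 1)) = cp * t powr (- p) * ((p - 1) * (1 - c))"
      unfolding S0p[OF that] cc S0'_def by (simp add: algebra_simps)
    then show ?thesis unfolding c_bounds(3) cc by (simp add: mult_ac)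
  qed
  have id1: "c powr p * t powr (- p) + cp * e \<le> - S1' t - (p - 1) * S1 t powr (p / (p - 1))" if t: "0 < t" "t \<le> R" for t
  proof -
    have "S1 t powr (p / (p - 1)) \<le> S0 t powr (p / (p - 1))" using ge1[OF t] p by (intro powr_mono2) auto
    then have "(p - 1) * S1 t powr (p / (p - 1)) \<le> (p - 1) * S0 t powr (p / (p - 1))" using p by (intro mult_left_mono) auto
    moreover have "- S1' t = - S0' t + cp * e" by (simp add: S1'_def S0'_def algebra_simps)
    ultimately show ?thesis using id0[OF t(1)] by linarith
  qed
  define k' where "k' = min k (cp * e)"
  have k': "0 < k'" "k' \<le> k" "k' \<le> cp * e" using k cp e by (auto simp: k'_def)
  have main: "integrable lebesgue (\<lambda>x. norm (Gv u x) powr p) \<and> k' * (\<integral>x. norm (Gv u x) powr p \<partial>lebesgue) \<le> I_p F p u \<Omega> \<and>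
     k' * (\<integral>x. \<bar>u x\<bar> powr p \<partial>lebesgue) \<le> I_p F p u \<Omega>" if u: "u \<in> Cc_inf \<Omega>" for u
  proof -
    note K = Cc_inf_support[OF u]
    have \<Omega>out: "u x = 0" "grad u x = 0" if "x \<notin> \<Omega>" for x using K that by auto
    note h0 = hardy_general[OF k D0(1) C0(1) ge0 u]
    note h1 = hardy_general[OF k D0(2) C0(2) ge1(1) u]
    have U0: "(\<lambda>x. \<bar>u x\<bar> powr p * (- S0' (d x) - (p - 1) * S0 (d x) powr (p / (p - 1)))) = (\<lambda>x. c powr p * (\<bar>u x\<bar> powr p / d x powr p))"
    proof
      fix x show "\<bar>u x\<bar> powr p * (- S0' (d x) - (p - 1) * S0 (d x) powr (p / (p - 1))) = c powr p * (\<bar>u x\<bar> powr p / d x powr p)"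
        using id0[of "d x"] d_pos[of x] by (cases "x \<in> \<Omega>") (auto simp: \<Omega>out powr_minus divide_inverse[of "\<bar>u x\<bar> powr p"])
    qed
    have G0: "(\<lambda>x. norm (grad u x - (S0 (d x) powr (1 / (p - 1)) * u x) *\<^sub>R gd x) powr p) = (\<lambda>x. norm (Gv u x) powr p)"
    proof
      fix x show "norm (grad u x - (S0 (d x) powr (1 / (p - 1)) * u x) *\<^sub>R gd x) powr p = norm (Gv u x) powr p"
        by (cases "x \<in> \<Omega>") (auto simp: \<Omega>out S0s d_pos Gv_def)
    qed
    have iu: "integrable lebesgue (\<lambda>x. \<bar>u x\<bar> powr p)"
      using p by (intro integrable_continuous_support[OF _ K(1)] continuous_on_powr' continuous_intros Cc_inf_continuous[OF u])
        (auto simp: K(3))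
    have iud: "integrable lebesgue (\<lambda>x. c powr p * (\<bar>u x\<bar> powr p / d x powr p))" using h0(2) unfolding U0 .
    have I: "I_p F p u \<Omega> = (\<integral>x. F (grad u x) powr p \<partial>lebesgue) - (\<integral>x. c powr p * (\<bar>u x\<bar> powr p / d x powr p) \<partial>lebesgue)"
    proof -
      have "(\<lambda>x. indicator \<Omega> x *\<^sub>R F (grad u x) powr p) = (\<lambda>x. F (grad u x) powr p)"
        "(\<lambda>x. indicator \<Omega> x *\<^sub>R (\<bar>u x\<bar> powr p / d x powr p)) = (\<lambda>x. \<bar>u x\<bar> powr p / d x powr p)"
        using \<Omega>out by (auto simp: indicator_def fun_eq_iff)
      moreover have "(\<integral>x. c powr p * (\<bar>u x\<bar> powr p / d x powr p) \<partial>lebesgue) = c powr p * (\<integral>x. \<bar>u x\<bar> powr p / d x powr p \<partial>lebesgue)"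
        by (rule integral_mult_right_zero)
      ultimately show ?thesis unfolding I_p_def set_lebesgue_integral_def c_def by (simp only:)
    qed
    have "k * (\<integral>x. norm (Gv u x) powr p \<partial>lebesgue) \<le> I_p F p u \<Omega>"
      using h0(4) unfolding U0 G0 I by linarith
    moreover have "k' * (\<integral>x. norm (Gv u x) powr p \<partial>lebesgue) \<le> k * (\<integral>x. norm (Gv u x) powr p \<partial>lebesgue)"
      using k' by (intro mult_right_mono integral_nonneg_AE) auto
    moreover have "cp * e * (\<integral>x. \<bar>u x\<bar> powr p \<partial>lebesgue) \<le> I_p F p u \<Omega>"
    proof -
      have "(\<integral>x. c powr p * (\<bar>u x\<bar> powr p / d x powr p) + (cp * e) * \<bar>u x\<bar> powr p \<partial>lebesgue)
         \<le> (\<integral>x. \<bar>u x\<bar> powr p * (- S1' (d x) - (p - 1) * S1 (d x) powr (p / (p - 1))) \<partial>lebesgue)"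
      proof (rule Bochner_Integration.integral_mono)
        fix x
        show "c powr p * (\<bar>u x\<bar> powr p / d x powr p) + (cp * e) * \<bar>u x\<bar> powr p \<le> \<bar>u x\<bar> powr p * (- S1' (d x) - (p - 1) * S1 (d x) powr (p / (p - 1)))"
        proof (cases "x \<in> \<Omega>")
          case True
          have "\<bar>u x\<bar> powr p * (c powr p * d x powr (- p) + cp * e) \<le> \<bar>u x\<bar> powr p * (- S1' (d x) - (p - 1) * S1 (d x) powr (p / (p - 1)))"
            by (intro mult_left_mono id1 d_pos R True) auto
          then show ?thesis by (simp add: powr_minus divide_inverse algebra_simps)
        qed (simp add: \<Omega>out)
      qed (use h1(2) iud iu in auto)
      moreover have "(\<integral>x. c powr p * (\<bar>u x\<bar> powr p / d x powr p) + (cp * e) * \<bar>u x\<bar> powr p \<partial>lebesgue)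
         = (\<integral>x. c powr p * (\<bar>u x\<bar> powr p / d x powr p) \<partial>lebesgue) + cp * e * (\<integral>x. \<bar>u x\<bar> powr p \<partial>lebesgue)"
        using iud iu by (subst Bochner_Integration.integral_add) auto
      moreover have "0 \<le> k * (\<integral>x. norm (grad u x - (S1 (d x) powr (1 / (p - 1)) * u x) *\<^sub>R gd x) powr p \<partial>lebesgue)"
        using k(1) by (intro mult_nonneg_nonneg integral_nonneg_AE) auto
      ultimately show ?thesis using h1(4) unfolding I by linarith
    qed
    moreover have "k' * (\<integral>x. \<bar>u x\<bar> powr p \<partial>lebesgue) \<le> cp * e * (\<integral>x. \<bar>u x\<bar> powr p \<partial>lebesgue)"
      using k' by (intro mult_right_mono integral_nonneg_AE) auto
    ultimately show ?thesis using h0(3) unfolding G0 by auto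
  qed
  then show ?thesis using k'(1) by blast
qed

end

section \<open>Affine changes of variables and boundary charts\<close>

lemma lebesgue_affine_eq:
  fixes t :: "'a::euclidean_space"
  assumes c: "0 < c"
  shows "lebesgue = density (distr lebesgue lebesgue (\<lambda>x. t + c *\<^sub>R x)) (\<lambda>_. ennreal (c ^ DIM('a)))"
    and "(\<lambda>x. t + c *\<^sub>R x) \<in> lebesgue \<rightarrow>\<^sub>M lebesgue"
  using lebesgue_affine_euclidean[of "\<lambda>_::'a. c" t] lebesgue_affine_measurable[of "\<lambda>_::'a. c" t] c
  unfolding scaleR_scaleR[symmetric] scaleR_sum_right[symmetric] euclidean_representation prod_constant by auto

lemma AE_lebesgue_affine:
  fixes t :: "'a::euclidean_space"
  assumes c: "0 < c" and P: "AE x in lebesgue. P x"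
  shows "AE x in lebesgue. P (t + c *\<^sub>R x)"
proof -
  note m = lebesgue_affine_eq(2)[OF c, of t]
  have "AE x in density (distr lebesgue lebesgue (\<lambda>x. t + c *\<^sub>R x)) (\<lambda>_. ennreal (c ^ DIM('a))). P x"
    using P by (subst lebesgue_affine_eq(1)[OF c, of t, symmetric])
  then have "AE x in distr lebesgue lebesgue (\<lambda>x. t + c *\<^sub>R x). P x"
    using c by (subst (asm) AE_density) auto
  then show ?thesis by (rule AE_distrD[OF m])
qed

lemma lebesgue_integral_affine:
  fixes f :: "'a::euclidean_space \<Rightarrow> real"
  assumes c: "0 < c" and f: "integrable lebesgue f"
  shows "integrable lebesgue (\<lambda>x. f (t + c *\<^sub>R x))"
    and "(\<integral>x. f (t + c *\<^sub>R x) \<partial>lebesgue) = (\<integral>x. f x \<partial>lebesgue) / c ^ DIM('a)"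
proof -
  note m = lebesgue_affine_eq(2)[OF c, of t]
  let ?D = "distr lebesgue lebesgue (\<lambda>x. t + c *\<^sub>R x)"
  have fm: "f \<in> borel_measurable ?D" using f by (simp add: borel_measurable_integrable)
  have "integrable (density ?D (\<lambda>_. ennreal (c ^ DIM('a)))) f"
    using f lebesgue_affine_eq(1)[OF c, of t] by simp
  then have "integrable ?D (\<lambda>x. c ^ DIM('a) *\<^sub>R f x)"
    using fm c by (subst (asm) integrable_density) auto
  then have D: "integrable ?D f" using c by simp
  then show "integrable lebesgue (\<lambda>x. f (t + c *\<^sub>R x))" by (rule integrable_distr[OF m])
  have "(\<integral>x. f x \<partial>lebesgue) = (\<integral>x. f x \<partial>density ?D (\<lambda>_. ennreal (c ^ DIM('a))))"
    using lebesgue_affine_eq(1)[OF c, of t] by simp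
  also have "\<dots> = (\<integral>x. c ^ DIM('a) *\<^sub>R f x \<partial>?D)" using fm c by (subst integral_density) auto
  also have "\<dots> = c ^ DIM('a) * (\<integral>x. f x \<partial>?D)" by simp
  also have "(\<integral>x. f x \<partial>?D) = (\<integral>x. f (t + c *\<^sub>R x) \<partial>lebesgue)"
    using f by (intro integral_distr m) (simp add: borel_measurable_integrable)
  finally show "(\<integral>x. f (t + c *\<^sub>R x) \<partial>lebesgue) = (\<integral>x. f x \<partial>lebesgue) / c ^ DIM('a)" using c by simp
qed

text \<open>Hoelder's inequality up to a factor 2, from the pointwise bound \<open>f \<le> y + y powr (1 - p) * f powr p\<close>.\<close>

lemma holder_set:
  fixes f :: "'a::euclidean_space \<Rightarrow> real"
  assumes p: "1 < p" and f: "f \<in> borel_measurable lebesgue" "\<And>x. 0 \<le> f x"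
    and fp: "integrable lebesgue (\<lambda>x. f x powr p)" "(\<integral>x. f x powr p \<partial>lebesgue) \<le> N powr p" and N: "0 < N"
    and E: "E \<in> lmeasurable" "measure lebesgue E \<le> V" and V: "0 < V"
  shows "integrable lebesgue (\<lambda>x. indicator E x * f x)"
    and "(\<integral>x. indicator E x * f x \<partial>lebesgue) \<le> 2 * N * V powr (1 - 1/p)"
proof -
  \<comment> \<open>The value that balances y V against y powr (1 - p) N powr p; both become N V
    powr (1 - 1/p).\<close>
  define y where "y = N * V powr (- 1/p)"
  have y: "0 < y" using N V by (simp add: y_def)
  have pt: "f x \<le> y + y powr (1 - p) * f x powr p" for x
  proof (cases "f x \<le> y")
    case False
    then have fx: "y \<le> f x" "0 < f x" using y by auto
    have "1 \<le> (f x / y) powr (p - 1)" using fx y p by (intro ge_one_powr_ge_zero) auto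
    then have "f x * 1 \<le> f x * (f x / y) powr (p - 1)" using fx by (intro mult_left_mono) auto
    also have "\<dots> = y powr (1 - p) * f x powr p"
      using fx y by (simp add: powr_divide powr_diff powr_minus field_simps)
    finally show ?thesis using y by simp
  qed (use y in \<open>auto intro: order_trans\<close>)
  have iE: "integrable lebesgue (\<lambda>x. indicator E x :: real)"
    using E by (intro integrable_real_indicator) (auto simp: fmeasurable_def)
  have ib: "integrable lebesgue (\<lambda>x. y * indicator E x + y powr (1 - p) * f x powr p)"
    by (intro Bochner_Integration.integrable_add integrable_mult_right iE fp)
  have le: "indicator E x * f x \<le> y * indicator E x + y powr (1 - p) * f x powr p" for x
    using pt[of x] y by (auto simp: indicator_def)
  have Em: "E \<in> sets lebesgue" using E by auto
  show int: "integrable lebesgue (\<lambda>x. indicator E x * f x)"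
  proof (rule Bochner_Integration.integrable_bound[OF ib])
    show "(\<lambda>x. indicator E x * f x) \<in> borel_measurable lebesgue"
      using f(1) Em by (intro borel_measurable_times borel_measurable_indicator)
    show "AE x in lebesgue. norm (indicator E x * f x) \<le> norm (y * indicator E x + y powr (1 - p) * f x powr p)"
      using le f(2) by (intro always_eventually) (smt (verit) indicator_pos_le mult_nonneg_nonneg real_norm_def)
  qed
  have "(\<integral>x. indicator E x * f x \<partial>lebesgue) \<le> (\<integral>x. y * indicator E x + y powr (1 - p) * f x powr p \<partial>lebesgue)"
    by (rule Bochner_Integration.integral_mono[OF int ib le])
  also have "\<dots> = y * measure lebesgue E + y powr (1 - p) * (\<integral>x. f x powr p \<partial>lebesgue)"
    using iE fp Em by (subst Bochner_Integration.integral_add) auto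
  also have "\<dots> \<le> y * V + y powr (1 - p) * N powr p"
    using E fp y by (intro add_mono mult_left_mono) auto
  also have "y * V = N * V powr (1 - 1/p)"
    using V by (simp add: y_def powr_diff powr_minus divide_inverse)
  also have "y powr (1 - p) * N powr p = N * V powr (1 - 1/p)"
  proof -
    have "N powr (1 - p) * N powr p = N" using N by (simp flip: powr_add)
    moreover have "(- 1 / p) * (1 - p) = 1 - 1 / p" using p by (simp add: field_simps)
    ultimately show ?thesis using N V by (simp add: y_def powr_mult powr_powr mult_ac)
  qed
  finally show "(\<integral>x. indicator E x * f x \<partial>lebesgue) \<le> 2 * N * V powr (1 - 1/p)" by simp
qed

lemma measure_ball_scaling:
  fixes z :: "real^'n::finite"
  assumes "0 < r"
  shows "measure lebesgue (ball z r) = measure lebesgue (ball (0::real^'n) 1) * r powr real CARD('n)"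
proof -
  have "measure lebesgue (ball z r) = unit_ball_vol (real DIM(real^'n)) * r ^ DIM(real^'n)"
    if "0 \<le> r" for z :: "real^'n" and r :: real using content_ball[OF that, of z] by (simp add: measure_completion)
  from this[of r z] this[of 1 0] show ?thesis using assms by (simp add: powr_realpow)
qed

section \<open>Heights in uniform boundary charts\<close>

locale lipschitz_superharmonic_domain = superharmonic_domain F \<Omega> p R
  for F :: "real^'n::finite \<Rightarrow> real" and \<Omega> and p R +
  fixes r0 L n :: real
  assumes n: "n = real CARD('n)" and n2: "2 \<le> n"
    and r0: "0 < r0" and L: "0 \<le> L"
    and chart: "\<And>x0. x0 \<in> frontier \<Omega> \<Longrightarrow> \<exists>e g. norm e = 1 \<and> L-lipschitz_on UNIV g \<and>
          \<Omega> \<inter> ball x0 r0 = {x \<in> ball x0 r0. (x - x0) \<bullet> e > g ((x - x0) - ((x - x0) \<bullet> e) *\<^sub>R e)}"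
begin

text \<open>\<open>ch\<close> is the constant in \<open>h \<le> ch * d\<close> for the height \<open>h\<close> of a point above the boundary graph.\<close>

definition ch :: real where "ch = (SOME b. 0 < b \<and> (\<forall>z. (1 + L) * norm z \<le> b * dual z))"

lemma ch: "0 < ch" "(1 + L) * norm z \<le> ch * dual z"
proof -
  obtain a where a: "0 < a" "\<And>x. a * norm x \<le> dual x" using dual_bounds by blast
  have "(1 + L) * norm z \<le> (1 + L) / a * dual z" for z
  proof -
    have "(1 + L) * norm z \<le> (1 + L) * (dual z / a)" using a(2)[of z] a(1) L by (intro mult_left_mono) (auto simp: field_simps)
    then show ?thesis by simp
  qed
  then have "\<exists>b. 0 < b \<and> (\<forall>z. (1 + L) * norm z \<le> b * dual z)"
    using a(1) L by (intro exI[of _ "(1 + L) / a"]) auto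
  from someI_ex[OF this] show "0 < ch" "(1 + L) * norm z \<le> ch * dual z" unfolding ch_def by blast+
qed

text \<open>h is the vertical height above the boundary graph, defined on the whole space. To
  compare it with d at x, take the boundary point y realising d: inside the chart it has height at
  most 0; if it lies outside, x0 is in Euclidean distance no farther from x than y and takes its
  place.\<close>

lemma chart_height:
  assumes x0: "x0 \<in> frontier \<Omega>"
  shows "\<exists>h e. norm e = 1 \<and> (\<forall>x\<in>ball x0 r0. x \<in> \<Omega> \<longleftrightarrow> 0 < h x) \<and> (\<forall>x s. h (x + s *\<^sub>R e) = h x + s) \<and>
     (\<forall>x y. \<bar>h x - h y\<bar> \<le> (1 + L) * norm (x - y)) \<and> (\<forall>x\<in>ball x0 (r0/2). h x \<le> ch * d x)"
proof -
  obtain e g where e: "norm e = 1" and g: "L-lipschitz_on UNIV g"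
    and \<Omega>: "\<Omega> \<inter> ball x0 r0 = {x \<in> ball x0 r0. (x - x0) \<bullet> e > g ((x - x0) - ((x - x0) \<bullet> e) *\<^sub>R e)}"
    using chart[OF x0] by blast
  define pr where "pr y = y - (y \<bullet> e) *\<^sub>R e" for y
  define h where "h x = (x - x0) \<bullet> e - g (pr (x - x0))" for x
  have ee: "e \<bullet> e = 1" using e by (simp add: dot_square_norm)
  have pr_norm: "norm (pr y) \<le> norm y" for y
  proof -
    have "(norm (pr y))\<^sup>2 = (norm y)\<^sup>2 - (y \<bullet> e)\<^sup>2"
      unfolding power2_norm_eq_inner pr_def
      by (simp add: inner_diff_left inner_diff_right ee inner_commute power2_eq_square)
    then have "(norm (pr y))\<^sup>2 \<le> (norm y)\<^sup>2" by simp
    then show ?thesis by (rule power2_le_imp_le) simp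
  qed
  have \<Omega>h: "x \<in> \<Omega> \<longleftrightarrow> 0 < h x" if "x \<in> ball x0 r0" for x
    using \<Omega> that by (auto simp: h_def pr_def set_eq_iff)
  have up: "h (x + s *\<^sub>R e) = h x + s" for x s
  proof -
    have "pr (x + s *\<^sub>R e - x0) = pr (x - x0)" by (simp add: pr_def inner_add_left inner_diff_left ee algebra_simps)
    then show ?thesis by (simp add: h_def inner_add_left inner_diff_left ee)
  qed
  have lip: "\<bar>h x - h y\<bar> \<le> (1 + L) * norm (x - y)" for x y
  proof -
    have "pr (x - x0) - pr (y - x0) = pr (x - y)" by (simp add: pr_def inner_diff_left algebra_simps)
    then have "\<bar>g (pr (x - x0)) - g (pr (y - x0))\<bar> \<le> L * norm (pr (x - y))"
      using lipschitz_onD[OF g, of "pr (x - x0)" "pr (y - x0)"] by (simp add: dist_norm)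
    also have "\<dots> \<le> L * norm (x - y)" using pr_norm L by (intro mult_left_mono)
    finally have 1: "\<bar>g (pr (x - x0)) - g (pr (y - x0))\<bar> \<le> L * norm (x - y)" .
    have "\<bar>(x - x0) \<bullet> e - (y - x0) \<bullet> e\<bar> = \<bar>(x - y) \<bullet> e\<bar>" by (simp add: inner_diff_left)
    also have "\<dots> \<le> norm (x - y)" using Cauchy_Schwarz_ineq2[of "x - y" e] e by simp
    finally show ?thesis using 1 unfolding h_def by (simp add: algebra_simps)
  qed
  have fr: "h y \<le> 0" if "y \<in> frontier \<Omega>" "y \<in> ball x0 r0" for y
    using \<Omega>h[OF that(2)] \<Omega>_not_frontier that(1) by force
  have "h x \<le> ch * d x" if x: "x \<in> ball x0 (r0/2)" for x
  proof -
    obtain y where y: "y \<in> frontier \<Omega>" "d x = dual (x - y)" using d_attained by blast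
    have "h x \<le> (1 + L) * norm (x - y)"
    proof (cases "y \<in> ball x0 r0")
      case True
      then show ?thesis using fr[OF y(1) True] lip[of x y] by linarith
    next
      case False
      have "norm (x - x0) \<le> norm (x - y)"
        using False x norm_triangle_ineq[of "y - x" "x - x0"] by (simp add: dist_norm norm_minus_commute)
      then have "(1 + L) * norm (x - x0) \<le> (1 + L) * norm (x - y)" using L by (intro mult_left_mono) auto
      moreover have "h x0 \<le> 0" using fr[OF x0] r0 by simp
      ultimately show ?thesis using lip[of x x0] by linarith
    qed
    then show ?thesis using ch(2)[of "x - y"] y by simp
  qed
  with e \<Omega>h up lip show ?thesis by blast
qed

text \<open>\<open>KK\<close> is the vertical speed that makes the height grow at least at unit speed along the flow
  \<open>x + s ((x - x1) / r + KK e)\<close>, and \<open>\<rho>\<close> is so small that this flow stays in the half chart for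
  \<open>0 \<le> s \<le> \<rho>\<close> when started in a ball of radius \<open>3 \<rho>\<close>.\<close>

definition KK :: real where "KK = 2 + L"
definition \<rho> :: real where "\<rho> = r0 / (4 * (5 + KK))"

lemma \<rho>: "0 < \<rho>" "\<rho> * (5 + KK) < r0 / 2" "2 \<le> KK"
proof -
  have K: "2 \<le> KK" using L by (simp add: KK_def)
  then have "\<rho> * (5 + KK) = r0 / 4" by (simp add: \<rho>_def field_simps)
  then show "\<rho> * (5 + KK) < r0 / 2" using r0 by simp
  show "2 \<le> KK" by (rule K)
  show "0 < \<rho>" using r0 K by (simp add: \<rho>_def)
qed

definition vv :: "(real^'n \<Rightarrow> real) \<Rightarrow> real^'n \<Rightarrow> real" where "vv u x = u x * d x powr (- c)"
definition gvv :: "(real^'n \<Rightarrow> real) \<Rightarrow> real^'n \<Rightarrow> real^'n" where "gvv u x = d x powr (- c) *\<^sub>R Gv u x"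

lemma vv_lipschitz: "u \<in> Cc_inf \<Omega> \<Longrightarrow> \<exists>M. M-lipschitz_on UNIV (vv u)"
proof -
  assume u: "u \<in> Cc_inf \<Omega>"
  obtain M where M: "M-lipschitz_on UNIV u" using Cc_inf_lipschitz[OF u] by blast
  note K = Cc_inf_support[OF u]
  show ?thesis unfolding vv_def[abs_def]
    by (rule lipschitz_mult_d[OF M K(1,2,3), where S="\<lambda>t. t powr (- c)" and S'="\<lambda>t. (- c) * t powr (- c - 1)"])
       (auto intro!: derivative_eq_intros continuous_intros)
qed

lemma vv_derivative:
  assumes u: "u \<in> Cc_inf \<Omega>"
  shows "AE x in lebesgue. (vv u has_derivative (\<lambda>h. gvv u x \<bullet> h)) (at x)"
  using AE_F_gd
proof eventually_elim
  case (elim x)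
  show ?case
  proof (cases "x \<in> \<Omega>")
    case True
    then have D: "(d has_derivative (\<lambda>h. gd x \<bullet> h)) (at x)" using elim by simp
    have dx: "0 < d x" by (rule d_pos[OF True])
    have "((\<lambda>t. t powr (- c)) has_real_derivative (- c) * d x powr (- c - 1)) (at (d x))"
      using dx by (auto intro!: derivative_eq_intros)
    then have "((\<lambda>x. d x powr (- c)) has_derivative (\<lambda>h. (- c) * d x powr (- c - 1) * (gd x \<bullet> h))) (at x)"
      unfolding has_field_derivative_def by (rule has_derivative_compose[OF D])
    from has_derivative_mult[OF has_derivative_grad[OF Cc_inf_differentiable[OF u]] this]
    show ?thesis unfolding vv_def[abs_def]
      by (rule has_derivative_eq_rhs)
         (use dx in \<open>auto simp: gvv_def Gv_def inner_diff_left powr_diff field_simps\<close>)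
  next
    case False
    note K = Cc_inf_support[OF u]
    have x: "x \<notin> tsupp u" using False K by auto
    have "gvv u x = 0" using K(3,4)[OF x] by (simp add: gvv_def Gv_def)
    moreover have "(vv u has_derivative (\<lambda>h. 0)) (at x)"
      by (rule grad_eq_0_outside(1)[OF compact_imp_closed[OF K(1)] _ x]) (simp add: vv_def K(3))
    ultimately show ?thesis by simp
  qed
qed

lemma Gv_measurable:
  assumes u: "u \<in> Cc_inf \<Omega>" shows "Gv u \<in> borel_measurable lebesgue" "gvv u \<in> borel_measurable lebesgue"
proof -
  note [measurable] = continuous_imp_lebesgue_measurable[OF Cc_inf_grad_continuous[OF u]]
    continuous_imp_lebesgue_measurable[OF Cc_inf_continuous[OF u]] gd_measurable continuous_imp_lebesgue_measurable[OF d_continuous]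
  show [measurable]: "Gv u \<in> borel_measurable lebesgue" unfolding Gv_def[abs_def] by measurable
  show "gvv u \<in> borel_measurable lebesgue" unfolding gvv_def[abs_def] by measurable
qed

end

section \<open>The ground state quotient in the bulk\<close>

text \<open>The flow map at time s is a dilation followed by a translation, so it pulls null sets
  back to null sets and w is differentiable at almost every image point. The Lipschitz constant of w
  dominates the difference quotients, and the derivative passes under the integral.\<close>

lemma integral_flow_derivative:
  fixes w \<sigma> :: "real^'n::finite \<Rightarrow> real" and b :: "real^'n \<Rightarrow> real^'n"
  assumes lip: "M-lipschitz_on UNIV w" and bw: "\<And>x. \<bar>w x\<bar> \<le> W"
    and der: "AE x in lebesgue. (w has_derivative (\<lambda>h. gw x \<bullet> h)) (at x)"
    and E: "E \<in> lmeasurable" and \<sigma>: "\<sigma> \<in> borel_measurable lebesgue" "\<And>x. \<bar>\<sigma> x\<bar> \<le> 1"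
    and b: "continuous_on UNIV b" "\<And>x. x \<in> E \<Longrightarrow> norm (b x) \<le> B"
    and aff: "\<And>x. x + s *\<^sub>R b x = t + l *\<^sub>R x" "0 < l"
  shows "((\<lambda>s. \<integral>x. indicator E x * (\<sigma> x * w (x + s *\<^sub>R b x)) \<partial>lebesgue) has_real_derivative
      (\<integral>x. indicator E x * (\<sigma> x * (gw (x + s *\<^sub>R b x) \<bullet> b x)) \<partial>lebesgue)) (at s)"
proof -
  define m where "m s = (\<integral>x. indicator E x * (\<sigma> x * w (x + s *\<^sub>R b x)) \<partial>lebesgue)" for s
  define D where "D = (\<integral>x. indicator E x * (\<sigma> x * (gw (x + s *\<^sub>R b x) \<bullet> b x)) \<partial>lebesgue)"
  have Em: "E \<in> sets lebesgue" using E by auto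
  have wc: "continuous_on UNIV w" using lip by (rule lipschitz_on_continuous_on)
  have M: "0 \<le> M" using lip by (rule lipschitz_on_nonneg)
  have iE: "integrable lebesgue (\<lambda>x. A * indicator E x :: real)" for A
    using E by (intro integrable_mult_right integrable_real_indicator) (auto simp: fmeasurable_def)
  have meas: "(\<lambda>x. indicator E x * (\<sigma> x * w (x + s *\<^sub>R b x))) \<in> borel_measurable lebesgue" for s
    using Em by (intro borel_measurable_times borel_measurable_indicator \<sigma>(1) continuous_imp_lebesgue_measurable
        continuous_on_compose2[OF wc] continuous_intros b) auto
  have int: "integrable lebesgue (\<lambda>x. indicator E x * (\<sigma> x * w (x + s *\<^sub>R b x)))" for s
  proof (rule Bochner_Integration.integrable_bound[OF iE[of W] meas])
    show "AE x in lebesgue. norm (indicator E x * (\<sigma> x * w (x + s *\<^sub>R b x))) \<le> norm (W * indicator E x)"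
    proof (rule always_eventually, rule allI)
      fix x
      have "\<bar>\<sigma> x\<bar> * \<bar>w (x + s *\<^sub>R b x)\<bar> \<le> 1 * W" using \<sigma>(2)[of x] bw by (intro mult_mono) auto
      then show "norm (indicator E x * (\<sigma> x * w (x + s *\<^sub>R b x))) \<le> norm (W * indicator E x)"
        by (auto simp: abs_mult indicator_def)
    qed
  qed
  have "((\<lambda>h. (m (s + h) - m s) / h) \<longlongrightarrow> D) (at 0)"
    unfolding tendsto_at_iff_sequentially
  proof (intro allI impI)
    fix X :: "nat \<Rightarrow> real" assume X: "\<forall>i. X i \<in> UNIV - {0}" "X \<longlonglongrightarrow> 0"
    then have X0: "X i \<noteq> 0" for i by auto
    define q where "q i x = indicator E x * (\<sigma> x * ((w (x + (s + X i) *\<^sub>R b x) - w (x + s *\<^sub>R b x)) / X i))" for i x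
    have q_eq: "q i x = (indicator E x * (\<sigma> x * w (x + (s + X i) *\<^sub>R b x)) - indicator E x * (\<sigma> x * w (x + s *\<^sub>R b x))) / X i" for i x
      by (simp add: q_def diff_divide_distrib algebra_simps)
    have qm: "q i \<in> borel_measurable lebesgue" for i
      unfolding q_eq[abs_def] by (intro borel_measurable_divide borel_measurable_diff meas borel_measurable_const)
    have lim: "AE x in lebesgue. (\<lambda>i. q i x) \<longlonglongrightarrow> indicator E x * (\<sigma> x * (gw (x + s *\<^sub>R b x) \<bullet> b x))"
      using AE_lebesgue_affine[OF aff(2) der, of t]
    proof eventually_elim
      case (elim x)
      then have "(w has_derivative (\<lambda>h. gw (x + s *\<^sub>R b x) \<bullet> h)) (at (x + s *\<^sub>R b x))" using aff(1)[of x] by simp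
      from difference_quotient_tendsto[OF this X(2) X0, of "b x"]
      have "(\<lambda>i. (w (x + (s + X i) *\<^sub>R b x) - w (x + s *\<^sub>R b x)) / X i) \<longlonglongrightarrow> gw (x + s *\<^sub>R b x) \<bullet> b x"
        by (simp add: scaleR_add_left add.assoc)
      then show ?case unfolding q_def by (intro tendsto_intros)
    qed
    have bound: "AE x in lebesgue. norm (q i x) \<le> (M * B) * indicator E x" for i
    proof (rule always_eventually, rule allI)
      fix x
      show "norm (q i x) \<le> (M * B) * indicator E x"
      proof (cases "x \<in> E")
        case True
        have "\<bar>w (x + (s + X i) *\<^sub>R b x) - w (x + s *\<^sub>R b x)\<bar> \<le> M * (\<bar>X i\<bar> * norm (b x))"
          using lipschitz_onD[OF lip, of "x + (s + X i) *\<^sub>R b x" "x + s *\<^sub>R b x"] by (simp add: dist_norm scaleR_add_left)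
        also have "\<dots> \<le> M * (\<bar>X i\<bar> * B)" using b(2)[OF True] M by (intro mult_left_mono) auto
        finally have "\<bar>w (x + (s + X i) *\<^sub>R b x) - w (x + s *\<^sub>R b x)\<bar> / \<bar>X i\<bar> \<le> M * B"
          using X0[of i] by (simp add: divide_simps mult_ac)
        then have "\<bar>\<sigma> x\<bar> * (\<bar>w (x + (s + X i) *\<^sub>R b x) - w (x + s *\<^sub>R b x)\<bar> / \<bar>X i\<bar>) \<le> 1 * (M * B)"
          using \<sigma>(2)[of x] by (intro mult_mono) auto
        then show ?thesis using True by (simp add: q_def abs_mult)
      qed (simp add: q_def)
    qed
    have fm: "(\<lambda>x. indicator E x * (\<sigma> x * (gw (x + s *\<^sub>R b x) \<bullet> b x))) \<in> borel_measurable lebesgue"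
      by (rule lebesgue_measurable_AE_limit[OF qm lim])
    have "(\<lambda>i. \<integral>x. q i x \<partial>lebesgue) \<longlonglongrightarrow> D"
      unfolding D_def by (rule integral_dominated_convergence[OF fm qm iE lim bound])
    moreover have "(\<integral>x. q i x \<partial>lebesgue) = (m (s + X i) - m s) / X i" for i
      unfolding q_eq m_def using int by simp
    ultimately show "((\<lambda>h. (m (s + h) - m s) / h) \<circ> X) \<longlonglongrightarrow> D" by (simp add: o_def)
  qed
  then show ?thesis unfolding DERIV_def m_def D_def .
qed

text \<open>Substituting \<open>t = (s / r) powr (1 / p)\<close> turns \<open>s powr (1 / p - 1) ds\<close> into a multiple of \<open>dt\<close>
  and the decay factor into at most \<open>4 / (1 + t)\<^sup>2\<close>, the derivative of \<open>4 t / (1 + t)\<close>.\<close>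

lemma flow_majorant_derivative:
  fixes p r s :: real
  assumes p: "2 \<le> p" and r: "0 < r" and s: "0 < s"
  defines "\<beta> \<equiv> \<lambda>s. 4 * p * (s / r) powr (1/p) / (1 + (s / r) powr (1/p))"
  shows "\<exists>D. (\<beta> has_real_derivative D) (at s) \<and> r powr (- 1/p) * s powr (1/p - 1) * (1 + s / r) powr (- 2/p) \<le> D"
proof -
  define t where "t = (s / r) powr (1/p)"
  have t: "0 < t" using r s by (simp add: t_def)
  have t': "((\<lambda>s. (s / r) powr (1/p)) has_real_derivative (1/p * s powr (1/p - 1) * r powr (- 1/p))) (at s)"
  proof -
    have "((\<lambda>s. (s / r) powr (1/p)) has_real_derivative ((1/p) * (s / r) powr (1/p - 1) * (1 / r))) (at s)"
      using r s by (auto intro!: derivative_eq_intros)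
    moreover have "(s / r) powr (1/p - 1) * (1 / r) = s powr (1/p - 1) * r powr (- 1/p)"
      using r s by (simp add: powr_divide powr_diff powr_minus field_simps)
    ultimately show ?thesis by (simp only: mult.assoc)
  qed
  have "((\<lambda>y. 4 * p * y / (1 + y)) has_real_derivative (4 * p / (1 + t)\<^sup>2)) (at t)"
    using t by (auto intro!: derivative_eq_intros simp: field_simps power2_eq_square)
  from DERIV_chain2[OF this[unfolded t_def] t']
  have D: "(\<beta> has_real_derivative (4 * p / (1 + t)\<^sup>2 * (1/p * s powr (1/p - 1) * r powr (- 1/p)))) (at s)"
    unfolding \<beta>_def t_def .
  define z where "z = (1 + s / r) powr (1/p)"
  have z: "1 \<le> z" "t \<le> z" unfolding z_def t_def using r s p by (auto intro!: ge_one_powr_ge_zero powr_mono2)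
  have "(1 + t)\<^sup>2 \<le> (2 * z)\<^sup>2" using z t by (intro power_mono) auto
  then have "1 / z\<^sup>2 \<le> 4 / (1 + t)\<^sup>2" using z t by (simp add: divide_simps power2_eq_square)
  moreover have "(1 + s / r) powr (- 2/p) = 1 / z\<^sup>2"
  proof -
    have "z\<^sup>2 = (1 + s / r) powr (2/p)" using r s z by (simp add: z_def powr_powr flip: powr_numeral)
    then show ?thesis by (simp add: powr_minus divide_inverse)
  qed
  ultimately have "(1 + s / r) powr (- 2/p) \<le> 4 / (1 + t)\<^sup>2" by simp
  then have "(s powr (1/p - 1) * r powr (- 1/p)) * (1 + s / r) powr (- 2/p) \<le> (s powr (1/p - 1) * r powr (- 1/p)) * (4 / (1 + t)\<^sup>2)"
    by (intro mult_left_mono) auto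
  also have "\<dots> = 4 * p / (1 + t)\<^sup>2 * (1/p * s powr (1/p - 1) * r powr (- 1/p))" using p by simp
  finally show ?thesis using D by (intro exI conjI) (assumption, simp add: mult_ac)
qed


context lipschitz_superharmonic_domain
begin

definition V1 :: real where "V1 = measure lebesgue (ball (0::real^'n) 1)"

lemma V1: "0 < V1" unfolding V1_def using content_ball_pos[of 1 "0::real^'n"] by (simp add: measure_completion)

lemma ball_part:
  assumes r: "0 < r"
  shows "\<Omega> \<inter> ball x r \<in> lmeasurable" "measure lebesgue (\<Omega> \<inter> ball x r) \<le> V1 * r powr n"
    "(V1 * r powr n) powr (1 - 1/p) = V1 powr (1 - 1/p) * r powr (n - n/p)"
proof -
  show 1: "\<Omega> \<inter> ball x r \<in> lmeasurable"
    using open_\<Omega> by (intro lmeasurable_open) (auto intro: bounded_subset[OF bounded_ball])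
  have "measure lebesgue (\<Omega> \<inter> ball x r) \<le> measure lebesgue (ball x r)"
    using 1 by (intro measure_mono_fmeasurable) auto
  then show "measure lebesgue (\<Omega> \<inter> ball x r) \<le> V1 * r powr n"
    using measure_ball_scaling[OF r, of x] by (simp add: V1_def n)
  show "(V1 * r powr n) powr (1 - 1/p) = V1 powr (1 - 1/p) * r powr (n - n/p)"
    using r V1 by (simp add: powr_mult powr_powr algebra_simps)
qed

lemma vv_bounded: "u \<in> Cc_inf \<Omega> \<Longrightarrow> \<exists>W. \<forall>x. \<bar>vv u x\<bar> \<le> W"
proof -
  assume u: "u \<in> Cc_inf \<Omega>"
  note K = Cc_inf_support[OF u]
  obtain M where "M-lipschitz_on UNIV (vv u)" using vv_lipschitz[OF u] by blast
  then have "continuous_on (tsupp u) (vv u)" using lipschitz_on_continuous_on continuous_on_subset by blast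
  then have "bounded (vv u ` tsupp u)" using compact_continuous_image K(1) compact_imp_bounded by blast
  then obtain W where W: "0 < W" "\<And>x. x \<in> tsupp u \<Longrightarrow> \<bar>vv u x\<bar> \<le> W" unfolding bounded_pos by auto
  have "\<bar>vv u x\<bar> \<le> W" for x using W K(3)[of x] by (cases "x \<in> tsupp u") (auto simp: vv_def)
  then show ?thesis by blast
qed

text \<open>The first summand collects the change along the flow, 4 p being the bound for the
  majorant \<beta>. The second is the transported integral at time \<rho>, when all heights are at
  least \<rho>.\<close>

definition C_bulk :: real where
  "C_bulk = 2 * V1 powr (1 - 1/p) * (4 * p * (KK + 1) * ch powr c + (\<rho> / ch) powr (- c) * \<rho> powr (- 1/p))"

lemma C_bulk_pos: "0 < C_bulk"
  unfolding C_bulk_def using V1 p \<rho> ch by (intro mult_pos_pos add_pos_pos) auto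

lemma bulk_estimate:
  assumes u: "u \<in> Cc_inf \<Omega>" and x0: "x0 \<in> frontier \<Omega>" and x1: "dist x1 x0 \<le> \<rho>" and r: "0 < r" "r \<le> 3 * \<rho>"
    and N: "0 < N" and iG: "integrable lebesgue (\<lambda>x. norm (Gv u x) powr p)"
    and G: "(\<integral>x. norm (Gv u x) powr p \<partial>lebesgue) \<le> N powr p"
    and U: "(\<integral>x. \<bar>u x\<bar> powr p \<partial>lebesgue) \<le> N powr p"
  shows "(\<integral>x. indicator (\<Omega> \<inter> ball x1 r) x * \<bar>vv u x\<bar> \<partial>lebesgue) \<le> C_bulk * N * r powr (n - n/p + 1/p)"
proof -
  obtain h e where e: "norm e = 1" and h\<Omega>: "\<And>x. x \<in> ball x0 r0 \<Longrightarrow> x \<in> \<Omega> \<longleftrightarrow> 0 < h x" and hup: "\<And>x s. h (x + s *\<^sub>R e) = h x + s"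
    and hlip: "\<And>x y. \<bar>h x - h y\<bar> \<le> (1 + L) * norm (x - y)" and hd: "\<And>x. x \<in> ball x0 (r0/2) \<Longrightarrow> h x \<le> ch * d x"
    using chart_height[OF x0] by blast
  define E where "E = \<Omega> \<inter> ball x1 r"
  define V where "V = V1 * r powr n"
  have E: "E \<in> lmeasurable" "measure lebesgue E \<le> V" unfolding E_def V_def using ball_part[OF r(1)] by auto
  have V: "0 < V" using V1 r by (simp add: V_def)
  have p1: "1 < p" using p by simp
  \<comment> \<open>Dilation about x1, of speed at most 1 on the ball, plus a vertical drift. The
    velocity depends on the starting point only, so the flow map is affine.\<close>
  define b where "b x = (1/r) *\<^sub>R (x - x1) + KK *\<^sub>R e" for x
  define t where "t s = (s * KK) *\<^sub>R e - (s / r) *\<^sub>R x1" for s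
  have aff: "x + s *\<^sub>R b x = t s + (1 + s / r) *\<^sub>R x" for x s
    by (simp add: b_def t_def algebra_simps)
  have bc: "continuous_on UNIV b" unfolding b_def by (intro continuous_intros)
  have b1: "norm ((1/r) *\<^sub>R (x - x1)) \<le> 1" if "x \<in> E" for x
    using that r by (auto simp: E_def dist_norm norm_minus_commute)
  have bn: "norm (b x) \<le> KK + 1" if "x \<in> E" for x
    using norm_triangle_ineq[of "(1/r) *\<^sub>R (x - x1)" "KK *\<^sub>R e"] b1[OF that] e \<rho>(3) by (simp add: b_def)
  \<comment> \<open>The dilation lowers the height by at most (1 + L) s and the drift raises it by
    (2 + L) s, so at time s the height is at least s. The point is still in the half chart, where
    the height bounds d from below.\<close>
  have d_low: "s / ch \<le> d (x + s *\<^sub>R b x)" if x: "x \<in> E" and s: "0 \<le> s" "s \<le> \<rho>" for x s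
  proof -
    have "norm (x + s *\<^sub>R b x - x0) \<le> norm (x - x1) + norm (x1 - x0) + norm (s *\<^sub>R b x)"
      using norm_triangle_ineq[of "x - x1 + (x1 - x0)" "s *\<^sub>R b x"] norm_triangle_ineq[of "x - x1" "x1 - x0"]
      by (simp add: algebra_simps)
    moreover have "norm (x - x1) \<le> 3 * \<rho>" "norm (x1 - x0) \<le> \<rho>"
      using x x1 r by (auto simp: E_def dist_norm norm_minus_commute)
    moreover have "norm (s *\<^sub>R b x) \<le> \<rho> * (KK + 1)"
      using mult_mono[of s \<rho> "norm (b x)" "KK + 1"] bn[OF x] s \<rho> by simp
    ultimately have "norm (x + s *\<^sub>R b x - x0) \<le> \<rho> * (5 + KK)" by (simp add: algebra_simps)
    then have inb: "x + s *\<^sub>R b x \<in> ball x0 (r0/2)" using \<rho>(2) by (simp add: dist_norm norm_minus_commute)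
    have "norm (x - x0) \<le> 4 * \<rho>"
      using norm_triangle_ineq[of "x - x1" "x1 - x0"] \<open>norm (x - x1) \<le> 3 * \<rho>\<close> \<open>norm (x1 - x0) \<le> \<rho>\<close> by simp
    moreover have "4 * \<rho> \<le> \<rho> * (5 + KK)" using \<rho> by (simp add: algebra_simps)
    ultimately have "x \<in> ball x0 r0" using \<rho>(2) r0 by (simp add: dist_norm norm_minus_commute)
    then have hx: "0 < h x" using h\<Omega> x by (auto simp: E_def)
    define y where "y = x + s *\<^sub>R ((1/r) *\<^sub>R (x - x1))"
    have "h (x + s *\<^sub>R b x) = h (y + (s * KK) *\<^sub>R e)" by (simp add: y_def b_def scaleR_add_right add.assoc)
    also have "\<dots> = h y + s * KK" by (rule hup)
    finally have hy: "h (x + s *\<^sub>R b x) = h y + s * KK" .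
    have "norm (y - x) \<le> s" using mult_left_mono[OF b1[OF x] s(1)] s by (simp add: y_def)
    then have "(1 + L) * norm (y - x) \<le> (1 + L) * s" using L by (intro mult_left_mono) auto
    then have "h x - (1 + L) * s \<le> h y" using hlip[of y x] by linarith
    then have "s \<le> h (x + s *\<^sub>R b x)" unfolding hy using hx by (simp add: KK_def algebra_simps)
    also have "\<dots> \<le> ch * d (x + s *\<^sub>R b x)" by (rule hd[OF inb])
    finally show ?thesis using ch(1) by (simp add: divide_simps mult.commute)
  qed
  have dpow: "d (x + s *\<^sub>R b x) powr (- c) \<le> (s / ch) powr (- c)" if "x \<in> E" "0 < s" "s \<le> \<rho>" for x s
    using d_low[of x s] that ch c_bounds by (intro powr_mono2') auto
  \<comment> \<open>The change of variables divides the integral of the p-th power by (1 + s/r)^n.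
    This decay is what dilation gains over translation.\<close>
  have hol: "integrable lebesgue (\<lambda>x. indicator E x * f (x + s *\<^sub>R b x))"
    "(\<integral>x. indicator E x * f (x + s *\<^sub>R b x) \<partial>lebesgue) \<le> 2 * (N * (1 + s / r) powr (- n/p)) * V powr (1 - 1/p)"
    if f: "f \<in> borel_measurable lebesgue" "\<And>x. 0 \<le> f x" "integrable lebesgue (\<lambda>x. f x powr p)" "(\<integral>x. f x powr p \<partial>lebesgue) \<le> N powr p"
      and s: "0 \<le> s" for f s
  proof -
    have l: "0 < 1 + s / r" using s r by (simp add: add_pos_nonneg)
    have ip: "integrable lebesgue (\<lambda>x. f (x + s *\<^sub>R b x) powr p)"
      unfolding aff by (rule lebesgue_integral_affine(1)[OF l f(3)])
    have "(\<integral>x. f (x + s *\<^sub>R b x) powr p \<partial>lebesgue) = (\<integral>x. f x powr p \<partial>lebesgue) / (1 + s / r) ^ DIM(real^'n)"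
      unfolding aff by (rule lebesgue_integral_affine(2)[OF l f(3)])
    also have "\<dots> \<le> N powr p / (1 + s / r) ^ CARD('n)" using f(4) l by (simp add: divide_right_mono)
    also have "\<dots> = (N * (1 + s / r) powr (- n/p)) powr p"
    proof -
      have "((1 + s / r) powr (- n/p)) powr p = (1 + s / r) powr (- n)" using p by (simp add: powr_powr)
      also have "\<dots> = 1 / (1 + s / r) ^ CARD('n)" using l unfolding n powr_minus by (simp add: powr_realpow divide_inverse)
      finally show ?thesis using N by (simp add: powr_mult)
    qed
    finally have le: "(\<integral>x. f (x + s *\<^sub>R b x) powr p \<partial>lebesgue) \<le> (N * (1 + s / r) powr (- n/p)) powr p" .
    have fm: "(\<lambda>x. f (x + s *\<^sub>R b x)) \<in> borel_measurable lebesgue"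
      unfolding aff using measurable_compose[OF lebesgue_affine_eq(2)[OF l] f(1)] by simp
    have N': "0 < N * (1 + s / r) powr (- n/p)" using N l by simp
    show "integrable lebesgue (\<lambda>x. indicator E x * f (x + s *\<^sub>R b x))"
      "(\<integral>x. indicator E x * f (x + s *\<^sub>R b x) \<partial>lebesgue) \<le> 2 * (N * (1 + s / r) powr (- n/p)) * V powr (1 - 1/p)"
      using holder_set[OF p1 fm _ ip le N' E V] f(2) by auto
  qed
  obtain M where lip: "M-lipschitz_on UNIV (vv u)" using vv_lipschitz[OF u] by blast
  obtain W where W: "\<And>x. \<bar>vv u x\<bar> \<le> W" using vv_bounded[OF u] by blast
  have vm: "vv u \<in> borel_measurable lebesgue"
    by (intro continuous_imp_lebesgue_measurable lipschitz_on_continuous_on[OF lip])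
  (* The sign is frozen at the starting point of the flow, so that no derivative of |v| is needed. *)
  define \<sigma> where "\<sigma> x = sgn (vv u x)" for x
  have \<sigma>: "\<sigma> \<in> borel_measurable lebesgue" "\<And>x. \<bar>\<sigma> x\<bar> \<le> 1"
    unfolding \<sigma>_def using vm by (auto simp: abs_sgn_eq)
  define m where "m s = (\<integral>x. indicator E x * (\<sigma> x * vv u (x + s *\<^sub>R b x)) \<partial>lebesgue)" for s
  define m' where "m' s = (\<integral>x. indicator E x * (\<sigma> x * (gvv u (x + s *\<^sub>R b x) \<bullet> b x)) \<partial>lebesgue)" for s
  have mD: "(m has_real_derivative m' s) (at s)" if "0 \<le> s" for s
  proof -
    have "0 < 1 + s / r" using that r by (simp add: add_pos_nonneg)
    then show ?thesis unfolding m_def[abs_def] m'_def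
      by (intro integral_flow_derivative[OF lip W vv_derivative[OF u] E(1) \<sigma> bc bn, where t="t s" and l="1 + s / r"] aff)
  qed
  define A where "A = 2 * N * V powr (1 - 1/p) * ((KK + 1) * ch powr c)"
  have A: "0 < A" using N V \<rho> ch by (simp add: A_def)
  have Gm: "(\<lambda>x. norm (Gv u x)) \<in> borel_measurable lebesgue" using Gv_measurable[OF u] by simp
  have m'_bound: "\<bar>m' s\<bar> \<le> A * (s powr (1/p - 1) * (1 + s / r) powr (- 2/p))" if s: "0 < s" "s \<le> \<rho>" for s
  proof -
    note hg = hol[OF Gm norm_ge_zero iG G less_imp_le[OF s(1)]]
    define k where "k = (s / ch) powr (- c) * (KK + 1)"
    have k: "0 \<le> k" using \<rho> by (simp add: k_def)
    have "\<bar>m' s\<bar> \<le> (\<integral>x. k * (indicator E x * norm (Gv u (x + s *\<^sub>R b x))) \<partial>lebesgue)"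
      unfolding m'_def
    proof (rule integral_abs_bound_integral)
      show i2: "integrable lebesgue (\<lambda>x. k * (indicator E x * norm (Gv u (x + s *\<^sub>R b x))))"
        by (intro integrable_mult_right hg)
      have pt: "\<bar>indicator E x * (\<sigma> x * (gvv u (x + s *\<^sub>R b x) \<bullet> b x))\<bar> \<le> k * (indicator E x * norm (Gv u (x + s *\<^sub>R b x)))" for x
      proof (cases "x \<in> E")
        case True
        have "\<bar>gvv u (x + s *\<^sub>R b x) \<bullet> b x\<bar> \<le> norm (gvv u (x + s *\<^sub>R b x)) * norm (b x)" by (rule Cauchy_Schwarz_ineq2)
        also have "\<dots> = d (x + s *\<^sub>R b x) powr (- c) * norm (b x) * norm (Gv u (x + s *\<^sub>R b x))" by (simp add: gvv_def)
        also have "\<dots> \<le> k * norm (Gv u (x + s *\<^sub>R b x))" unfolding k_def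
          using dpow[OF True s] bn[OF True] \<rho> by (intro mult_right_mono mult_mono) auto
        finally have 1: "\<bar>gvv u (x + s *\<^sub>R b x) \<bullet> b x\<bar> \<le> k * norm (Gv u (x + s *\<^sub>R b x))" .
        have "\<bar>\<sigma> x\<bar> * \<bar>gvv u (x + s *\<^sub>R b x) \<bullet> b x\<bar> \<le> 1 * (k * norm (Gv u (x + s *\<^sub>R b x)))"
          using 1 \<sigma>(2)[of x] by (intro mult_mono) auto
        then show ?thesis using True by (simp add: abs_mult)
      qed simp
      then show "\<bar>indicator E x * (\<sigma> x * (gvv u (x + s *\<^sub>R b x) \<bullet> b x))\<bar> \<le> k * (indicator E x * norm (Gv u (x + s *\<^sub>R b x)))" for x .
      have l: "0 < 1 + s / r" using s r by (simp add: add_pos_pos)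
      have gm: "(\<lambda>x. gvv u (x + s *\<^sub>R b x)) \<in> borel_measurable lebesgue"
        unfolding aff using measurable_compose[OF lebesgue_affine_eq(2)[OF l] Gv_measurable(2)[OF u]] by simp
      have Em: "E \<in> sets lebesgue" using E by auto
      have "(\<lambda>x. indicator E x * (\<sigma> x * (gvv u (x + s *\<^sub>R b x) \<bullet> b x))) \<in> borel_measurable lebesgue"
        using Em by (intro borel_measurable_times borel_measurable_indicator \<sigma>(1) borel_measurable_inner gm continuous_imp_lebesgue_measurable bc)
      then show "integrable lebesgue (\<lambda>x. indicator E x * (\<sigma> x * (gvv u (x + s *\<^sub>R b x) \<bullet> b x)))"
        by (rule Bochner_Integration.integrable_bound[OF i2])
           (use pt in \<open>auto intro!: always_eventually order_trans[OF _ abs_ge_self]\<close>)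
    qed
    also have "\<dots> = k * (\<integral>x. indicator E x * norm (Gv u (x + s *\<^sub>R b x)) \<partial>lebesgue)" by simp
    also have "\<dots> \<le> k * (2 * (N * (1 + s / r) powr (- n/p)) * V powr (1 - 1/p))" by (intro mult_left_mono hg k)
    also have "\<dots> = A * (s powr (1/p - 1) * (1 + s / r) powr (- n/p))"
    proof -
      have "(s / ch) powr (- c) = s powr (- c) * ch powr c" using s ch(1) by (simp add: powr_divide powr_minus_divide)
      moreover have "- c = 1/p - 1" using c_bounds(4) by simp
      ultimately have "(s / ch) powr (- c) = s powr (1/p - 1) * ch powr c" by simp
      then show ?thesis unfolding k_def A_def by (simp only: mult_ac)
    qed
    \<comment> \<open>Here n \<ge> 2 enters: the bound decays like s powr (-1 - 1/p) and has an
      integrable tail.\<close>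
    also have "\<dots> \<le> A * (s powr (1/p - 1) * (1 + s / r) powr (- 2/p))"
    proof -
      have "(1 + s / r) powr (- n/p) \<le> (1 + s / r) powr (- 2/p)"
        using s r p n2 by (intro powr_mono) (auto simp: divide_simps)
      then show ?thesis using A by (intro mult_left_mono) auto
    qed
    finally show ?thesis .
  qed
  define \<beta> where "\<beta> s = 4 * p * (s / r) powr (1/p) / (1 + (s / r) powr (1/p))" for s
  define A' where "A' = A * r powr (1/p)"
  have A': "0 < A'" using A r by (simp add: A'_def)
  \<comment> \<open>The fundamental theorem in monotone form: m + A' \<beta> is nondecreasing.
    Derivatives are needed on the open interval only, which matters because that of \<beta> blows up
    at 0.\<close>
  have "m 0 + A' * \<beta> 0 \<le> m \<rho> + A' * \<beta> \<rho>"
  proof (rule DERIV_nonneg_imp_increasing_open[of 0 \<rho> "\<lambda>s. m s + A' * \<beta> s"])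
    show "0 \<le> \<rho>" using \<rho> by simp
    fix s assume s: "0 < s" "s < \<rho>"
    obtain D where D: "(\<beta> has_real_derivative D) (at s)" "r powr (- 1/p) * s powr (1/p - 1) * (1 + s / r) powr (- 2/p) \<le> D"
      using flow_majorant_derivative[OF p r(1) s(1)] unfolding \<beta>_def by blast
    have "\<bar>m' s\<bar> \<le> A' * D"
    proof -
      have "A' * (r powr (- 1/p) * s powr (1/p - 1) * (1 + s / r) powr (- 2/p)) \<le> A' * D" using D(2) A' by (intro mult_left_mono) auto
      moreover have "A' * (r powr (- 1/p) * s powr (1/p - 1) * (1 + s / r) powr (- 2/p)) = A * (s powr (1/p - 1) * (1 + s / r) powr (- 2/p))"
        using r by (simp add: A'_def powr_minus field_simps)
      ultimately show ?thesis using m'_bound[of s] s by linarith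
    qed
    then show "\<exists>y. ((\<lambda>s. m s + A' * \<beta> s) has_real_derivative y) (at s) \<and> 0 \<le> y"
      using s by (intro exI[of _ "m' s + A' * D"] conjI DERIV_add mD DERIV_cmult D) auto
  next
    have "continuous_on {0..\<rho>} \<beta>" unfolding \<beta>_def using r p
      by (intro continuous_intros continuous_on_powr') (auto simp: add_nonneg_eq_0_iff)
    moreover have "continuous_on {0..\<rho>} m"
      using mD by (intro continuous_at_imp_continuous_on ballI DERIV_isCont) auto
    ultimately show "continuous_on {0..\<rho>} (\<lambda>s. m s + A' * \<beta> s)" by (intro continuous_intros)
  qed
  moreover have "\<beta> 0 = 0" by (simp add: \<beta>_def)
  moreover have "\<beta> \<rho> \<le> 4 * p"
  proof -
    define y where "y = (\<rho> / r) powr (1/p)"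
    have "0 \<le> y" by (simp add: y_def)
    then have "y / (1 + y) \<le> 1" by simp
    then have "4 * p * (y / (1 + y)) \<le> 4 * p * 1" using p by (intro mult_left_mono) auto
    then show ?thesis by (simp add: \<beta>_def y_def)
  qed
  then have "A' * \<beta> \<rho> \<le> A' * (4 * p)" using A' by (intro mult_left_mono) auto
  ultimately have m0: "m 0 \<le> m \<rho> + A' * (4 * p)" by simp
  have "m 0 = (\<integral>x. indicator E x * \<bar>vv u x\<bar> \<partial>lebesgue)"
    unfolding m_def \<sigma>_def by (simp add: abs_sgn mult.commute[of "sgn _"])
  moreover have "m \<rho> \<le> 2 * N * V powr (1 - 1/p) * ((\<rho> / ch) powr (- c) * \<rho> powr (- 1/p)) * r powr (1/p)"
  proof -
    have um: "(\<lambda>x. \<bar>u x\<bar>) \<in> borel_measurable lebesgue"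
      by (intro continuous_imp_lebesgue_measurable continuous_intros Cc_inf_continuous[OF u])
    have iu: "integrable lebesgue (\<lambda>x. \<bar>u x\<bar> powr p)"
      using p by (intro integrable_continuous_support[OF _ Cc_inf_support(1)[OF u]] continuous_on_powr' continuous_intros Cc_inf_continuous[OF u])
        (auto simp: Cc_inf_support(3)[OF u])
    have \<rho>0: "0 \<le> \<rho>" using \<rho> by simp
    note hu = hol[OF um abs_ge_zero iu U \<rho>0]
    define k where "k = (\<rho> / ch) powr (- c)"
    have k: "0 \<le> k" by (simp add: k_def)
    have ml: "m \<rho> \<le> \<bar>m \<rho>\<bar>" by simp
    also have "\<dots> \<le> (\<integral>x. k * (indicator E x * \<bar>u (x + \<rho> *\<^sub>R b x)\<bar>) \<partial>lebesgue)"
      unfolding m_def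
    proof (rule integral_abs_bound_integral)
      show i2: "integrable lebesgue (\<lambda>x. k * (indicator E x * \<bar>u (x + \<rho> *\<^sub>R b x)\<bar>))" by (intro integrable_mult_right hu)
      have pt: "\<bar>indicator E x * (\<sigma> x * vv u (x + \<rho> *\<^sub>R b x))\<bar> \<le> k * (indicator E x * \<bar>u (x + \<rho> *\<^sub>R b x)\<bar>)" for x
      proof (cases "x \<in> E")
        case True
        have "\<bar>vv u (x + \<rho> *\<^sub>R b x)\<bar> = d (x + \<rho> *\<^sub>R b x) powr (- c) * \<bar>u (x + \<rho> *\<^sub>R b x)\<bar>" by (simp add: vv_def abs_mult)
        also have "\<dots> \<le> k * \<bar>u (x + \<rho> *\<^sub>R b x)\<bar>" unfolding k_def using dpow[OF True] \<rho> by (intro mult_right_mono) auto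
        finally have 1: "\<bar>vv u (x + \<rho> *\<^sub>R b x)\<bar> \<le> k * \<bar>u (x + \<rho> *\<^sub>R b x)\<bar>" .
        have "\<bar>\<sigma> x\<bar> * \<bar>vv u (x + \<rho> *\<^sub>R b x)\<bar> \<le> 1 * (k * \<bar>u (x + \<rho> *\<^sub>R b x)\<bar>)"
          using 1 \<sigma>(2)[of x] by (intro mult_mono) auto
        then show ?thesis using True by (simp add: abs_mult)
      qed simp
      then show "\<bar>indicator E x * (\<sigma> x * vv u (x + \<rho> *\<^sub>R b x))\<bar> \<le> k * (indicator E x * \<bar>u (x + \<rho> *\<^sub>R b x)\<bar>)" for x .
      have Em: "E \<in> sets lebesgue" using E by auto
      have "(\<lambda>x. indicator E x * (\<sigma> x * vv u (x + \<rho> *\<^sub>R b x))) \<in> borel_measurable lebesgue"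
        using Em by (intro borel_measurable_times borel_measurable_indicator \<sigma>(1) continuous_imp_lebesgue_measurable
          continuous_on_compose2[OF lipschitz_on_continuous_on[OF lip]] continuous_intros bc) auto
      then show "integrable lebesgue (\<lambda>x. indicator E x * (\<sigma> x * vv u (x + \<rho> *\<^sub>R b x)))"
        by (rule Bochner_Integration.integrable_bound[OF i2])
           (use pt in \<open>auto intro!: always_eventually order_trans[OF _ abs_ge_self]\<close>)
    qed
    also have "\<dots> = k * (\<integral>x. indicator E x * \<bar>u (x + \<rho> *\<^sub>R b x)\<bar> \<partial>lebesgue)" by simp
    also have "\<dots> \<le> k * (2 * (N * (1 + \<rho> / r) powr (- n/p)) * V powr (1 - 1/p))" by (intro mult_left_mono hu k)
    also have "\<dots> \<le> k * (2 * (N * (\<rho> powr (- 1/p) * r powr (1/p))) * V powr (1 - 1/p))"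
    proof -
      \<comment> \<open>Of the exponent n/p only 1/p is kept, which produces exactly the required
        factor r powr (1/p).\<close>
      have "(1 + \<rho> / r) powr (- n/p) \<le> (1 + \<rho> / r) powr (- 1/p)"
        using \<rho> r p n2 by (intro powr_mono) (auto simp: divide_simps)
      also have "\<dots> \<le> (\<rho> / r) powr (- 1/p)" using \<rho> r p by (intro powr_mono2') auto
      also have "\<dots> = \<rho> powr (- 1/p) * r powr (1/p)" using \<rho>(1) r by (simp add: powr_divide powr_minus_divide)
      finally show ?thesis using k N by (intro mult_left_mono mult_right_mono) auto
    qed
    also have "\<dots> = 2 * N * V powr (1 - 1/p) * (k * \<rho> powr (- 1/p)) * r powr (1/p)" by (simp only: mult_ac)
    finally show ?thesis unfolding k_def .
  qed
  ultimately have "(\<integral>x. indicator E x * \<bar>vv u x\<bar> \<partial>lebesgue)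
     \<le> 2 * N * V powr (1 - 1/p) * ((\<rho> / ch) powr (- c) * \<rho> powr (- 1/p)) * r powr (1/p) + A' * (4 * p)" using m0 by linarith
  also have "\<dots> = 2 * N * V powr (1 - 1/p) * (4 * p * (KK + 1) * ch powr c + (\<rho> / ch) powr (- c) * \<rho> powr (- 1/p)) * r powr (1/p)"
    unfolding A'_def A_def by (simp add: algebra_simps)
  also have "\<dots> = C_bulk * N * r powr (n - n/p + 1/p)"
    unfolding V_def ball_part(3)[OF r(1)] C_bulk_def powr_add by (simp only: mult_ac)
  finally show ?thesis unfolding E_def .
qed

end

section \<open>The boundary layer and the Morrey estimate\<close>

text \<open>Concavity of the power c, derived from the tangent inequality for the inverse power 1/c;
  in this form \<delta> = h is included.\<close>

lemma powr_concave_tangent: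
  fixes c h \<delta> :: real
  assumes c: "0 < c" "c < 1" and h: "0 < h" and \<delta>: "0 \<le> \<delta>" "\<delta> \<le> h"
  shows "\<delta> * (c * h powr (c - 1)) \<le> h powr c - (h - \<delta>) powr c"
proof -
  have q: "1 \<le> 1 / c" using c by simp
  have "(h powr c) powr (1/c) + 1/c * (h powr c) powr (1/c - 1) * ((h - \<delta>) powr c - h powr c) \<le> ((h - \<delta>) powr c) powr (1/c)"
    by (rule powr_ge_tangent[OF q]) (use h in auto)
  moreover have "(h powr c) powr (1/c) = h" "((h - \<delta>) powr c) powr (1/c) = h - \<delta>"
    using c h \<delta> by (auto simp: powr_powr)
  moreover have "(h powr c) powr (1/c - 1) = h powr (1 - c)" using c by (simp add: powr_powr right_diff_distrib)
  ultimately have "\<delta> \<le> 1/c * h powr (1 - c) * (h powr c - (h - \<delta>) powr c)" by (simp add: algebra_simps)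
  then have "(c * h powr (c - 1)) * \<delta> \<le> (c * h powr (c - 1)) * (1/c * h powr (1 - c) * (h powr c - (h - \<delta>) powr c))"
    using c by (intro mult_left_mono) auto
  also have "\<dots> = (h powr (c - 1) * h powr (1 - c)) * (h powr c - (h - \<delta>) powr c)" using c by simp
  also have "h powr (c - 1) * h powr (1 - c) = 1" using h by (simp flip: powr_add)
  finally show ?thesis by (simp add: mult_ac)
qed

context lipschitz_superharmonic_domain
begin

lemma vv_continuous: "u \<in> Cc_inf \<Omega> \<Longrightarrow> continuous_on UNIV (vv u)"
  using vv_lipschitz lipschitz_on_continuous_on by blast

lemma vv_support: "u \<in> Cc_inf \<Omega> \<Longrightarrow> x \<notin> tsupp u \<Longrightarrow> vv u x = 0"
  using Cc_inf_support(3)[of u \<Omega> x] by (simp add: vv_def)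

lemma ud_integrable:
  assumes u: "u \<in> Cc_inf \<Omega>" shows "integrable lebesgue (\<lambda>x. \<bar>u x\<bar> / d x)"
proof -
  note K = Cc_inf_support[OF u]
  have "continuous_on UNIV (\<lambda>x. \<bar>u x\<bar> * (1 / d x))"
    by (intro continuous_mult_d[OF _ K(1,2), where V="\<lambda>t. 1 / t"] continuous_intros Cc_inf_continuous[OF u])
      (auto simp: K(3) dest: d_pos)
  then show ?thesis by (intro integrable_continuous_support[OF _ K(1)]) (auto simp: K(3))
qed

lemma integrable_indicator_mult:
  fixes f :: "real^'n \<Rightarrow> real"
  assumes "integrable lebesgue f" "A \<in> sets lebesgue" shows "integrable lebesgue (\<lambda>x. indicator A x * f x)"
  using integrable_mult_indicator[OF assms(2,1)] by simp

lemma ball_part_sets: "\<Omega> \<inter> ball x r \<in> sets lebesgue"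
  using open_\<Omega> by auto

text \<open>In terms of v the quotient is |v| d powr (c - 1) with a negative exponent, so any lower
  bound for d, such as a multiple of the height, may be inserted.\<close>

lemma ud_le_vv:
  assumes "x \<in> \<Omega>" "0 < t" "t \<le> ch * d x"
  shows "\<bar>u x\<bar> / d x \<le> ch powr (1/p) * (\<bar>vv u x\<bar> * t powr (c - 1))"
proof -
  have dx: "0 < d x" by (rule d_pos[OF assms(1)])
  have "\<bar>u x\<bar> / d x = \<bar>vv u x\<bar> * d x powr (c - 1)"
  proof -
    have "d x powr (- c) * d x powr (c - 1) = d x powr (- 1)"
      unfolding powr_add[symmetric] by simp
    also have "\<dots> = inverse (d x)" using dx powr_minus[of "d x" 1] by simp
    finally have "d x powr (- c) * d x powr (c - 1) = inverse (d x)" .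
    then show ?thesis by (simp add: vv_def abs_mult divide_inverse mult.assoc)
  qed
  also have "\<dots> \<le> \<bar>vv u x\<bar> * (t / ch) powr (c - 1)"
    using assms ch(1) c_bounds by (intro mult_left_mono powr_mono2') (auto simp: field_simps)
  also have "(t / ch) powr (c - 1) = ch powr (1/p) * t powr (c - 1)"
  proof -
    have "c - 1 = - (1/p)" using c_bounds(4) by simp
    then show ?thesis using assms(2) ch(1) by (simp add: powr_divide powr_minus_divide)
  qed
  finally show ?thesis by (simp add: mult_ac)
qed

definition C_bd :: real where
  "C_bd = ch powr (1/p) * (C_bulk + 3 powr (n - n/p) / c * ((5 + 4 * L) powr c * 3 powr (1/p) * C_bulk + 4 * ch powr c * V1 powr (1 - 1/p)))"

lemma C_bd_pos: "0 < C_bd"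
  unfolding C_bd_def using C_bulk_pos ch c_bounds V1 L
  by (intro mult_pos_pos add_pos_nonneg) (auto intro!: mult_nonneg_nonneg add_nonneg_nonneg)

text \<open>If all heights in the ball are at least r, the weight is at most a multiple of r powr
  (-1/p) and the bulk bound suffices. Otherwise heights near the ball are at most a multiple of r,
  and |v| q h powr c is differentiated vertically with a cutoff q: the derivative of h powr c
  produces the weight h powr (-1/p), that of q is paid for by the bulk bound, and in that of v the
  factor h powr c cancels the singular d powr (-c).\<close>

lemma boundary_estimate:
  assumes u: "u \<in> Cc_inf \<Omega>" and x0: "x0 \<in> frontier \<Omega>" and x1: "dist x1 x0 \<le> \<rho>" and r: "0 < r" "r \<le> \<rho>"
    and N: "0 < N" and iG: "integrable lebesgue (\<lambda>x. norm (Gv u x) powr p)"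
    and G: "(\<integral>x. norm (Gv u x) powr p \<partial>lebesgue) \<le> N powr p"
    and U: "(\<integral>x. \<bar>u x\<bar> powr p \<partial>lebesgue) \<le> N powr p"
  shows "(\<integral>x. indicator (\<Omega> \<inter> ball x1 r) x * (\<bar>u x\<bar> / d x) \<partial>lebesgue) \<le> C_bd * N * r powr (n - n/p)"
proof -
  obtain h e where e: "norm e = 1" and h\<Omega>: "\<And>x. x \<in> ball x0 r0 \<Longrightarrow> x \<in> \<Omega> \<longleftrightarrow> 0 < h x" and hup: "\<And>x s. h (x + s *\<^sub>R e) = h x + s"
    and hlip: "\<And>x y. \<bar>h x - h y\<bar> \<le> (1 + L) * norm (x - y)" and hd: "\<And>x. x \<in> ball x0 (r0/2) \<Longrightarrow> h x \<le> ch * d x"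
    using chart_height[OF x0] by blast
  define lam where "lam = n - n/p"
  define E where "E = \<Omega> \<inter> ball x1 r"
  define E3 where "E3 = \<Omega> \<inter> ball x1 (3 * r)"
  have in_half: "x \<in> ball x0 (r0/2)" if "dist x1 x \<le> 3 * r" for x
  proof -
    have "dist x0 x \<le> dist x1 x0 + dist x1 x" using dist_triangle3[of x0 x x1] by simp
    also have "\<dots> \<le> 4 * \<rho>" using that x1 r by simp
    also have "\<dots> \<le> \<rho> * (5 + KK)" using \<rho> by (simp add: algebra_simps)
    finally show ?thesis using \<rho>(2) by simp
  qed
  have h_pos: "x \<in> \<Omega> \<longleftrightarrow> 0 < h x" if "dist x1 x \<le> 3 * r" for x
    using in_half[OF that] h\<Omega>[of x] r0 by simp
  have iud: "integrable lebesgue (\<lambda>x. indicator E x * (\<bar>u x\<bar> / d x))"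
    unfolding E_def by (intro integrable_indicator_mult ud_integrable[OF u] ball_part_sets)
  note K = Cc_inf_support[OF u]
  have vc: "continuous_on UNIV (vv u)" by (rule vv_continuous[OF u])
  have iv: "integrable lebesgue (\<lambda>x. \<bar>vv u x\<bar>)"
    by (intro integrable_continuous_support[OF _ K(1)] continuous_intros vc) (simp add: vv_support[OF u])
  have bulk: "(\<integral>x. indicator (\<Omega> \<inter> ball x1 s) x * \<bar>vv u x\<bar> \<partial>lebesgue) \<le> C_bulk * N * s powr (lam + 1/p)" if "0 < s" "s \<le> 3 * r" for s
    unfolding lam_def using that r by (intro bulk_estimate[OF u x0 x1 _ _ N iG G U]) auto
  define C1 where "C1 = 3 powr lam / c * ((5 + 4 * L) powr c * 3 powr (1/p) * C_bulk + 4 * ch powr c * V1 powr (1 - 1/p))"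
  have C1: "0 \<le> C1" unfolding C1_def using c_bounds C_bulk_pos L by (intro mult_nonneg_nonneg add_nonneg_nonneg divide_nonneg_nonneg) auto
  have C_bd_eq: "C_bd = ch powr (1/p) * (C_bulk + C1)" by (simp add: C_bd_def C1_def lam_def)
  show ?thesis
  proof (cases "\<forall>y\<in>E. r \<le> h y")
    case True
    have "(\<integral>x. indicator E x * (\<bar>u x\<bar> / d x) \<partial>lebesgue) \<le> (\<integral>x. (ch powr (1/p) * r powr (c - 1)) * (indicator E x * \<bar>vv u x\<bar>) \<partial>lebesgue)"
    proof (rule Bochner_Integration.integral_mono[OF iud])
      show "integrable lebesgue (\<lambda>x. (ch powr (1/p) * r powr (c - 1)) * (indicator E x * \<bar>vv u x\<bar>))"
        unfolding E_def by (intro integrable_mult_right integrable_indicator_mult iv ball_part_sets)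
      fix x
      show "indicator E x * (\<bar>u x\<bar> / d x) \<le> (ch powr (1/p) * r powr (c - 1)) * (indicator E x * \<bar>vv u x\<bar>)"
      proof (cases "x \<in> E")
        case x: True
        have "r \<le> ch * d x" using True x hd[OF in_half[of x]] r by (force simp: E_def)
        then show ?thesis using ud_le_vv[of x r u] x r by (simp add: E_def mult_ac)
      qed simp
    qed
    also have "\<dots> = (ch powr (1/p) * r powr (c - 1)) * (\<integral>x. indicator E x * \<bar>vv u x\<bar> \<partial>lebesgue)" by simp
    also have "\<dots> \<le> (ch powr (1/p) * r powr (c - 1)) * (C_bulk * N * r powr (lam + 1/p))"
      unfolding E_def using r by (intro mult_left_mono bulk) auto
    also have "\<dots> = ch powr (1/p) * C_bulk * N * r powr lam"
    proof -
      have "r powr (c - 1) * r powr (lam + 1/p) = r powr lam"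
      proof -
        have "c - 1 + (lam + 1/p) = lam" using c_bounds(4) by simp
        then show ?thesis by (simp only: powr_add[symmetric])
      qed
      then show ?thesis by (simp add: mult_ac)
    qed
    also have "\<dots> \<le> C_bd * N * r powr lam"
      unfolding C_bd_eq using N C1 by (intro mult_right_mono mult_left_mono) auto
    finally show ?thesis unfolding E_def lam_def .
  next
    case False
    then obtain y where y: "y \<in> E" "h y < r" by force
    \<comment> \<open>The point y has height below r, and points of the triple ball are within 4 r
      of it; this gives r + 4 (1 + L) r.\<close>
    define H where "H = 5 + 4 * L"
    have H: "0 < H" using L by (simp add: H_def)
    have h_up: "h x \<le> H * r" if "dist x1 x \<le> 3 * r" for x
    proof -
      have "norm (x - y) \<le> 4 * r" using that y(1) dist_triangle3[of x y x1] by (simp add: E_def dist_norm norm_minus_commute)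
      then have "(1 + L) * norm (x - y) \<le> (1 + L) * (4 * r)" using L by (intro mult_left_mono) auto
      then show ?thesis using hlip[of x y] y(2) by (simp add: H_def algebra_simps)
    qed
    \<comment> \<open>On this compact part of the support the height is at least some h0 > 0. This
      keeps h powr (c - 1) continuous and the shifts \<delta> below the heights; h0 depends on u but
      does not enter the final constant.\<close>
    define K3 where "K3 = tsupp u \<inter> cball x1 (3 * r)"
    have hcont: "continuous_on S h" for S
    proof -
      have "(1 + L)-lipschitz_on S h" using hlip L by (intro lipschitz_onI) (auto simp: dist_norm)
      then show ?thesis by (rule lipschitz_on_continuous_on)
    qed
    have "\<exists>h0>0. \<forall>x\<in>K3. h0 \<le> h x"
    proof (cases "K3 = {}")
      case False
      have "compact K3" unfolding K3_def using K(1) by (intro compact_Int) auto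
      then obtain z where z: "z \<in> K3" "\<And>x. x \<in> K3 \<Longrightarrow> h z \<le> h x"
        using continuous_attains_inf[OF _ False hcont] by blast
      then have "0 < h z" using h_pos[of z] K(2) by (auto simp: K3_def)
      with z show ?thesis by blast
    qed (auto intro: exI[of _ 1])
    then obtain h0 where h0: "0 < h0" "\<And>x. x \<in> K3 \<Longrightarrow> h0 \<le> h x" by blast
    \<comment> \<open>A cone: \<open>q\<close> has slope at most one, is at least r on the small
      ball and at most 2 r everywhere, so a single factor r has to be divided out at the
      end.\<close>
    define q where "q x = max 0 (2 * r - dist x1 x)" for x
    have q0: "0 \<le> q x" "q x \<le> 2 * r" for x using r by (auto simp: q_def)
    have qlip: "\<bar>q x - q z\<bar> \<le> dist x z" for x z
      using dist_triangle[of x1 x z] dist_triangle[of x1 z x] by (auto simp: q_def max_def dist_commute)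
    have qc: "continuous_on UNIV q" unfolding q_def by (intro continuous_intros)
    \<comment> \<open>The positive part extends h powr c continuously by zero below the graph, so
      translated points that leave \<Omega> do no harm.\<close>
    define \<kappa> where "\<kappa> t = (max t 0) powr c" for t
    have \<kappa>0: "0 \<le> \<kappa> t" for t by (simp add: \<kappa>_def)
    have \<kappa>mono: "\<kappa> s \<le> \<kappa> t" if "s \<le> t" for s t using that c_bounds by (auto simp: \<kappa>_def intro!: powr_mono2)
    have \<kappa>c: "continuous_on UNIV \<kappa>" unfolding \<kappa>_def using c_bounds by (intro continuous_on_powr' continuous_intros) auto
    \<comment> \<open>The truncation at h0 makes \<open>Q\<close> continuous and changes nothing
      where v and \<open>q\<close> are both nonzero.\<close>
    define Q where "Q x = \<bar>vv u x\<bar> * q x * (max (h x) h0) powr (c - 1)" for x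
    have iQ: "integrable lebesgue Q" unfolding Q_def
      by (intro integrable_continuous_support[OF _ K(1)] continuous_intros vc qc hcont) (use h0 in \<open>auto simp: vv_support[OF u] max_def\<close>)
    define B1 where "B1 x = (H * r) powr c * (indicator E3 x * \<bar>vv u x\<bar>)" for x
    have iB1: "integrable lebesgue B1" unfolding B1_def E3_def
      by (intro integrable_mult_right integrable_indicator_mult iv ball_part_sets)
    \<comment> \<open>A difference quotient of v in place of its vertical derivative; the limit
      \<delta> to 0 is taken after integration, so that neither h nor the graph has to be
      differentiated.\<close>
    define D where "D \<delta> x = q (x - \<delta> *\<^sub>R e) * \<kappa> (h x - \<delta>) * (\<bar>vv u x - vv u (x - \<delta> *\<^sub>R e)\<bar> / \<delta>)" for \<delta> x
    have q_out: "q (x - \<delta> *\<^sub>R e) = 0" if "\<not> dist x1 x < 3 * r" "0 \<le> \<delta>" "\<delta> \<le> r" for x \<delta>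
    proof -
      have "dist x1 x \<le> dist x1 (x - \<delta> *\<^sub>R e) + \<delta>"
        using dist_triangle[of x1 x "x - \<delta> *\<^sub>R e"] e that by (simp add: dist_norm)
      then show ?thesis using that by (simp add: q_def)
    qed
    have Dc: "continuous_on UNIV (D \<delta>)" if "\<delta> \<noteq> 0" for \<delta>
      unfolding D_def using that
      by (intro continuous_intros continuous_on_compose2[OF qc] continuous_on_compose2[OF \<kappa>c] continuous_on_compose2[OF vc] hcont) auto
    have iD: "integrable lebesgue (D \<delta>)" if "0 < \<delta>" "\<delta> \<le> r" for \<delta>
      by (rule integrable_continuous_support[where K="cball x1 (3 * r)"])
         (use Dc[of \<delta>] q_out[of _ \<delta>] that in \<open>auto simp: D_def\<close>)
    (* The integrals of f and of its translate by \<delta> e agree; the difference f x - f (x - \<delta> e)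
       is split into increments of \<kappa>, of the cutoff q, and of |v|. *)
    have ineq: "c * (\<integral>x. Q x \<partial>lebesgue) \<le> (\<integral>x. B1 x \<partial>lebesgue) + (\<integral>x. D \<delta> x \<partial>lebesgue)" if \<delta>: "0 < \<delta>" "\<delta> \<le> r" "\<delta> \<le> h0" for \<delta>
    proof -
      define f where "f x = \<bar>vv u x\<bar> * q x * \<kappa> (h x)" for x
      have if1: "integrable lebesgue f" unfolding f_def
        by (intro integrable_continuous_support[OF _ K(1)] continuous_intros vc qc continuous_on_compose2[OF \<kappa>c hcont])
           (auto simp: vv_support[OF u])
      have sh: "- \<delta> *\<^sub>R e + 1 *\<^sub>R x = x - \<delta> *\<^sub>R e" for x by simp
      have if2: "integrable lebesgue (\<lambda>x. f (x - \<delta> *\<^sub>R e))" "(\<integral>x. f (x - \<delta> *\<^sub>R e) \<partial>lebesgue) = (\<integral>x. f x \<partial>lebesgue)"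
        using lebesgue_integral_affine[OF zero_less_one if1, of "- \<delta> *\<^sub>R e"] unfolding sh by simp_all
      have pt: "\<delta> * (c * Q x - B1 x - D \<delta> x) \<le> f x - f (x - \<delta> *\<^sub>R e)" for x
      proof -
        define v v' where "v = \<bar>vv u x\<bar>" and "v' = \<bar>vv u (x - \<delta> *\<^sub>R e)\<bar>"
        define qq where "qq = q (x - \<delta> *\<^sub>R e)"
        have v0: "0 \<le> v" by (simp add: v_def)
        have h': "h (x - \<delta> *\<^sub>R e) = h x - \<delta>" using hup[of x "-\<delta>"] by simp
        have split: "f x - f (x - \<delta> *\<^sub>R e) = v * q x * (\<kappa> (h x) - \<kappa> (h x - \<delta>)) + v * \<kappa> (h x - \<delta>) * (q x - qq) + qq * \<kappa> (h x - \<delta>) * (v - v')"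
          unfolding f_def h' v_def v'_def qq_def by (simp add: algebra_simps)
        \<comment> \<open>Concavity bounds the increment of h powr c from below by \<delta> times
          its derivative at the upper end point h, which is the weight in \<open>Q\<close>.\<close>
        have a: "\<delta> * (c * Q x) \<le> v * q x * (\<kappa> (h x) - \<kappa> (h x - \<delta>))"
        proof (cases "v = 0 \<or> q x = 0")
          case True
          then show ?thesis by (auto simp: Q_def v_def)
        next
          case False
          then have "x \<in> tsupp u" "dist x1 x < 2 * r" using vv_support[OF u, of x] by (auto simp: v_def q_def max_def split: if_splits)
          then have hx: "h0 \<le> h x" using r by (intro h0(2)) (auto simp: K3_def)
          then have "\<delta> * (c * h x powr (c - 1)) \<le> h x powr c - (h x - \<delta>) powr c"
            using \<delta> h0(1) c_bounds by (intro powr_concave_tangent) auto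
          then have "\<delta> * (c * h x powr (c - 1)) \<le> \<kappa> (h x) - \<kappa> (h x - \<delta>)" using hx \<delta> h0(1) by (simp add: \<kappa>_def)
          then have "v * q x * (\<delta> * (c * h x powr (c - 1))) \<le> v * q x * (\<kappa> (h x) - \<kappa> (h x - \<delta>))"
            using v0 q0(1)[of x] by (intro mult_left_mono) auto
          moreover have "max (h x) h0 = h x" using hx by simp
          ultimately show ?thesis by (simp add: Q_def v_def mult_ac)
        qed
        \<comment> \<open>\<open>q\<close> is 1-Lipschitz and the shift has length \<delta>; off the
          triple ball both values of \<open>q\<close> vanish.\<close>
        have b: "\<bar>v * \<kappa> (h x - \<delta>) * (q x - qq)\<bar> \<le> \<delta> * B1 x"
        proof (cases "v = 0 \<or> \<not> dist x1 x < 3 * r")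
          case True
          moreover have "0 \<le> \<delta> * B1 x" using \<delta> by (simp add: B1_def)
          moreover have "q x - qq = 0" if "\<not> dist x1 x < 3 * r"
            unfolding qq_def using q_out[OF that, of \<delta>] q_out[OF that, of 0] \<delta> r by simp
          ultimately show ?thesis by auto
        next
          case False
          then have x: "x \<in> E3" using vv_support[OF u, of x] K(2) by (auto simp: E3_def v_def)
          have "\<kappa> (h x - \<delta>) \<le> \<kappa> (H * r)" using h_up[of x] False \<delta> by (intro \<kappa>mono) auto
          also have "\<dots> = (H * r) powr c" using H r by (simp add: \<kappa>_def)
          finally have 1: "\<kappa> (h x - \<delta>) \<le> (H * r) powr c" .
          have 2: "\<bar>q x - qq\<bar> \<le> \<delta>" unfolding qq_def using qlip[of x "x - \<delta> *\<^sub>R e"] e \<delta> by (simp add: dist_norm)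
          have "v * (\<kappa> (h x - \<delta>) * \<bar>q x - qq\<bar>) \<le> v * ((H * r) powr c * \<delta>)"
            using 1 2 v0 by (intro mult_left_mono mult_mono) auto
          then show ?thesis using x \<kappa>0[of "h x - \<delta>"] v0 by (simp add: abs_mult B1_def v_def mult_ac)
        qed
        have d: "- (\<delta> * D \<delta> x) \<le> qq * \<kappa> (h x - \<delta>) * (v - v')"
        proof -
          have "qq * \<kappa> (h x - \<delta>) * (v' - v) \<le> qq * \<kappa> (h x - \<delta>) * \<bar>vv u x - vv u (x - \<delta> *\<^sub>R e)\<bar>"
            using \<kappa>0 q0(1) unfolding v_def v'_def qq_def by (intro mult_left_mono) auto
          also have "\<dots> = \<delta> * D \<delta> x" using \<delta> by (simp add: D_def qq_def)
          finally show ?thesis by (simp add: algebra_simps)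
        qed
        show ?thesis unfolding split using a b d by (simp add: algebra_simps abs_le_iff)
      qed
      have iL: "integrable lebesgue (\<lambda>x. \<delta> * (c * Q x - B1 x - D \<delta> x))"
        by (intro integrable_mult_right Bochner_Integration.integrable_diff iQ iB1 iD \<delta>)
      have "(\<integral>x. \<delta> * (c * Q x - B1 x - D \<delta> x) \<partial>lebesgue) \<le> (\<integral>x. f x - f (x - \<delta> *\<^sub>R e) \<partial>lebesgue)"
        by (rule Bochner_Integration.integral_mono[OF iL Bochner_Integration.integrable_diff[OF if1 if2(1)] pt])
      also have "\<dots> = 0" using if1 if2 by simp
      also have "(\<integral>x. \<delta> * (c * Q x - B1 x - D \<delta> x) \<partial>lebesgue) = \<delta> * (c * (\<integral>x. Q x \<partial>lebesgue) - (\<integral>x. B1 x \<partial>lebesgue) - (\<integral>x. D \<delta> x \<partial>lebesgue))"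
        using iQ iB1 iD[OF \<delta>(1,2)] by simp
      finally show ?thesis using \<delta>(1) by (simp add: mult_le_0_iff)
    qed
    define D0 where "D0 x = q x * \<kappa> (h x) * \<bar>gvv u x \<bullet> e\<bar>" for x
    define \<delta> where "\<delta> i = min r h0 / real (Suc i)" for i
    have \<delta>: "0 < \<delta> i" "\<delta> i \<le> r" "\<delta> i \<le> h0" for i
    proof -
      have "min r h0 / real (Suc i) \<le> min r h0 / 1" using r h0 by (intro divide_left_mono) auto
      then show "0 < \<delta> i" "\<delta> i \<le> r" "\<delta> i \<le> h0" using r h0 by (auto simp: \<delta>_def)
    qed
    have \<delta>lim: "\<delta> \<longlonglongrightarrow> 0" unfolding \<delta>_def by real_asymp
    obtain M where M: "M-lipschitz_on UNIV (vv u)" using vv_lipschitz[OF u] by blast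
    have Dlim: "AE x in lebesgue. (\<lambda>i. D (\<delta> i) x) \<longlonglongrightarrow> D0 x"
      using vv_derivative[OF u]
    proof eventually_elim
      case (elim x)
      have lim': "(\<lambda>i. - \<delta> i) \<longlonglongrightarrow> 0" using tendsto_minus[OF \<delta>lim] by simp
      have "- \<delta> i \<noteq> 0" for i using \<delta>(1)[of i] by simp
      from difference_quotient_tendsto[OF elim lim' this, of e]
      have "(\<lambda>i. \<bar>(vv u (x + - \<delta> i *\<^sub>R e) - vv u x) / - \<delta> i\<bar>) \<longlonglongrightarrow> \<bar>gvv u x \<bullet> e\<bar>" by (rule tendsto_rabs)
      moreover have "\<bar>(vv u (x + - \<delta> i *\<^sub>R e) - vv u x) / - \<delta> i\<bar> = \<bar>vv u x - vv u (x - \<delta> i *\<^sub>R e)\<bar> / \<delta> i" for i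
        using \<delta>(1)[of i] by (simp add: abs_divide abs_minus_commute)
      ultimately have 1: "(\<lambda>i. \<bar>vv u x - vv u (x - \<delta> i *\<^sub>R e)\<bar> / \<delta> i) \<longlonglongrightarrow> \<bar>gvv u x \<bullet> e\<bar>" by simp
      have "(\<lambda>i. x - \<delta> i *\<^sub>R e) \<longlonglongrightarrow> x - 0 *\<^sub>R e" by (intro tendsto_intros \<delta>lim)
      then have 2: "(\<lambda>i. q (x - \<delta> i *\<^sub>R e)) \<longlonglongrightarrow> q x"
        using qc by (intro continuous_on_tendsto_compose[OF qc]) auto
      have "(\<lambda>i. h x - \<delta> i) \<longlonglongrightarrow> h x - 0" by (intro tendsto_intros \<delta>lim)
      then have 3: "(\<lambda>i. \<kappa> (h x - \<delta> i)) \<longlonglongrightarrow> \<kappa> (h x)"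
        by (intro continuous_on_tendsto_compose[OF \<kappa>c]) auto
      show ?case unfolding D_def D0_def by (intro tendsto_intros 1 2 3)
    qed
    \<comment> \<open>This bound contains the Lipschitz constant of v and thus depends on u; it
      serves dominated convergence only.\<close>
    have Dbound: "AE x in lebesgue. norm (D (\<delta> i) x) \<le> (2 * r * (H * r) powr c * M) * indicator (cball x1 (3 * r)) x" for i
    proof (rule always_eventually, rule allI)
      fix x
      show "norm (D (\<delta> i) x) \<le> (2 * r * (H * r) powr c * M) * indicator (cball x1 (3 * r)) x"
      proof (cases "dist x1 x < 3 * r")
        case True
        have "\<kappa> (h x - \<delta> i) \<le> \<kappa> (H * r)" using h_up[of x] True \<delta>(1)[of i] by (intro \<kappa>mono) auto
        also have "\<dots> = (H * r) powr c" using H r by (simp add: \<kappa>_def)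
        finally have 1: "\<kappa> (h x - \<delta> i) \<le> (H * r) powr c" .
        have "\<bar>vv u x - vv u (x - \<delta> i *\<^sub>R e)\<bar> \<le> M * \<delta> i"
          using lipschitz_onD[OF M, of x "x - \<delta> i *\<^sub>R e"] e \<delta>(1)[of i] by (simp add: dist_norm)
        then have 2: "\<bar>vv u x - vv u (x - \<delta> i *\<^sub>R e)\<bar> / \<delta> i \<le> M" using \<delta>(1)[of i] by (simp add: divide_simps)
        have "D (\<delta> i) x \<le> 2 * r * (H * r) powr c * M" unfolding D_def
          using 1 2 q0 \<kappa>0 \<delta>(1)[of i] r by (intro mult_mono) auto
        moreover have "0 \<le> D (\<delta> i) x" unfolding D_def using q0 \<kappa>0 \<delta>(1)[of i] by (intro mult_nonneg_nonneg) auto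
        ultimately show ?thesis using True by simp
      next
        case False
        then have "D (\<delta> i) x = 0" using q_out[OF False, of "\<delta> i"] \<delta>[of i] by (simp add: D_def)
        moreover have "0 \<le> M" using M by (rule lipschitz_on_nonneg)
        ultimately show ?thesis using r by simp
      qed
    qed
    have ib: "integrable lebesgue (\<lambda>x. (2 * r * (H * r) powr c * M) * indicator (cball x1 (3 * r)) x)"
      using lmeasurable_cball[of x1 "3 * r"]
      by (intro integrable_mult_right integrable_real_indicator) (auto simp: fmeasurable_def)
    have Dm: "D (\<delta> i) \<in> borel_measurable lebesgue" for i
      using Dc[of "\<delta> i"] \<delta>(1)[of i] by (intro continuous_imp_lebesgue_measurable) auto
    have D0m: "D0 \<in> borel_measurable lebesgue" by (rule lebesgue_measurable_AE_limit[OF Dm Dlim])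
    have iD0: "integrable lebesgue D0" by (rule integrable_dominated_convergence[OF D0m Dm ib Dlim Dbound])
    have Dconv: "(\<lambda>i. \<integral>x. D (\<delta> i) x \<partial>lebesgue) \<longlonglongrightarrow> (\<integral>x. D0 x \<partial>lebesgue)"
      by (rule integral_dominated_convergence[OF D0m Dm ib Dlim Dbound])
    have main: "c * (\<integral>x. Q x \<partial>lebesgue) \<le> (\<integral>x. B1 x \<partial>lebesgue) + (\<integral>x. D0 x \<partial>lebesgue)"
      by (rule LIMSEQ_le_const[OF tendsto_add[OF tendsto_const Dconv]]) (use ineq \<delta> in auto)
    have r3: "0 < 3 * r" using r by simp
    have B1le: "(\<integral>x. B1 x \<partial>lebesgue) \<le> (H * r) powr c * (C_bulk * N * (3 * r) powr (lam + 1/p))"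
      unfolding B1_def integral_mult_right_zero E3_def using r by (intro mult_left_mono bulk) auto
    have p1: "1 < p" using p by simp
    have Gm: "(\<lambda>x. norm (Gv u x)) \<in> borel_measurable lebesgue" using Gv_measurable[OF u] by simp
    note hol = holder_set[OF p1 Gm norm_ge_zero iG G N ball_part(1,2)[OF r3, of x1]]
    have V3: "0 < V1 * (3 * r) powr n" using V1 r by simp
    have D0le: "(\<integral>x. D0 x \<partial>lebesgue) \<le> (2 * r * ch powr c) * (2 * N * (V1 powr (1 - 1/p) * (3 * r) powr lam))"
    proof -
      have "(\<integral>x. D0 x \<partial>lebesgue) \<le> (\<integral>x. (2 * r * ch powr c) * (indicator E3 x * norm (Gv u x)) \<partial>lebesgue)"
      proof (rule Bochner_Integration.integral_mono[OF iD0])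
        show "integrable lebesgue (\<lambda>x. (2 * r * ch powr c) * (indicator E3 x * norm (Gv u x)))"
          unfolding E3_def by (intro integrable_mult_right hol(1) V3)
        fix x
        show "D0 x \<le> (2 * r * ch powr c) * (indicator E3 x * norm (Gv u x))"
        proof (cases "q x = 0 \<or> h x \<le> 0")
          case True
          then have "D0 x = 0" by (auto simp: D0_def \<kappa>_def max_def)
          then show ?thesis using r by simp
        next
          case False
          then have dx: "dist x1 x < 2 * r" by (auto simp: q_def max_def split: if_splits)
          have hx: "0 < h x" using False by simp
          then have x: "x \<in> \<Omega>" using h_pos[of x] dx r by simp
          have x3: "x \<in> E3" using x dx r by (simp add: E3_def)
          have dp: "0 < d x" by (rule d_pos[OF x])
          have "\<kappa> (h x) = h x powr c" using hx by (simp add: \<kappa>_def)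
          also have "\<dots> \<le> (ch * d x) powr c" using hd[OF in_half[of x]] dx r hx c_bounds by (intro powr_mono2) auto
          also have "\<dots> = ch powr c * d x powr c" using ch(1) dp by (simp add: powr_mult)
          finally have k: "\<kappa> (h x) \<le> ch powr c * d x powr c" .
          have "\<bar>gvv u x \<bullet> e\<bar> \<le> norm (gvv u x) * norm e" by (rule Cauchy_Schwarz_ineq2)
          then have g: "\<bar>gvv u x \<bullet> e\<bar> \<le> d x powr (- c) * norm (Gv u x)" using e by (simp add: gvv_def)
          \<comment> \<open>The factor d powr c gained from the height cancels the weight d powr
            (-c) inside \<open>gvv\<close>, so that only \<open>Gv\<close> remains.\<close>
          have "q x * \<kappa> (h x) * \<bar>gvv u x \<bullet> e\<bar> \<le> (2 * r) * (ch powr c * d x powr c) * (d x powr (- c) * norm (Gv u x))"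
            using q0[of x] k g \<kappa>0[of "h x"] r by (intro mult_mono) auto
          also have "\<dots> = (2 * r * ch powr c) * norm (Gv u x) * (d x powr c * d x powr (- c))" by (simp only: mult_ac)
          also have "d x powr c * d x powr (- c) = 1" using dp by (simp flip: powr_add)
          finally show ?thesis using x3 by (simp add: D0_def)
        qed
      qed
      also have "\<dots> = (2 * r * ch powr c) * (\<integral>x. indicator E3 x * norm (Gv u x) \<partial>lebesgue)" by simp
      also have "\<dots> \<le> (2 * r * ch powr c) * (2 * N * (V1 * (3 * r) powr n) powr (1 - 1/p))"
        unfolding E3_def using r hol(2)[OF V3] by (intro mult_left_mono) auto
      finally show ?thesis unfolding ball_part(3)[OF r3] lam_def .
    qed
    \<comment> \<open>The factor r makes room for \<open>q\<close>, which is at least r on the small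
      ball.\<close>
    have "r * (\<integral>x. indicator E x * (\<bar>u x\<bar> / d x) \<partial>lebesgue) = (\<integral>x. r * (indicator E x * (\<bar>u x\<bar> / d x)) \<partial>lebesgue)"
      by (rule integral_mult_right_zero[symmetric])
    also have "\<dots> \<le> (\<integral>x. ch powr (1/p) * Q x \<partial>lebesgue)"
    proof (rule Bochner_Integration.integral_mono)
      show "integrable lebesgue (\<lambda>x. r * (indicator E x * (\<bar>u x\<bar> / d x)))" by (intro integrable_mult_right iud)
      show "integrable lebesgue (\<lambda>x. ch powr (1/p) * Q x)" by (intro integrable_mult_right iQ)
      fix x
      show "r * (indicator E x * (\<bar>u x\<bar> / d x)) \<le> ch powr (1/p) * Q x"
      proof (cases "x \<in> E \<and> u x \<noteq> 0")
        case True
        then have x: "x \<in> \<Omega>" "dist x1 x < r" "x \<in> tsupp u" using K(3) by (auto simp: E_def)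
        then have hx: "h0 \<le> h x" using r by (intro h0(2)) (auto simp: K3_def)
        have "\<bar>u x\<bar> / d x \<le> ch powr (1/p) * (\<bar>vv u x\<bar> * h x powr (c - 1))"
          using x hx h0(1) hd[OF in_half[of x]] r by (intro ud_le_vv) auto
        moreover have "r \<le> q x" using x by (simp add: q_def)
        ultimately have "r * (\<bar>u x\<bar> / d x) \<le> q x * (ch powr (1/p) * (\<bar>vv u x\<bar> * h x powr (c - 1)))"
          using r by (intro mult_mono) auto
        moreover have "max (h x) h0 = h x" using hx by simp
        ultimately show ?thesis using True by (simp add: Q_def mult_ac)
      next
        case False
        then have "r * (indicator E x * (\<bar>u x\<bar> / d x)) = 0" by (auto simp: indicator_def)
        moreover have "0 \<le> ch powr (1/p) * Q x" using q0 by (simp add: Q_def)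
        ultimately show ?thesis by linarith
      qed
    qed
    also have "\<dots> = ch powr (1/p) / c * (c * (\<integral>x. Q x \<partial>lebesgue))" using c_bounds by simp
    also have "\<dots> \<le> ch powr (1/p) / c * ((H * r) powr c * (C_bulk * N * (3 * r) powr (lam + 1/p)) + (2 * r * ch powr c) * (2 * N * (V1 powr (1 - 1/p) * (3 * r) powr lam)))"
      using main B1le D0le c_bounds by (intro mult_left_mono) auto
    \<comment> \<open>Counting powers of r: the first term carries r powr (c + lam + 1/p) and c +
      1/p = 1; the second has an explicit factor r from \<open>q\<close>. Both are multiples of r
      times r powr lam.\<close>
    also have "\<dots> = r * (ch powr (1/p) * C1 * N * r powr lam)"
    proof -
      have "(H * r) powr c * (3 * r) powr (lam + 1/p) = H powr c * 3 powr (1/p) * 3 powr lam * r powr lam * (r powr c * r powr (1/p))"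
        using H r by (simp add: powr_mult powr_add mult_ac)
      moreover have "r powr c * r powr (1/p) = r" 
      proof -
        have "c + 1/p = 1" using c_bounds(4) by simp
        then show ?thesis using r by (simp only: powr_add[symmetric]) simp
      qed
      moreover have "(3 * r) powr lam = 3 powr lam * r powr lam" using r by (simp add: powr_mult)
      ultimately have "(H * r) powr c * (C_bulk * N * (3 * r) powr (lam + 1/p)) + (2 * r * ch powr c) * (2 * N * (V1 powr (1 - 1/p) * (3 * r) powr lam))
        = r * (3 powr lam * (H powr c * 3 powr (1/p) * C_bulk + 4 * ch powr c * V1 powr (1 - 1/p)) * N * r powr lam)"
        by (simp add: algebra_simps)
      then show ?thesis unfolding C1_def H_def by (simp add: field_simps)
    qed
    finally have "(\<integral>x. indicator E x * (\<bar>u x\<bar> / d x) \<partial>lebesgue) \<le> ch powr (1/p) * C1 * N * r powr lam"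
      using r by simp
    also have "\<dots> \<le> C_bd * N * r powr lam"
      unfolding C_bd_eq using N C_bulk_pos by (intro mult_right_mono mult_left_mono) auto
    finally show ?thesis unfolding E_def lam_def .
  qed
qed


section \<open>From boundary balls to all balls\<close>

definition C_loc :: real where "C_loc = max C_bd (2 * ch / \<rho> * (2 * V1 powr (1 - 1/p)))"

text \<open>Either the centre is within \<rho> of the boundary and a chart applies, or all points of
  the ball stay at distance at least \<rho>/2 from the boundary; then 1/d is bounded and Hoelder's
  inequality for u is enough. The bound r \<le> \<rho>/2 leaves this margin.\<close>

lemma local_estimate:
  assumes u: "u \<in> Cc_inf \<Omega>" and x1: "x1 \<in> \<Omega>" and r: "0 < r" "r \<le> \<rho> / 2"
    and N: "0 < N" and iG: "integrable lebesgue (\<lambda>x. norm (Gv u x) powr p)"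
    and G: "(\<integral>x. norm (Gv u x) powr p \<partial>lebesgue) \<le> N powr p"
    and U: "(\<integral>x. \<bar>u x\<bar> powr p \<partial>lebesgue) \<le> N powr p"
  shows "(\<integral>x. indicator (\<Omega> \<inter> ball x1 r) x * (\<bar>u x\<bar> / d x) \<partial>lebesgue) \<le> C_loc * N * r powr (n - n/p)"
proof (cases "\<exists>x0\<in>frontier \<Omega>. dist x1 x0 \<le> \<rho>")
  case True
  then obtain x0 where x0: "x0 \<in> frontier \<Omega>" "dist x1 x0 \<le> \<rho>" by blast
  have "(\<integral>x. indicator (\<Omega> \<inter> ball x1 r) x * (\<bar>u x\<bar> / d x) \<partial>lebesgue) \<le> C_bd * N * r powr (n - n/p)"
    using r \<rho>(1) by (intro boundary_estimate[OF u x0 r(1) _ N iG G U]) auto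
  also have "\<dots> \<le> C_loc * N * r powr (n - n/p)" using N by (intro mult_right_mono) (auto simp: C_loc_def)
  finally show ?thesis .
next
  case False
  note K = Cc_inf_support[OF u]
  have p1: "1 < p" using p by simp
  have uc: "continuous_on UNIV (\<lambda>x. \<bar>u x\<bar>)" by (intro continuous_intros Cc_inf_continuous[OF u])
  have iu: "integrable lebesgue (\<lambda>x. \<bar>u x\<bar> powr p)"
    using p by (intro integrable_continuous_support[OF _ K(1)] continuous_on_powr' uc continuous_intros) (auto simp: K(3))
  have V: "0 < V1 * r powr n" using V1 r by simp
  note hol = holder_set[OF p1 continuous_imp_lebesgue_measurable[OF uc] abs_ge_zero iu U N ball_part(1,2)[OF r(1), of x1] V]
  have "(\<integral>x. indicator (\<Omega> \<inter> ball x1 r) x * (\<bar>u x\<bar> / d x) \<partial>lebesgue)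
      \<le> (\<integral>x. (2 * ch / \<rho>) * (indicator (\<Omega> \<inter> ball x1 r) x * \<bar>u x\<bar>) \<partial>lebesgue)"
  proof (rule Bochner_Integration.integral_mono)
    show "integrable lebesgue (\<lambda>x. indicator (\<Omega> \<inter> ball x1 r) x * (\<bar>u x\<bar> / d x))"
      by (intro integrable_indicator_mult ud_integrable[OF u] ball_part_sets)
    show "integrable lebesgue (\<lambda>x. (2 * ch / \<rho>) * (indicator (\<Omega> \<inter> ball x1 r) x * \<bar>u x\<bar>))"
      by (intro integrable_mult_right hol)
    fix x
    show "indicator (\<Omega> \<inter> ball x1 r) x * (\<bar>u x\<bar> / d x) \<le> (2 * ch / \<rho>) * (indicator (\<Omega> \<inter> ball x1 r) x * \<bar>u x\<bar>)"
    proof (cases "x \<in> \<Omega> \<inter> ball x1 r")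
      case True
      obtain z where z: "z \<in> frontier \<Omega>" "d x = dual (x - z)" using d_attained by blast
      have "\<rho> < dist x1 z" using False z by force
      then have "\<rho> / 2 \<le> norm (x - z)"
        using True r dist_triangle[of x1 z x] by (simp add: dist_norm)
      also have "\<dots> \<le> (1 + L) * norm (x - z)" using L by (simp add: mult_right_mono[of 1 "1 + L", simplified])
      also have "\<dots> \<le> ch * d x" using ch(2) z by simp
      finally have "1 / d x \<le> 2 * ch / \<rho>" using d_pos[of x] True \<rho>(1) by (simp add: divide_simps mult_ac)
      then have "\<bar>u x\<bar> * (1 / d x) \<le> \<bar>u x\<bar> * (2 * ch / \<rho>)" by (intro mult_left_mono) auto
      then show ?thesis using True by (simp add: mult_ac)
    qed simp
  qed
  also have "\<dots> = (2 * ch / \<rho>) * (\<integral>x. indicator (\<Omega> \<inter> ball x1 r) x * \<bar>u x\<bar> \<partial>lebesgue)" by simp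
  also have "\<dots> \<le> (2 * ch / \<rho>) * (2 * N * (V1 * r powr n) powr (1 - 1/p))"
    using hol(2) ch(1) \<rho>(1) by (intro mult_left_mono) auto
  also have "\<dots> = (2 * ch / \<rho> * (2 * V1 powr (1 - 1/p))) * N * r powr (n - n/p)"
    unfolding ball_part(3)[OF r(1)] by (simp only: mult_ac)
  also have "\<dots> \<le> C_loc * N * r powr (n - n/p)" using N by (intro mult_right_mono) (auto simp: C_loc_def)
  finally show ?thesis .
qed

text \<open>An interior corkscrew condition: if the ball around x leaves \<Omega>, a boundary point
  is near, and moving x up by t/2 in its chart gives a height above t/2. Heights have Lipschitz
  constant 1 + L, so the stated smaller ball stays above the graph.\<close>

lemma inner_ball:
  assumes x: "x \<in> \<Omega>" and t: "0 < t" "t \<le> r0 / 2"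
  shows "\<exists>y. ball y (t / (2 * (2 + L))) \<subseteq> \<Omega> \<inter> ball x t"
proof (cases "ball x t \<subseteq> \<Omega>")
  case True
  have "t / (2 * (2 + L)) \<le> t / 1" using t L by (intro divide_left_mono) auto
  then have "ball x (t / (2 * (2 + L))) \<subseteq> ball x t" by (intro subset_ball) simp
  with True show ?thesis by blast
next
  case False
  have "x \<in> ball x t \<inter> \<Omega>" using x t by simp
  then have "ball x t \<inter> \<Omega> \<noteq> {}" by blast
  then have "ball x t \<inter> frontier \<Omega> \<noteq> {}"
    using False by (intro connected_Int_frontier connected_ball) auto
  then obtain x0 where x0: "x0 \<in> frontier \<Omega>" "dist x x0 < t" by auto
  obtain h e where e: "norm e = 1" and h\<Omega>: "\<And>x. x \<in> ball x0 r0 \<Longrightarrow> x \<in> \<Omega> \<longleftrightarrow> 0 < h x" and hup: "\<And>x s. h (x + s *\<^sub>R e) = h x + s"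
    and hlip: "\<And>x y. \<bar>h x - h y\<bar> \<le> (1 + L) * norm (x - y)"
    using chart_height[OF x0(1)] by blast
  have "x \<in> ball x0 r0" using x0 t by (simp add: dist_commute)
  then have hx: "0 < h x" using h\<Omega> x by simp
  define y where "y = x + (t / 2) *\<^sub>R e"
  define \<tau> where "\<tau> = t / (2 * (2 + L))"
  have \<tau>: "0 < \<tau>" "(2 + L) * \<tau> = t / 2" using t L by (auto simp: \<tau>_def field_simps)
  have "1 * \<tau> \<le> (2 + L) * \<tau>" using \<tau>(1) L by (intro mult_right_mono) auto
  then have \<tau>2: "\<tau> \<le> t / 2" using \<tau>(2) by linarith
  have "w \<in> \<Omega> \<inter> ball x t" if w: "w \<in> ball y \<tau>" for w
  proof -
    have wy: "norm (w - y) < \<tau>" using w by (simp add: dist_norm norm_minus_commute)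
    have "norm (w - x) \<le> norm (w - y) + norm (y - x)" using norm_triangle_ineq[of "w - y" "y - x"] by simp
    moreover have "norm (y - x) = t / 2" using e t by (simp add: y_def)
    ultimately have wx: "norm (w - x) < t" using wy \<tau>2 by simp
    have "dist x0 w \<le> dist x x0 + dist x w" using dist_triangle3[of x0 w x] by simp
    then have "w \<in> ball x0 r0" using wx x0 t by (simp add: dist_norm norm_minus_commute)
    moreover have "0 < h w"
    proof -
      have "(1 + L) * norm (w - y) \<le> (1 + L) * \<tau>" using wy L by (intro mult_left_mono) auto
      also have "\<dots> < (2 + L) * \<tau>" using \<tau>(1) by (simp add: algebra_simps)
      finally have "(1 + L) * norm (w - y) < t / 2" using \<tau>(2) by simp
      moreover have "h y = h x + t / 2" unfolding y_def by (rule hup)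
      ultimately show ?thesis using hlip[of w y] hx by linarith
    qed
    ultimately show ?thesis using h\<Omega> wx by (simp add: dist_norm norm_minus_commute)
  qed
  then show ?thesis unfolding \<tau>_def by blast
qed

text \<open>A packing argument: balls of radius t around 2t-separated points are disjoint and each
  contains a fixed amount of the volume of \<Omega>, so finite measure bounds their number, and a
  separated set of maximal cardinality covers. Boundedness of \<Omega> is not assumed but follows
  from such a cover.\<close>

lemma finite_cover:
  assumes fin: "emeasure lebesgue \<Omega> < \<infinity>" and t: "0 < t" "t \<le> r0 / 2"
  shows "\<exists>P. finite P \<and> P \<subseteq> \<Omega> \<and> \<Omega> \<subseteq> (\<Union>z\<in>P. ball z (2 * t))"
proof -
  define \<tau> where "\<tau> = t / (2 * (2 + L))"
  have \<tau>: "0 < \<tau>" using t L by (simp add: \<tau>_def)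
  define m where "m = V1 * \<tau> powr n"
  have m: "0 < m" using V1 \<tau> by (simp add: m_def)
  have low: "ennreal m \<le> emeasure lebesgue (\<Omega> \<inter> ball x t)" if x: "x \<in> \<Omega>" for x
  proof -
    obtain y where y: "ball y \<tau> \<subseteq> \<Omega> \<inter> ball x t" using inner_ball[OF x t] unfolding \<tau>_def by blast
    have "ennreal m = emeasure lebesgue (ball y \<tau>)"
      using measure_ball_scaling[OF \<tau>, of y] by (simp add: m_def V1_def n emeasure_eq_measure2)
    also have "\<dots> \<le> emeasure lebesgue (\<Omega> \<inter> ball x t)" using y by (intro emeasure_mono ball_part_sets)
    finally show ?thesis .
  qed
  define sep where "sep S \<longleftrightarrow> finite S \<and> S \<subseteq> \<Omega> \<and> (\<forall>x\<in>S. \<forall>y\<in>S. x \<noteq> y \<longrightarrow> 2 * t \<le> dist x y)" for S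
  have card: "real (card S) \<le> measure lebesgue \<Omega> / m" if S: "sep S" for S
  proof -
    have disj: "disjoint_family_on (\<lambda>x. \<Omega> \<inter> ball x t) S"
      unfolding disjoint_family_on_def
    proof (intro ballI impI)
      fix x y assume xy: "x \<in> S" "y \<in> S" "x \<noteq> y"
      then have "2 * t \<le> dist x y" using S by (auto simp: sep_def)
      then have "z \<notin> ball y t" if "z \<in> ball x t" for z
        using that dist_triangle2[of x y z] by (simp add: dist_commute)
      then show "(\<Omega> \<inter> ball x t) \<inter> (\<Omega> \<inter> ball y t) = {}" by auto
    qed
    have "ennreal (real (card S) * m) = (\<Sum>x\<in>S. ennreal m)"
      using m by (simp add: ennreal_of_nat_eq_real_of_nat ennreal_mult)
    also have "\<dots> \<le> (\<Sum>x\<in>S. emeasure lebesgue (\<Omega> \<inter> ball x t))"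
      using S low by (intro sum_mono) (auto simp: sep_def)
    also have "\<dots> = emeasure lebesgue (\<Union>x\<in>S. \<Omega> \<inter> ball x t)"
      using S disj ball_part_sets by (intro sum_emeasure) (auto simp: sep_def)
    also have "\<dots> \<le> emeasure lebesgue \<Omega>" by (intro emeasure_mono \<Omega>_lebesgue) auto
    also have "\<dots> = ennreal (measure lebesgue \<Omega>)" using fin by (simp add: emeasure_eq_ennreal_measure)
    finally have "real (card S) * m \<le> measure lebesgue \<Omega>" by simp
    then show ?thesis using m by (simp add: field_simps)
  qed
  have "\<exists>S. sep S \<and> (\<forall>S'. sep S' \<longrightarrow> card S' \<le> card S)"
  proof (rule ex_has_greatest_nat[of sep "{}" card "Suc (nat \<lceil>measure lebesgue \<Omega> / m\<rceil>)"])
    show "sep {}" by (simp add: sep_def)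
    show "\<forall>S. sep S \<longrightarrow> card S < Suc (nat \<lceil>measure lebesgue \<Omega> / m\<rceil>)"
    proof (intro allI impI)
      fix S assume "sep S"
      from card[OF this] show "card S < Suc (nat \<lceil>measure lebesgue \<Omega> / m\<rceil>)" by linarith
    qed
  qed
  then obtain S where S: "sep S" "\<And>S'. sep S' \<Longrightarrow> card S' \<le> card S" by blast
  have "\<Omega> \<subseteq> (\<Union>z\<in>S. ball z (2 * t))"
  proof
    fix x assume x: "x \<in> \<Omega>"
    show "x \<in> (\<Union>z\<in>S. ball z (2 * t))"
    proof (rule ccontr)
      assume "x \<notin> (\<Union>z\<in>S. ball z (2 * t))"
      then have far: "\<And>z. z \<in> S \<Longrightarrow> 2 * t \<le> dist z x" by (auto simp: not_less)
      then have "x \<notin> S" using t by force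
      have "sep (insert x S)" using S(1) x far unfolding sep_def by (auto simp: dist_commute)
      then show False using S(2)[of "insert x S"] S(1) \<open>x \<notin> S\<close> by (auto simp: sep_def)
    qed
  qed
  then show ?thesis using S(1) by (auto simp: sep_def)
qed

text \<open>Radii above \<rho>/2 are reduced to the finite cover: since n - n/p \<ge> 0, the power
  of r dominates the same power of \<rho>/2, and the constant only grows by the number of balls. N
  is any positive bound for the L^p norms of \<open>Gv u\<close> and u.\<close>

lemma hardy_morrey_estimate:
  assumes fin: "emeasure lebesgue \<Omega> < \<infinity>"
  shows "\<exists>C>0. \<forall>u\<in>Cc_inf \<Omega>. \<forall>N>0. integrable lebesgue (\<lambda>x. norm (Gv u x) powr p) \<longrightarrow>
     (\<integral>x. norm (Gv u x) powr p \<partial>lebesgue) \<le> N powr p \<longrightarrow> (\<integral>x. \<bar>u x\<bar> powr p \<partial>lebesgue) \<le> N powr p \<longrightarrow>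
     (\<forall>x1\<in>\<Omega>. \<forall>r>0. (\<integral>x. indicator (\<Omega> \<inter> ball x1 r) x * (\<bar>u x\<bar> / d x) \<partial>lebesgue) \<le> C * N * r powr (n - n/p))"
proof -
  have "\<rho> \<le> \<rho> * (5 + KK)" using \<rho> by (simp add: algebra_simps)
  then have t: "0 < \<rho> / 4" "\<rho> / 4 \<le> r0 / 2" using \<rho> by linarith+
  obtain P where P: "finite P" "P \<subseteq> \<Omega>" "\<Omega> \<subseteq> (\<Union>z\<in>P. ball z (\<rho> / 2))"
    using finite_cover[OF fin t] by auto
  define C where "C = C_loc * (1 + real (card P))"
  have Cl: "0 < C_loc" using C_bd_pos by (simp add: C_loc_def)
  have C: "0 < C" using Cl by (simp add: C_def add_pos_nonneg)
  have lam: "0 \<le> n - n/p" using p n2 by (simp add: field_simps)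
  have "(\<integral>x. indicator (\<Omega> \<inter> ball x1 r) x * (\<bar>u x\<bar> / d x) \<partial>lebesgue) \<le> C * N * r powr (n - n/p)"
    if u: "u \<in> Cc_inf \<Omega>" and N: "0 < N" and iG: "integrable lebesgue (\<lambda>x. norm (Gv u x) powr p)"
      and G: "(\<integral>x. norm (Gv u x) powr p \<partial>lebesgue) \<le> N powr p" and U: "(\<integral>x. \<bar>u x\<bar> powr p \<partial>lebesgue) \<le> N powr p"
      and x1: "x1 \<in> \<Omega>" and r: "0 < r" for u N x1 r
  proof (cases "r \<le> \<rho> / 2")
    case True
    have "C_loc * N * r powr (n - n/p) \<le> C * N * r powr (n - n/p)"
      using Cl N unfolding C_def by (intro mult_right_mono) (auto simp: algebra_simps)
    then show ?thesis using local_estimate[OF u x1 r True N iG G U] by linarith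
  next
    case False
    have ii: "integrable lebesgue (\<lambda>x. indicator (\<Omega> \<inter> ball z s) x * (\<bar>u x\<bar> / d x))" for z s
      by (intro integrable_indicator_mult ud_integrable[OF u] ball_part_sets)
    have "(\<integral>x. indicator (\<Omega> \<inter> ball x1 r) x * (\<bar>u x\<bar> / d x) \<partial>lebesgue)
       \<le> (\<integral>x. (\<Sum>z\<in>P. indicator (\<Omega> \<inter> ball z (\<rho> / 2)) x * (\<bar>u x\<bar> / d x)) \<partial>lebesgue)"
    proof (rule Bochner_Integration.integral_mono[OF ii])
      show "integrable lebesgue (\<lambda>x. \<Sum>z\<in>P. indicator (\<Omega> \<inter> ball z (\<rho> / 2)) x * (\<bar>u x\<bar> / d x))"
        by (intro Bochner_Integration.integrable_sum ii)
      fix x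
      have nn: "0 \<le> indicator (\<Omega> \<inter> ball z s) x * (\<bar>u x\<bar> / d x)" for z s by simp
      show "indicator (\<Omega> \<inter> ball x1 r) x * (\<bar>u x\<bar> / d x) \<le> (\<Sum>z\<in>P. indicator (\<Omega> \<inter> ball z (\<rho> / 2)) x * (\<bar>u x\<bar> / d x))"
      proof (cases "x \<in> \<Omega> \<inter> ball x1 r")
        case True
        then obtain z where z: "z \<in> P" "x \<in> ball z (\<rho> / 2)" using P(3) by auto
        have "indicator (\<Omega> \<inter> ball x1 r) x * (\<bar>u x\<bar> / d x) = indicator (\<Omega> \<inter> ball z (\<rho> / 2)) x * (\<bar>u x\<bar> / d x)"
          using True z by simp
        also have "\<dots> \<le> (\<Sum>z\<in>P. indicator (\<Omega> \<inter> ball z (\<rho> / 2)) x * (\<bar>u x\<bar> / d x))"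
          using z P(1) nn by (intro member_le_sum) auto
        finally show ?thesis .
      next
        case False
        then have "indicator (\<Omega> \<inter> ball x1 r) x * (\<bar>u x\<bar> / d x) = 0" by simp
        also have "0 \<le> (\<Sum>z\<in>P. indicator (\<Omega> \<inter> ball z (\<rho> / 2)) x * (\<bar>u x\<bar> / d x))" using nn by (rule sum_nonneg)
        finally show ?thesis .
      qed
    qed
    also have "\<dots> = (\<Sum>z\<in>P. \<integral>x. indicator (\<Omega> \<inter> ball z (\<rho> / 2)) x * (\<bar>u x\<bar> / d x) \<partial>lebesgue)"
      by (rule Bochner_Integration.integral_sum[OF ii])
    also have "\<dots> \<le> (\<Sum>z\<in>P. C_loc * N * (\<rho> / 2) powr (n - n/p))"
      using P(2) \<rho>(1) by (intro sum_mono local_estimate[OF u _ _ _ N iG G U]) auto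
    also have "\<dots> = real (card P) * (C_loc * N * (\<rho> / 2) powr (n - n/p))" by simp
    also have "\<dots> \<le> (1 + real (card P)) * (C_loc * N * r powr (n - n/p))"
      using False \<rho>(1) lam Cl N by (intro mult_mono mult_left_mono powr_mono2) auto
    finally show ?thesis by (simp add: C_def mult_ac)
  qed
  with C show ?thesis by blast
qed

lemma F_grad_le: 
  assumes b: "\<And>x. F x \<le> b * norm x"
  shows "AE x in lebesgue. x \<in> \<Omega> \<longrightarrow> F (grad u x) \<le> b * norm (Gv u x) + c * (\<bar>u x\<bar> / d x)"
  using AE_F_gd
proof eventually_elim
  case (elim x)
  show ?case
  proof
    assume x: "x \<in> \<Omega>"
    have "F (grad u x) = F (Gv u x + (c * u x / d x) *\<^sub>R gd x)" by (simp add: Gv_def)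
    also have "\<dots> \<le> F (Gv u x) + \<bar>c * u x / d x\<bar> * F (gd x)" using F_triangle F_scaleR by metis
    also have "\<dots> = F (Gv u x) + c * (\<bar>u x\<bar> / d x)" using elim x c_bounds by (simp add: abs_mult)
    also have "\<dots> \<le> b * norm (Gv u x) + c * (\<bar>u x\<bar> / d x)" using b by simp
    finally show "F (grad u x) \<le> b * norm (Gv u x) + c * (\<bar>u x\<bar> / d x)" .
  qed
qed

lemma morrey_estimate:
  assumes fin: "emeasure lebesgue \<Omega> < \<infinity>"
  shows "\<exists>C>0. \<forall>u\<in>Cc_inf \<Omega>. \<forall>x1\<in>\<Omega>. \<forall>r>0.
     (LINT x:(\<Omega> \<inter> ball x1 r)|lebesgue. \<bar>F (grad u x)\<bar>) \<le> C * r powr (n - n/p) * I_p F p u \<Omega> powr (1/p)"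
proof -
  obtain k where k: "0 < k" and H: "\<And>u. u \<in> Cc_inf \<Omega> \<Longrightarrow> integrable lebesgue (\<lambda>x. norm (Gv u x) powr p) \<and>
     k * (\<integral>x. norm (Gv u x) powr p \<partial>lebesgue) \<le> I_p F p u \<Omega> \<and> k * (\<integral>x. \<bar>u x\<bar> powr p \<partial>lebesgue) \<le> I_p F p u \<Omega>"
    using hardy by blast
  obtain C where C: "0 < C" and HM: "\<And>u N x1 r. u \<in> Cc_inf \<Omega> \<Longrightarrow> 0 < N \<Longrightarrow> integrable lebesgue (\<lambda>x. norm (Gv u x) powr p) \<Longrightarrow>
     (\<integral>x. norm (Gv u x) powr p \<partial>lebesgue) \<le> N powr p \<Longrightarrow> (\<integral>x. \<bar>u x\<bar> powr p \<partial>lebesgue) \<le> N powr p \<Longrightarrow>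
     x1 \<in> \<Omega> \<Longrightarrow> 0 < r \<Longrightarrow> (\<integral>x. indicator (\<Omega> \<inter> ball x1 r) x * (\<bar>u x\<bar> / d x) \<partial>lebesgue) \<le> C * N * r powr (n - n/p)"
    using hardy_morrey_estimate[OF fin] by blast
  obtain b where b: "0 < b" "\<And>x. F x \<le> b * norm x" using F_bounds by blast
  define C' where "C' = b * 2 * V1 powr (1 - 1/p) + c * C"
  have C': "0 < C'" unfolding C'_def using b C c_bounds V1 by (intro add_pos_pos mult_pos_pos) auto
  have p1: "1 < p" using p by simp
  have main: "(LINT x:(\<Omega> \<inter> ball x1 r)|lebesgue. \<bar>F (grad u x)\<bar>) \<le> (C' * (1/k) powr (1/p)) * r powr (n - n/p) * I_p F p u \<Omega> powr (1/p)"
    if u: "u \<in> Cc_inf \<Omega>" and x1: "x1 \<in> \<Omega>" and r: "0 < r" for u x1 r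
  proof -
    define I where "I = I_p F p u \<Omega>"
    define X where "X = (LINT x:(\<Omega> \<inter> ball x1 r)|lebesgue. \<bar>F (grad u x)\<bar>)"
    define A where "A = \<Omega> \<inter> ball x1 r"
    have hI: "integrable lebesgue (\<lambda>x. norm (Gv u x) powr p)" "k * (\<integral>x. norm (Gv u x) powr p \<partial>lebesgue) \<le> I" "k * (\<integral>x. \<bar>u x\<bar> powr p \<partial>lebesgue) \<le> I"
      using H[OF u] unfolding I_def by auto
    have "0 \<le> k * (\<integral>x. \<bar>u x\<bar> powr p \<partial>lebesgue)" using k by (intro mult_nonneg_nonneg integral_nonneg_AE) auto
    then have I: "0 \<le> I" using hI(3) by linarith
    define N0 where "N0 = (I / k) powr (1/p)"
    have N0: "0 \<le> N0" "N0 powr p = I / k" using I k p by (auto simp: N0_def powr_powr)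
    \<comment> \<open>The preceding estimates require a positive N, while I may vanish; a bound for
      every N > N0 gives the one for N0.\<close>
    have Xle: "X \<le> (C' * r powr (n - n/p)) * N" if N: "N0 < N" for N
    proof -
      have N': "0 < N" using N N0 by simp
      have "I / k \<le> N powr p" using N N0 p by (metis less_imp_le powr_mono2 order_trans zero_le_numeral)
      then have G: "(\<integral>x. norm (Gv u x) powr p \<partial>lebesgue) \<le> N powr p" and U: "(\<integral>x. \<bar>u x\<bar> powr p \<partial>lebesgue) \<le> N powr p"
        using hI(2,3) k by (auto simp: pos_divide_le_eq mult.commute[of _ k] elim!: order_trans[rotated] intro: mult_left_le_imp_le[OF order_trans k])
      have Gm: "(\<lambda>x. norm (Gv u x)) \<in> borel_measurable lebesgue" using Gv_measurable[OF u] by simp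
      have V: "0 < V1 * r powr n" using V1 r by simp
      note hol = holder_set[OF p1 Gm norm_ge_zero hI(1) G N' ball_part(1,2)[OF r, of x1] V, folded A_def]
      have i1: "integrable lebesgue (\<lambda>x. indicator A x * (\<bar>u x\<bar> / d x))"
        unfolding A_def by (intro integrable_indicator_mult ud_integrable[OF u] ball_part_sets)
      have iF: "integrable lebesgue (\<lambda>x. indicator A x * \<bar>F (grad u x)\<bar>)"
        unfolding A_def using Cc_inf_support[OF u]
        by (intro integrable_indicator_mult ball_part_sets integrable_continuous_support[OF _ Cc_inf_support(1)[OF u]] continuous_intros
            continuous_on_compose2[OF F_continuous Cc_inf_grad_continuous[OF u]]) auto
      have "X = (\<integral>x. indicator A x * \<bar>F (grad u x)\<bar> \<partial>lebesgue)" by (simp add: X_def A_def set_lebesgue_integral_def)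
      also have "\<dots> \<le> (\<integral>x. b * (indicator A x * norm (Gv u x)) + c * (indicator A x * (\<bar>u x\<bar> / d x)) \<partial>lebesgue)"
      proof (rule integral_mono_AE[OF iF])
        show "integrable lebesgue (\<lambda>x. b * (indicator A x * norm (Gv u x)) + c * (indicator A x * (\<bar>u x\<bar> / d x)))"
          by (intro Bochner_Integration.integrable_add integrable_mult_right hol(1) i1)
        show "AE x in lebesgue. indicator A x * \<bar>F (grad u x)\<bar> \<le> b * (indicator A x * norm (Gv u x)) + c * (indicator A x * (\<bar>u x\<bar> / d x))"
          using F_grad_le[OF b(2), of u]
        proof eventually_elim
          case (elim x)
          then show ?case by (cases "x \<in> A") (auto simp: A_def)
        qed
      qed
      also have "\<dots> = b * (\<integral>x. indicator A x * norm (Gv u x) \<partial>lebesgue) + c * (\<integral>x. indicator A x * (\<bar>u x\<bar> / d x) \<partial>lebesgue)"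
        by (subst Bochner_Integration.integral_add[OF integrable_mult_right[OF hol(1)] integrable_mult_right[OF i1]])
           (simp only: integral_mult_right_zero)
      also have "\<dots> \<le> b * (2 * N * (V1 * r powr n) powr (1 - 1/p)) + c * (C * N * r powr (n - n/p))"
        using hol(2) HM[OF u N' hI(1) G U x1 r] b(1) c_bounds unfolding A_def by (intro add_mono mult_left_mono) auto
      also have "\<dots> = (C' * r powr (n - n/p)) * N"
        unfolding ball_part(3)[OF r] C'_def by (simp add: algebra_simps)
      finally show ?thesis .
    qed
    have pos: "0 < C' * r powr (n - n/p)" using C' r by simp
    have "X / (C' * r powr (n - n/p)) \<le> N0"
    proof (rule dense_ge)
      fix N assume "N0 < N"
      from Xle[OF this] show "X / (C' * r powr (n - n/p)) \<le> N" using pos by (simp add: pos_divide_le_eq mult.commute)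
    qed
    then have "X \<le> (C' * r powr (n - n/p)) * N0" using pos by (simp add: pos_divide_le_eq mult.commute)
    also have "N0 = (1/k) powr (1/p) * I powr (1/p)" unfolding N0_def using I k by (simp add: powr_mult[symmetric])
    finally show ?thesis unfolding X_def I_def by (simp add: mult_ac)
  qed
  show ?thesis using main C' k by (intro exI[of _ "C' * (1/k) powr (1/p)"]) auto
qed

end

theorem mainTheorem8:
  fixes F :: "real^'n::finite \<Rightarrow> real"
    and \<Omega> \<omega> :: "(real^'n) set"
    and \<alpha> p a \<delta> :: real
  assumes n2: "CARD('n) \<ge> 2"
    and F: "finsler_norm F"
    and alpha: "0 \<le> \<alpha>" "\<alpha> < 1"
    and p: "2 \<le> p" "p < real CARD('n) / (1 - \<alpha>)"
    and a_def: "a = (p - 1) * (1 - \<alpha>) * (real CARD('n) - 1) / (real CARD('n) - p * (1 - \<alpha>))"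
    and dom: "uniformly_lipschitz_domain \<Omega>"
    and fin_meas: "emeasure lebesgue \<Omega> < \<infinity>"
    and r_fin: "bdd_above (dF F \<Omega> ` \<Omega>)"
    and superh: "superharmonic_dF F \<Omega>"
    and delta: "\<delta> > 0"
    and omega: "open \<omega>" "compact (closure \<omega>)" "closure \<omega> \<subseteq> \<Omega>"
    and feeble: "feeble_regular F \<Omega> \<omega> (a - \<delta>)"
  shows "\<exists>C6 > 0. \<forall>u \<in> Cc_inf \<Omega>.
           morrey_norm1 (real CARD('n) - real CARD('n) / p) \<Omega> (\<lambda>x. F (grad u x))
             \<le> ereal (C6 * (I_p F p u \<Omega>) powr (1 / p))"
proof -
  obtain r0 L where r0: "0 < r0" "0 \<le> L" and chart: "\<And>x0. x0 \<in> frontier \<Omega> \<Longrightarrow> \<exists>e g. norm e = 1 \<and> L-lipschitz_on UNIV g \<and>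
          \<Omega> \<inter> ball x0 r0 = {x \<in> ball x0 r0. (x - x0) \<bullet> e > g ((x - x0) - ((x - x0) \<bullet> e) *\<^sub>R e)}"
    and domain: "domain \<Omega>"
    using dom unfolding uniformly_lipschitz_domain_def by blast
  obtain B where B: "\<And>x. x \<in> \<Omega> \<Longrightarrow> dF F \<Omega> x \<le> B" using r_fin unfolding bdd_above_def by blast
  \<comment> \<open>The maximum with 1 secures the positivity of R required by the locale.\<close>
  define R where "R = max 1 B"
  have R: "0 < R" "\<And>x. x \<in> \<Omega> \<Longrightarrow> dF F \<Omega> x \<le> R" using B by (auto simp: R_def le_max_iff_disj)
  interpret finsler_domain F \<Omega> by unfold_locales (use F domain in auto)
  interpret lipschitz_superharmonic_domain F \<Omega> p R r0 L "real CARD('n)"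
    by unfold_locales (use superh p R n2 r0 chart in auto)
  obtain C where C: "0 < C" and M: "\<And>u x1 r. u \<in> Cc_inf \<Omega> \<Longrightarrow> x1 \<in> \<Omega> \<Longrightarrow> 0 < r \<Longrightarrow>
     (LINT x:(\<Omega> \<inter> ball x1 r)|lebesgue. \<bar>F (grad u x)\<bar>) \<le> C * r powr (real CARD('n) - real CARD('n) / p) * I_p F p u \<Omega> powr (1/p)"
    using morrey_estimate[OF fin_meas] by blast
  have "morrey_norm1 (real CARD('n) - real CARD('n) / p) \<Omega> (\<lambda>x. F (grad u x)) \<le> ereal (C * I_p F p u \<Omega> powr (1 / p))"
    if u: "u \<in> Cc_inf \<Omega>" for u
    unfolding morrey_norm1_def
  proof (rule Sup_least, clarify)
    fix r x0 assume r: "0 < r" "ereal r < ediam \<Omega>" "x0 \<in> \<Omega>"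
    define lam where "lam = real CARD('n) - real CARD('n) / p"
    have "r powr (- lam) * (LINT x:(\<Omega> \<inter> ball x0 r)|lebesgue. \<bar>F (grad u x)\<bar>) \<le> r powr (- lam) * (C * r powr lam * I_p F p u \<Omega> powr (1/p))"
      unfolding lam_def by (intro mult_left_mono M u r) auto
    also have "\<dots> = (r powr (- lam) * r powr lam) * (C * I_p F p u \<Omega> powr (1/p))" by (simp only: mult_ac)
    also have "r powr (- lam) * r powr lam = 1" using r by (simp flip: powr_add)
    finally show "ereal (r powr - (real CARD('n) - real CARD('n) / p) * (LINT x:(\<Omega> \<inter> ball x0 r)|lebesgue. \<bar>F (grad u x)\<bar>))
        \<le> ereal (C * I_p F p u \<Omega> powr (1 / p))" by (simp add: lam_def)
  qed
  with C show ?thesis by blast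
qed

end
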